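(* Let $w\in W_{\mathrm{af}}^-$ and $\beta\in Q^\vee_<$. Then in $K_H(\mathrm{Gr})$, $$[\mathcal O_{\mathrm{Gr}_w}]\odot[\mathcal O_{\mathrm{Gr}_\beta}]=[\mathcal O_{\mathrm{Gr}_{wt_\beta}}].$$
   Context: $G$ is a connected, simply connected simple algebraic group over $\mathbb C$, with Borel $B$, maximal torus $H$, Weyl group $W$ with longest element $w_0$, weight lattice $P$, simple roots $\alpha_i$ ($i\in I$), highest root $\vartheta$ with coroot $\vartheta^\vee$, coroot lattice $Q^\vee$, $Q^\vee_<=\{\beta\in Q^\vee:\langle\beta,\alpha_i\rangle<0\ \forall i\in I\}$. $W_{\mathrm{af}}=W\ltimes Q^\vee$ with translations $t_\beta$, a Coxeter group generated by $s_i$, $i\in I_{\mathrm{af}}=I\cup\{0\}$, $s_\vartheta s_0=t_{-\vartheta^\vee}$; it acts on $P$ through $W_{\mathrm{af}}\to W$. $W_{\mathrm{af}}^-$ is the set of minimal length representatives of $W_{\mathrm{af}}/W$. $\mathbb CP$ is the group algebra of $P$, $\mathbb C(P)$ its fraction field. Nil-DAHA $\mathscr H$: generated by $e^\lambda$, $D_i$ ($i\in I_{\mathrm{af}}$) with $e^{\lambda+\mu}=e^\lambda e^\mu$, $D_i^2=D_i$, braid relations of $W_{\mathrm{af}}$, $D_ie^\lambda-e^{s_i\lambda}D_i=\frac{e^\lambda-e^{s_i\lambda}}{1-e^{\alpha_i}}$ ($i\in I$), $D_0e^\lambda-e^{s_\vartheta\lambda}D_0=\frac{e^\lambda-e^{s_\vartheta\lambda}}{1-e^{-\vartheta}}$;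 $D_w$ is the product along a reduced word of $w$. $\mathscr A=\mathbb C(P)\otimes\mathbb CW_{\mathrm{af}}$ with $(f\otimes w)(g\otimes v)=f\,w(g)\otimes wv$; algebra embedding $\iota^*:\mathscr H\to\mathscr A$: $e^\lambda\mapsto e^\lambda\otimes1$, $D_i\mapsto\frac1{1-e^{\alpha_i}}\otimes1-\frac{e^{\alpha_i}}{1-e^{\alpha_i}}\otimes s_i$ ($i\in I$), $D_0\mapsto\frac1{1-e^{-\vartheta}}\otimes1-\frac{e^{-\vartheta}}{1-e^{-\vartheta}}\otimes s_0$. $\mathrm{Gr}=G(\!(z)\!)/G[\![z]\!]$ with Iwahori-orbit closures $\mathrm{Gr}_\beta$ ($\beta\in Q^\vee$); for $v\in W_{\mathrm{af}}$, $\mathrm{Gr}_v:=\mathrm{Gr}_\beta$ where $v\in t_\beta W$. $K_H(\mathrm{Gr})=\bigoplus_\beta\mathbb CP[\mathcal O_{\mathrm{Gr}_\beta}]$, identified with the left ideal $\mathscr HD_{w_0}$ via $e^\lambda[\mathcal O_{\mathrm{Gr}_\beta}]\mapsto e^\lambda D_{t_\beta}D_{w_0}$. $\mathscr C=\mathbb C(P)\otimes\mathbb CQ^\vee\subset\mathscr A$ is commutative ($(f\otimes t_\beta)(g\otimes t_\gamma)=fg\otimes t_{\beta+\gamma}$); $\mathsf{pr}:\mathscr A\to\mathscr C$, $f\otimes t_\beta w\mapsto f\otimes t_\beta$ ($w\in W$). The map $\mathsf{pr}\circ\iota^*:K_H(\mathrm{Gr})\to\mathscr C$ is injective with image a subring;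 the induced commutative product on $K_H(\mathrm{Gr})$ is the Pontryagin product $\odot$. *)

theory Defs
  imports Complex_Main "HOL-Library.Poly_Mapping" "HOL-Computational_Algebra.Fraction_Field"
begin

text \<open>Conventions. The group G is given by its Cartan matrix A (indices I = {1..n});
  the affine node is 0. Weights (elements of P) are written in the basis of
  fundamental weights, coweights of the coroot lattice in the basis of simple coroots,
  root-lattice elements in the basis of simple roots; all as nat =>0 int with Poly_Mapping.keys in I.\<close>

type_synonym wt = "nat \<Rightarrow>\<^sub>0 int"

definition Iset :: "nat \<Rightarrow> nat set" where "Iset n = {1..n}"

definition gen_cartan :: "nat \<Rightarrow> (nat \<Rightarrow> nat \<Rightarrow> int) \<Rightarrow> bool" where
  "gen_cartan n A \<longleftrightarrow> (\<forall>i\<in>Iset n. A i i = 2) \<and>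
     (\<forall>i\<in>Iset n. \<forall>j\<in>Iset n. i \<noteq> j \<longrightarrow> A i j \<le> 0) \<and>
     (\<forall>i\<in>Iset n. \<forall>j\<in>Iset n. A i j = 0 \<longleftrightarrow> A j i = 0)"

definition finite_type :: "nat \<Rightarrow> (nat \<Rightarrow> nat \<Rightarrow> int) \<Rightarrow> bool" where
  "finite_type n A \<longleftrightarrow> (\<exists>d::nat \<Rightarrow> real. (\<forall>i\<in>Iset n. d i > 0) \<and>
     (\<forall>i\<in>Iset n. \<forall>j\<in>Iset n. d i * of_int (A i j) = d j * of_int (A j i)) \<and>
     (\<forall>x::nat \<Rightarrow> real. (\<exists>i\<in>Iset n. x i \<noteq> 0) \<longrightarrow>
        0 < (\<Sum>i\<in>Iset n. \<Sum>j\<in>Iset n. x i * d i * of_int (A i j) * x j)))"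

definition indecomposable :: "nat \<Rightarrow> (nat \<Rightarrow> nat \<Rightarrow> int) \<Rightarrow> bool" where
  "indecomposable n A \<longleftrightarrow> (\<forall>J. J \<subseteq> Iset n \<longrightarrow> J \<noteq> {} \<longrightarrow> J \<noteq> Iset n \<longrightarrow>
     (\<exists>i\<in>J. \<exists>j\<in>Iset n - J. A i j \<noteq> 0))"

definition simple_cartan :: "nat \<Rightarrow> (nat \<Rightarrow> nat \<Rightarrow> int) \<Rightarrow> bool" where
  "simple_cartan n A \<longleftrightarrow> 1 \<le> n \<and> gen_cartan n A \<and> finite_type n A \<and> indecomposable n A"

definition in_lattice :: "nat \<Rightarrow> wt \<Rightarrow> bool" where
  "in_lattice n x \<longleftrightarrow> Poly_Mapping.keys x \<subseteq> Iset n"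

definition alphaW :: "nat \<Rightarrow> (nat \<Rightarrow> nat \<Rightarrow> int) \<Rightarrow> nat \<Rightarrow> wt" where
  "alphaW n A j = (\<Sum>k\<in>Iset n. Poly_Mapping.single k (A k j))"

text \<open>pairing <beta, lambda> of a coroot-lattice element with a weight\<close>
definition pairing :: "nat \<Rightarrow> wt \<Rightarrow> wt \<Rightarrow> int" where
  "pairing n \<beta> \<mu> = (\<Sum>i\<in>Iset n. Poly_Mapping.lookup \<beta> i * Poly_Mapping.lookup \<mu> i)"

definition sP :: "nat \<Rightarrow> (nat \<Rightarrow> nat \<Rightarrow> int) \<Rightarrow> nat \<Rightarrow> wt \<Rightarrow> wt" where
  "sP n A i \<mu> = \<mu> - frag_cmul (Poly_Mapping.lookup \<mu> i) (alphaW n A i)"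

definition sQ :: "nat \<Rightarrow> (nat \<Rightarrow> nat \<Rightarrow> int) \<Rightarrow> nat \<Rightarrow> wt \<Rightarrow> wt" where
  "sQ n A i \<beta> = \<beta> - Poly_Mapping.single i (pairing n \<beta> (alphaW n A i))"

text \<open>simple reflection on the root lattice (simple-root coordinates)\<close>
definition sR :: "nat \<Rightarrow> (nat \<Rightarrow> nat \<Rightarrow> int) \<Rightarrow> nat \<Rightarrow> wt \<Rightarrow> wt" where
  "sR n A i \<gamma> = \<gamma> - Poly_Mapping.single i (\<Sum>j\<in>Iset n. A i j * Poly_Mapping.lookup \<gamma> j)"

text \<open>pairs (root, its coroot): (w alpha_i, w alpha_i^vee)\<close>
inductive_set rootpairs :: "nat \<Rightarrow> (nat \<Rightarrow> nat \<Rightarrow> int) \<Rightarrow> (wt \<times> wt) set"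
  for n A where
  simple: "i \<in> Iset n \<Longrightarrow> (Poly_Mapping.single i 1, Poly_Mapping.single i 1) \<in> rootpairs n A"
| refl: "(\<gamma>, c) \<in> rootpairs n A \<Longrightarrow> i \<in> Iset n \<Longrightarrow> (sR n A i \<gamma>, sQ n A i c) \<in> rootpairs n A"

definition roots :: "nat \<Rightarrow> (nat \<Rightarrow> nat \<Rightarrow> int) \<Rightarrow> wt set" where
  "roots n A = fst ` rootpairs n A"

definition thetaR :: "nat \<Rightarrow> (nat \<Rightarrow> nat \<Rightarrow> int) \<Rightarrow> wt" where
  "thetaR n A = (THE \<theta>. \<theta> \<in> roots n A \<and> (\<forall>\<gamma>\<in>roots n A. \<forall>i. Poly_Mapping.lookup \<gamma> i \<le> Poly_Mapping.lookup \<theta> i))"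

definition thetaV :: "nat \<Rightarrow> (nat \<Rightarrow> nat \<Rightarrow> int) \<Rightarrow> wt" where
  "thetaV n A = (THE c. (thetaR n A, c) \<in> rootpairs n A)"

definition thetaW :: "nat \<Rightarrow> (nat \<Rightarrow> nat \<Rightarrow> int) \<Rightarrow> wt" where
  "thetaW n A = (\<Sum>j\<in>Iset n. frag_cmul (Poly_Mapping.lookup (thetaR n A) j) (alphaW n A j))"

definition sthP :: "nat \<Rightarrow> (nat \<Rightarrow> nat \<Rightarrow> int) \<Rightarrow> wt \<Rightarrow> wt" where
  "sthP n A \<mu> = \<mu> - frag_cmul (pairing n (thetaV n A) \<mu>) (thetaW n A)"

definition sthQ :: "nat \<Rightarrow> (nat \<Rightarrow> nat \<Rightarrow> int) \<Rightarrow> wt \<Rightarrow> wt" where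
  "sthQ n A \<beta> = \<beta> - frag_cmul (pairing n \<beta> (thetaW n A)) (thetaV n A)"

text \<open>Elements of W_af = W |x Q^vee: (beta, f, g) stands for t_beta w, where w acts on P
  by f and on Q^vee by g.\<close>
type_synonym waf = "wt \<times> (wt \<Rightarrow> wt) \<times> (wt \<Rightarrow> wt)"

definition wmul :: "waf \<Rightarrow> waf \<Rightarrow> waf" where
  "wmul x y = (case x of (b1, f1, g1) \<Rightarrow> case y of (b2, f2, g2) \<Rightarrow>
      (b1 + g1 b2, f1 \<circ> f2, g1 \<circ> g2))"

definition wone :: waf where "wone = (0, id, id)"

definition transl :: "wt \<Rightarrow> waf" where "transl \<beta> = (\<beta>, id, id)"

definition gen :: "nat \<Rightarrow> (nat \<Rightarrow> nat \<Rightarrow> int) \<Rightarrow> nat \<Rightarrow> waf" where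
  "gen n A i = (if i = 0 then (thetaV n A, sthP n A, sthQ n A) else (0, sP n A i, sQ n A i))"

definition word_eval :: "nat \<Rightarrow> (nat \<Rightarrow> nat \<Rightarrow> int) \<Rightarrow> nat list \<Rightarrow> waf" where
  "word_eval n A ws = foldr (\<lambda>i x. wmul (gen n A i) x) ws wone"

definition Waf :: "nat \<Rightarrow> (nat \<Rightarrow> nat \<Rightarrow> int) \<Rightarrow> waf set" where
  "Waf n A = {word_eval n A ws | ws. set ws \<subseteq> {0..n}}"

definition Wfin :: "nat \<Rightarrow> (nat \<Rightarrow> nat \<Rightarrow> int) \<Rightarrow> waf set" where
  "Wfin n A = {word_eval n A ws | ws. set ws \<subseteq> Iset n}"

definition len :: "nat \<Rightarrow> (nat \<Rightarrow> nat \<Rightarrow> int) \<Rightarrow> waf \<Rightarrow> nat" where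
  "len n A x = (LEAST k. \<exists>ws. set ws \<subseteq> {0..n} \<and> length ws = k \<and> word_eval n A ws = x)"

definition reduced_word :: "nat \<Rightarrow> (nat \<Rightarrow> nat \<Rightarrow> int) \<Rightarrow> waf \<Rightarrow> nat list \<Rightarrow> bool" where
  "reduced_word n A x ws \<longleftrightarrow> set ws \<subseteq> {0..n} \<and> word_eval n A ws = x \<and> length ws = len n A x"

definition Waf_minus :: "nat \<Rightarrow> (nat \<Rightarrow> nat \<Rightarrow> int) \<Rightarrow> waf set" where
  "Waf_minus n A = {x \<in> Waf n A. \<forall>v\<in>Wfin n A. len n A x \<le> len n A (wmul x v)}"

definition w0 :: "nat \<Rightarrow> (nat \<Rightarrow> nat \<Rightarrow> int) \<Rightarrow> waf" where
  "w0 n A = (THE x. x \<in> Wfin n A \<and> (\<forall>y\<in>Wfin n A. len n A y \<le> len n A x))"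

text \<open>CP = group algebra of P, K = C(P) its fraction field\<close>
type_synonym CP = "wt \<Rightarrow>\<^sub>0 complex"
type_synonym K = "CP fract"

definition eK :: "wt \<Rightarrow> K" where "eK \<mu> = Fract (Poly_Mapping.single \<mu> 1) 1"

definition actCP :: "(wt \<Rightarrow> wt) \<Rightarrow> CP \<Rightarrow> CP" where
  "actCP f c = (\<Sum>\<mu>\<in>Poly_Mapping.keys c. Poly_Mapping.single (f \<mu>) (Poly_Mapping.lookup c \<mu>))"

definition actK :: "(wt \<Rightarrow> wt) \<Rightarrow> K \<Rightarrow> K" where
  "actK f x = (SOME y. \<forall>a b. b \<noteq> 0 \<longrightarrow> x = Fract a b \<longrightarrow> y = Fract (actCP f a) (actCP f b))"

text \<open>The algebra A = C(P) # C W_af, elements as finitely supported W_af => C(P)\<close>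
type_synonym Aalg = "waf \<Rightarrow>\<^sub>0 K"

definition amul :: "Aalg \<Rightarrow> Aalg \<Rightarrow> Aalg" where
  "amul X Y = (\<Sum>w\<in>Poly_Mapping.keys X. \<Sum>v\<in>Poly_Mapping.keys Y.
      Poly_Mapping.single (wmul w v) (Poly_Mapping.lookup X w * actK (fst (snd w)) (Poly_Mapping.lookup Y v)))"

definition aone :: Aalg where "aone = Poly_Mapping.single wone 1"

definition iD :: "nat \<Rightarrow> (nat \<Rightarrow> nat \<Rightarrow> int) \<Rightarrow> nat \<Rightarrow> Aalg" where
  "iD n A i = (let a = (if i = 0 then - thetaW n A else alphaW n A i) in
     Poly_Mapping.single wone (1 / (1 - eK a))
     - Poly_Mapping.single (gen n A i) (eK a / (1 - eK a)))"

definition Dimg :: "nat \<Rightarrow> (nat \<Rightarrow> nat \<Rightarrow> int) \<Rightarrow> waf \<Rightarrow> Aalg" where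
  "Dimg n A x = foldr amul (map (iD n A) (SOME ws. reduced_word n A x ws)) aone"

text \<open>C = C(P) (x) C Q^vee, with product = convolution in the Q^vee variable\<close>
type_synonym Calg = "wt \<Rightarrow>\<^sub>0 K"

definition pr :: "Aalg \<Rightarrow> Calg" where
  "pr X = (\<Sum>w\<in>Poly_Mapping.keys X. Poly_Mapping.single (fst w) (Poly_Mapping.lookup X w))"

text \<open>K_H(Gr) = finite sums of e^lambda [O_{Gr_beta}], as maps beta => coefficient in CP\<close>
type_synonym KH = "wt \<Rightarrow>\<^sub>0 CP"

definition KHset :: "nat \<Rightarrow> KH set" where
  "KHset n = {x. (\<forall>\<beta>\<in>Poly_Mapping.keys x. in_lattice n \<beta>) \<and>
      (\<forall>\<beta>. \<forall>\<mu>\<in>Poly_Mapping.keys (Poly_Mapping.lookup x \<beta>). in_lattice n \<mu>)}"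

definition OGr :: "wt \<Rightarrow> KH" where "OGr \<beta> = Poly_Mapping.single \<beta> 1"

text \<open>pr o iota^* on K_H(Gr): e^lambda [O_Gr_beta] |-> pr(iota^*(e^lambda D_{t_beta} D_{w_0}))\<close>
definition Phi :: "nat \<Rightarrow> (nat \<Rightarrow> nat \<Rightarrow> int) \<Rightarrow> KH \<Rightarrow> Calg" where
  "Phi n A x = (\<Sum>\<beta>\<in>Poly_Mapping.keys x. pr (amul (Poly_Mapping.single wone (Fract (Poly_Mapping.lookup x \<beta>) 1))
        (amul (Dimg n A (transl \<beta>)) (Dimg n A (w0 n A)))))"

definition pontryagin :: "nat \<Rightarrow> (nat \<Rightarrow> nat \<Rightarrow> int) \<Rightarrow> KH \<Rightarrow> KH \<Rightarrow> KH" where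
  "pontryagin n A x y = inv_into (KHset n) (Phi n A) (Phi n A x * Phi n A y)"

end

theory Submission
  imports Defs "HOL-Library.Product_Plus"
begin

text \<open>
  The map \<open>pr\<close> is the quotient of the twisted group algebra by the left ideal that kills \<open>w - 1\<close>,
  \<open>w \<in> W\<close>, so \<open>pr (X Y)\<close> depends on \<open>Y\<close> only through \<open>pr Y\<close>. Each \<open>D\<^sub>i\<close> with \<open>i \<in> I\<close> fixes \<open>1\<close>,
  hence the class of \<open>Gr\<^sub>x\<close> is sent to \<open>D\<^sub>x 1\<close> for the minimal representative \<open>x\<close> of \<open>x W\<close>. For \<open>\<beta>\<close>
  strictly antidominant \<open>s\<^sub>i t\<^sub>\<beta> < t\<^sub>\<beta>\<close> for all \<open>i \<in> I\<close>, so \<open>D\<^sub>i D\<^bsub>t\<beta>\<^esub> = D\<^bsub>t\<beta>\<^esub>\<close> and \<open>D\<^bsub>t\<beta>\<^esub> 1\<close> is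
  \<open>W\<close>-invariant; multiplication by a \<open>W\<close>-invariant element commutes with every \<open>D\<^sub>i\<close>, also with
  \<open>D\<^sub>0\<close>. Therefore \<open>(D\<^sub>w 1) (D\<^bsub>t\<beta>\<^esub> 1) = D\<^sub>w D\<^bsub>t\<beta>\<^esub> 1\<close>, and the lengths of \<open>w\<close> and \<open>t\<^sub>\<beta>\<close> add up.
  The elements \<open>D\<^sub>x 1\<close> are independent because they are triangular with respect to the length.
\<close>

section \<open>Lattices and reflections\<close>

text \<open>The definitions make choices: \<open>Dimg\<close> picks some reduced word,
  \<open>thetaR\<close>, \<open>thetaV\<close> and \<open>w0\<close> are definite descriptions,
  \<open>pontryagin\<close> inverts \<open>Phi\<close>. Most of the work shows that these choices
  are harmless. The data are a bare Cartan matrix, so signs and finiteness of roots and the highest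
  root come from the positive definite form; affine length and exchange come from the action on
  roots mu + m delta. Since \<open>Waf\<close> is defined by words, an extra argument is required to
  see that it contains every translation by the coroot lattice. Independence of the reduced word
  combines Matsumoto's theorem with explicit rank 2 braid relations. Products are evaluated as
  compositions of operators on C(P) tensor CQ^vee instead of in the twisted group algebra. There
  e^delta counts as 1: the denominators see only the finite parts of affine roots, so rank 2
  subsystems of infinite type must be excluded before a braid relation is applied.\<close>

abbreviation lk :: "('a \<Rightarrow>\<^sub>0 'b::zero) \<Rightarrow> 'a \<Rightarrow> 'b" where "lk \<equiv> Poly_Mapping.lookup"
abbreviation msingle :: "'a \<Rightarrow> 'b \<Rightarrow> 'a \<Rightarrow>\<^sub>0 'b::zero" where "msingle \<equiv> Poly_Mapping.single"
abbreviation mkeys :: "('a \<Rightarrow>\<^sub>0 'b::zero) \<Rightarrow> 'a set" where "mkeys \<equiv> Poly_Mapping.keys"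
abbreviation fc :: "int \<Rightarrow> wt \<Rightarrow> wt" where "fc \<equiv> frag_cmul"
abbreviation sg :: "nat \<Rightarrow> wt" where "sg i \<equiv> msingle i 1"

lemma pairing_linear [simp]:
  "pairing n (x + y) z = pairing n x z + pairing n y z"
  "pairing n z (x + y) = pairing n z x + pairing n z y"
  "pairing n (x - y) z = pairing n x z - pairing n y z"
  "pairing n z (x - y) = pairing n z x - pairing n z y"
  "pairing n (- x) z = - pairing n x z"
  "pairing n z (- x) = - pairing n z x"
  "pairing n (fc k x) z = k * pairing n x z"
  "pairing n z (fc k x) = k * pairing n z x"
  "pairing n 0 z = 0" "pairing n z 0 = 0"
  unfolding pairing_def
  by (simp_all add: lookup_add lookup_minus algebra_simps sum.distrib sum_subtractf sum_negf sum_distrib_left)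

lemma pairing_sum_right: "pairing n c (sum f S) = (\<Sum>j\<in>S. pairing n c (f j))"
  by (induction S rule: infinite_finite_induct) auto

lemma pairing_single [simp]: "i \<in> Iset n \<Longrightarrow> pairing n (msingle i k) \<mu> = k * lk \<mu> i"
  unfolding pairing_def
  by (subst sum.remove[of _ i]) (auto simp: Iset_def lookup_single when_def)

lemma finite_Iset [simp]: "finite (Iset n)" by (simp add: Iset_def)

lemma in_lattice_iff: "in_lattice n x \<longleftrightarrow> (\<forall>i. i \<notin> Iset n \<longrightarrow> lk x i = 0)"
  unfolding in_lattice_def by (auto simp: in_keys_iff)

lemma in_lattice_simps [simp]:
  "in_lattice n 0"
  "in_lattice n x \<Longrightarrow> in_lattice n y \<Longrightarrow> in_lattice n (x + y)"
  "in_lattice n x \<Longrightarrow> in_lattice n y \<Longrightarrow> in_lattice n (x - y)"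
  "in_lattice n x \<Longrightarrow> in_lattice n (fc k x)"
  "in_lattice n x \<Longrightarrow> in_lattice n (- x)"
  "i \<in> Iset n \<Longrightarrow> in_lattice n (msingle i k)"
  by (auto simp: in_lattice_iff lookup_add lookup_minus lookup_single when_def)

lemma in_lattice_eqI:
  "in_lattice n x \<Longrightarrow> in_lattice n y \<Longrightarrow> (\<And>i. i \<in> Iset n \<Longrightarrow> lk x i = lk y i) \<Longrightarrow> x = y"
  by (rule poly_mapping_eqI) (metis in_lattice_iff)

lemma lookup_alphaW: "lk (alphaW n A j) i = (if i \<in> Iset n then A i j else 0)"
  unfolding alphaW_def by (auto simp: lookup_sum lookup_single when_def)

lemma fc_single: "fc k (msingle i l) = msingle i (k * l)"
  by (rule poly_mapping_eqI) (simp add: lookup_single when_def)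

lemma obtain_max:
  fixes f :: "'a \<Rightarrow> 'b::linorder"
  assumes "finite S" "S \<noteq> {}"
  obtains x where "x \<in> S" "\<And>y. y \<in> S \<Longrightarrow> f y \<le> f x"
  using Max_in[of "f ` S"] Max_ge[of "f ` S"] assms by (metis finite_imageI imageE image_eqI image_is_empty)

text \<open>The Cartan matrix as a change of coordinates: signs and heights of a root are read off
  in simple-root coordinates, pairings and the action on P in fundamental-weight
  coordinates.\<close>

definition toW :: "nat \<Rightarrow> (nat \<Rightarrow> nat \<Rightarrow> int) \<Rightarrow> wt \<Rightarrow> wt" where
  "toW n A \<gamma> = (\<Sum>j\<in>Iset n. fc (lk \<gamma> j) (alphaW n A j))"

lemma lookup_toW: "lk (toW n A \<gamma>) i = (if i \<in> Iset n then (\<Sum>j\<in>Iset n. A i j * lk \<gamma> j) else 0)"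
  unfolding toW_def by (auto simp: lookup_sum lookup_alphaW mult.commute)

lemma toW_linear [simp]:
  "toW n A (x + y) = toW n A x + toW n A y"
  "toW n A (x - y) = toW n A x - toW n A y"
  "toW n A (- x) = - toW n A x"
  "toW n A (fc k x) = fc k (toW n A x)"
  "toW n A 0 = 0"
  by (rule poly_mapping_eqI, simp add: lookup_toW lookup_add lookup_minus algebra_simps sum.distrib
      sum_subtractf sum_negf sum_distrib_left)+

lemma toW_single [simp]: "i \<in> Iset n \<Longrightarrow> toW n A (msingle i k) = fc k (alphaW n A i)"
  unfolding toW_def
  by (subst sum.remove[of _ i]) (auto simp: lookup_single when_def)

lemma thetaW_toW: "thetaW n A = toW n A (thetaR n A)"
  by (simp add: thetaW_def toW_def)

text \<open>Stated for an arbitrary pair of coroot and root, so that the simple reflections and the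
  linear part of s_0 are instances of one formula; \<open>reflQ\<close> is its transpose for the
  pairing.\<close>

definition reflP :: "nat \<Rightarrow> wt \<Rightarrow> wt \<Rightarrow> wt \<Rightarrow> wt" where
  "reflP n c \<alpha> \<mu> = \<mu> - fc (pairing n c \<mu>) \<alpha>"

definition reflQ :: "nat \<Rightarrow> wt \<Rightarrow> wt \<Rightarrow> wt \<Rightarrow> wt" where
  "reflQ n c \<alpha> \<beta> = \<beta> - fc (pairing n \<beta> \<alpha>) c"

lemma reflP_linear [simp]:
  "reflP n c \<alpha> (x + y) = reflP n c \<alpha> x + reflP n c \<alpha> y"
  "reflP n c \<alpha> (x - y) = reflP n c \<alpha> x - reflP n c \<alpha> y"
  "reflP n c \<alpha> (- x) = - reflP n c \<alpha> x"
  "reflP n c \<alpha> (fc k x) = fc k (reflP n c \<alpha> x)"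
  "reflP n c \<alpha> 0 = 0"
  by (rule poly_mapping_eqI, simp add: reflP_def lookup_add lookup_minus algebra_simps)+

lemma reflQ_linear [simp]:
  "reflQ n c \<alpha> (x + y) = reflQ n c \<alpha> x + reflQ n c \<alpha> y"
  "reflQ n c \<alpha> (x - y) = reflQ n c \<alpha> x - reflQ n c \<alpha> y"
  "reflQ n c \<alpha> (- x) = - reflQ n c \<alpha> x"
  "reflQ n c \<alpha> (fc k x) = fc k (reflQ n c \<alpha> x)"
  "reflQ n c \<alpha> 0 = 0"
  by (rule poly_mapping_eqI, simp add: reflQ_def lookup_add lookup_minus algebra_simps)+

lemma reflP_uminus: "reflP n (- c) (- \<alpha>) = reflP n c \<alpha>" "reflQ n (- c) (- \<alpha>) = reflQ n c \<alpha>"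
  by (rule ext, rule poly_mapping_eqI, simp add: reflP_def reflQ_def lookup_minus)+

lemma refl_invol:
  assumes "pairing n c \<alpha> = 2"
  shows "reflP n c \<alpha> (reflP n c \<alpha> \<mu>) = \<mu>" "reflQ n c \<alpha> (reflQ n c \<alpha> \<beta>) = \<beta>"
  by (rule poly_mapping_eqI, simp add: reflP_def reflQ_def lookup_minus assms)+

lemma refl_pairing:
  assumes "pairing n c \<alpha> = 2"
  shows "pairing n (reflQ n c \<alpha> \<beta>) (reflP n c \<alpha> \<mu>) = pairing n \<beta> \<mu>"
  by (simp add: reflP_def reflQ_def assms)

lemma refl_adjoint: "pairing n (reflQ n c \<alpha> \<beta>) \<mu> = pairing n \<beta> (reflP n c \<alpha> \<mu>)"
  by (simp add: reflP_def reflQ_def)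

text \<open>Here \<open>\<gamma>\<close> and \<open>x\<close> are in simple-root coordinates, whereas \<open>reflP\<close> uses weight coordinates.\<close>

definition reflR :: "nat \<Rightarrow> (nat \<Rightarrow> nat \<Rightarrow> int) \<Rightarrow> wt \<Rightarrow> wt \<Rightarrow> wt \<Rightarrow> wt" where
  "reflR n A c \<gamma> x = x - fc (pairing n c (toW n A x)) \<gamma>"

lemma toW_reflR [simp]: "toW n A (reflR n A c \<gamma> x) = reflP n c (toW n A \<gamma>) (toW n A x)"
  by (simp add: reflR_def reflP_def)

lemma sP_refl: "i \<in> Iset n \<Longrightarrow> sP n A i = reflP n (sg i) (alphaW n A i)"
  by (rule ext) (simp add: sP_def reflP_def)

lemma sQ_refl: "i \<in> Iset n \<Longrightarrow> sQ n A i = reflQ n (sg i) (alphaW n A i)"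
  by (rule ext) (simp add: sQ_def reflQ_def fc_single)

lemma sR_refl: "i \<in> Iset n \<Longrightarrow> sR n A i = reflR n A (sg i) (sg i)"
  by (rule ext) (simp add: sR_def reflR_def fc_single lookup_toW)

lemma fc_uminus [simp]: "fc k (- x) = fc (- k) x"
  by (rule poly_mapping_eqI) simp

section \<open>Finite root systems\<close>

locale cartan =
  fixes n :: nat and A :: "nat \<Rightarrow> nat \<Rightarrow> int" and d :: "nat \<Rightarrow> real"
  assumes n_pos: "1 \<le> n"
    and A_diag: "i \<in> Iset n \<Longrightarrow> A i i = 2"
    and A_le: "i \<in> Iset n \<Longrightarrow> j \<in> Iset n \<Longrightarrow> i \<noteq> j \<Longrightarrow> A i j \<le> 0"
    and A_zero: "i \<in> Iset n \<Longrightarrow> j \<in> Iset n \<Longrightarrow> A i j = 0 \<longleftrightarrow> A j i = 0"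
    and d_pos: "i \<in> Iset n \<Longrightarrow> 0 < d i"
    and d_sym: "i \<in> Iset n \<Longrightarrow> j \<in> Iset n \<Longrightarrow> d i * of_int (A i j) = d j * of_int (A j i)"
    and posdef: "\<And>x::nat \<Rightarrow> real. \<exists>i\<in>Iset n. x i \<noteq> 0 \<Longrightarrow>
        0 < (\<Sum>i\<in>Iset n. \<Sum>j\<in>Iset n. x i * d i * of_int (A i j) * x j)"
    and indec: "indecomposable n A"
begin

abbreviation "I \<equiv> Iset n"
abbreviation pair ("\<langle>_,_\<rangle>") where "pair \<equiv> pairing n"
abbreviation "tW \<equiv> toW n A"
abbreviation "RP \<equiv> rootpairs n A"
abbreviation "L \<equiv> in_lattice n"

section \<open>The invariant form and the norms of roots\<close>

definition form :: "wt \<Rightarrow> wt \<Rightarrow> real" where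
  "form x y = (\<Sum>i\<in>I. \<Sum>j\<in>I. of_int (lk x i) * d i * of_int (A i j) * of_int (lk y j))"

lemma form_alt: "form x y = (\<Sum>i\<in>I. of_int (lk x i) * d i * of_int (lk (tW y) i))"
  unfolding form_def
  by (rule sum.cong[OF HOL.refl]) (simp add: lookup_toW sum_distrib_left algebra_simps)

lemma form_sym: "form x y = form y x"
proof -
  have "form x y = (\<Sum>j\<in>I. \<Sum>i\<in>I. of_int (lk x i) * d i * of_int (A i j) * of_int (lk y j))"
    unfolding form_def by (rule sum.swap)
  also have "\<dots> = form y x" unfolding form_def
  proof (intro sum.cong HOL.refl)
    fix j i assume "j \<in> I" "i \<in> I"
    then have *: "d i * of_int (A i j) = d j * of_int (A j i)" by (rule d_sym[rotated])
    have "of_int (lk x i) * d i * of_int (A i j) * of_int (lk y j)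
      = of_int (lk x i) * (d i * of_int (A i j)) * of_int (lk y j)" by simp
    also have "\<dots> = of_int (lk y j) * d j * of_int (A j i) * of_int (lk x i)"
      unfolding * by simp
    finally show "of_int (lk x i) * d i * of_int (A i j) * of_int (lk y j) = \<dots>" .
  qed
  finally show ?thesis .
qed

lemma form_linear [simp]:
  "form (x + y) z = form x z + form y z"
  "form (x - y) z = form x z - form y z"
  "form (- x) z = - form x z"
  "form (fc k x) z = of_int k * form x z"
  unfolding form_alt
  by (simp_all add: lookup_add lookup_minus algebra_simps sum.distrib sum_subtractf sum_negf sum_distrib_left)

lemma form_linear_right [simp]:
  "form z (x + y) = form z x + form z y"
  "form z (x - y) = form z x - form z y"
  "form z (- x) = - form z x"
  "form z (fc k x) = of_int k * form z x"
  by (simp_all add: form_sym[of z])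

lemma form_pos: "L x \<Longrightarrow> x \<noteq> 0 \<Longrightarrow> 0 < form x x"
  unfolding form_def by (rule posdef) (metis in_lattice_eqI in_lattice_simps(1) lookup_zero of_int_eq_0_iff)

lemma form_nonneg: "L x \<Longrightarrow> 0 \<le> form x x"
  using form_pos[of x] by (cases "x = 0") (auto simp: form_def)

lemma form_single: "i \<in> I \<Longrightarrow> form (sg i) y = d i * of_int (lk (tW y) i)"
  unfolding form_alt by (subst sum.remove[of _ i]) (auto simp: lookup_single when_def)

lemma toW_inj: "L x \<Longrightarrow> L y \<Longrightarrow> tW x = tW y \<Longrightarrow> x = y"
  using form_pos[of "x - y"] by (force simp: form_alt)

text \<open>Here e is half the squared length of gamma, and the last clause says that the coroot is
  the functional (gamma, .) / e. So \<open>form\<close> and \<open>pairing\<close> can be exchanged,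
  and symmetry of the form relates the two Cartan integers of a pair of roots.\<close>

definition root_norm :: "wt \<Rightarrow> wt \<Rightarrow> real \<Rightarrow> bool" where
  "root_norm \<gamma> c e \<longleftrightarrow> L \<gamma> \<and> L c \<and> 0 < e \<and> form \<gamma> \<gamma> = 2 * e \<and> (\<forall>i\<in>I. d i * of_int (lk \<gamma> i) = e * of_int (lk c i))"

lemma root_norm_form:
  assumes "root_norm \<gamma> c e"
  shows "form \<gamma> x = e * of_int \<langle>c,tW x\<rangle>"
proof -
  have "form \<gamma> x = (\<Sum>i\<in>I. (d i * of_int (lk \<gamma> i)) * of_int (lk (tW x) i))"
    unfolding form_alt by (intro sum.cong) (auto simp: algebra_simps)
  also have "\<dots> = (\<Sum>i\<in>I. (e * of_int (lk c i)) * of_int (lk (tW x) i))"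
    using assms by (intro sum.cong) (auto simp: root_norm_def)
  finally show ?thesis by (simp add: pairing_def sum_distrib_left algebra_simps)
qed

lemma root_norm_simple: "i \<in> I \<Longrightarrow> root_norm (sg i) (sg i) (d i)"
  by (auto simp: root_norm_def form_single lookup_alphaW d_pos A_diag lookup_single when_def)

lemma root_norm_pairing: assumes "root_norm \<gamma> c e" shows "\<langle>c,tW \<gamma>\<rangle> = 2"
proof -
  have "e * of_int \<langle>c,tW \<gamma>\<rangle> = e * (2::real)" using root_norm_form[OF assms, of \<gamma>] assms by (simp only: root_norm_def)
  with assms have "real_of_int \<langle>c,tW \<gamma>\<rangle> = 2" unfolding root_norm_def by (metis mult_left_cancel less_irrefl)
  then show ?thesis by linarith
qed

lemma refl_form:
  assumes "root_norm \<gamma> c e"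
  shows "form (reflR n A c \<gamma> x) (reflR n A c \<gamma> y) = form x y"
proof -
  have "form \<gamma> \<gamma> = 2 * e" using assms by (simp add: root_norm_def)
  then show ?thesis using root_norm_form[OF assms, of x] root_norm_form[OF assms, of y]
    by (simp add: reflR_def form_sym[of x \<gamma>] algebra_simps)
qed

lemma pairing_sym_form:
  assumes "root_norm \<gamma> c e" "root_norm \<gamma>' c' e'"
  shows "e * of_int \<langle>c,tW \<gamma>'\<rangle> = e' * of_int \<langle>c',tW \<gamma>\<rangle>"
  using root_norm_form[OF assms(1), of \<gamma>'] root_norm_form[OF assms(2), of \<gamma>] by (simp add: form_sym)

lemma root_norm_refl:
  assumes "root_norm \<gamma> c e" "root_norm \<delta> b f"
  shows "root_norm (reflR n A c \<gamma> \<delta>) (reflQ n c (tW \<gamma>) b) f"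
proof -
  have p: "e * of_int \<langle>c,tW \<delta>\<rangle> = f * of_int \<langle>b,tW \<gamma>\<rangle>" using assms by (rule pairing_sym_form)
  have "d i * of_int (lk (reflR n A c \<gamma> \<delta>) i) = f * of_int (lk (reflQ n c (tW \<gamma>) b) i)" if i: "i \<in> I" for i
  proof -
    have "d i * of_int (lk (reflR n A c \<gamma> \<delta>) i)
        = d i * of_int (lk \<delta> i) - of_int \<langle>c,tW \<delta>\<rangle> * (d i * of_int (lk \<gamma> i))"
      by (simp add: reflR_def lookup_minus algebra_simps)
    also have "d i * of_int (lk \<delta> i) = f * of_int (lk b i)" using assms i by (auto simp: root_norm_def)
    also have "d i * of_int (lk \<gamma> i) = e * of_int (lk c i)" using assms i by (auto simp: root_norm_def)
    also have "of_int \<langle>c,tW \<delta>\<rangle> * (e * of_int (lk c i)) = (e * of_int \<langle>c,tW \<delta>\<rangle>) * real_of_int (lk c i)" by simp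
    also note p
    finally show ?thesis by (simp add: reflQ_def lookup_minus algebra_simps)
  qed
  moreover have "form (reflR n A c \<gamma> \<delta>) (reflR n A c \<gamma> \<delta>) = form \<delta> \<delta>" by (rule refl_form[OF assms(1)])
  moreover have "L (reflR n A c \<gamma> \<delta>)" "L (reflQ n c (tW \<gamma>) b)"
    using assms by (simp_all add: root_norm_def reflR_def reflQ_def)
  ultimately show ?thesis using assms(2) unfolding root_norm_def by metis
qed

lemma rootpair_norm: "(\<gamma>, c) \<in> RP \<Longrightarrow> \<exists>e. root_norm \<gamma> c e"
proof (induction \<gamma> c rule: rootpairs.induct)
  case (simple i) then show ?case using root_norm_simple by blast
next
  case (refl \<gamma> c i)
  then show ?case using root_norm_refl[OF root_norm_simple[OF refl(2)]]
    by (auto simp: sR_refl sQ_refl)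
qed

lemma rootpair_lattice: "(\<gamma>, c) \<in> RP \<Longrightarrow> L \<gamma> \<and> L c"
  using rootpair_norm root_norm_def by blast

lemma rootpair_pairing: "(\<gamma>, c) \<in> RP \<Longrightarrow> \<langle>c,tW \<gamma>\<rangle> = 2"
  using rootpair_norm root_norm_pairing by blast

lemma rootpair_nonzero: "(\<gamma>, c) \<in> RP \<Longrightarrow> \<gamma> \<noteq> 0" "(\<gamma>, c) \<in> RP \<Longrightarrow> tW \<gamma> \<noteq> 0"
  using rootpair_pairing[of \<gamma> c] by auto

lemma coroot_unique: assumes "(\<gamma>, c) \<in> RP" "(\<gamma>, c') \<in> RP" shows "c = c'"
proof -
  obtain e e' where e: "root_norm \<gamma> c e" "root_norm \<gamma> c' e'" using assms rootpair_norm by blast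
  then have "e = e'" by (auto simp: root_norm_def)
  with e show ?thesis by (intro in_lattice_eqI[of n]) (auto simp: root_norm_def)
qed

lemma refl_conj:
  assumes "i \<in> I"
  shows "reflP n (sQ n A i c) (sP n A i \<alpha>) \<mu> = sP n A i (reflP n c \<alpha> (sP n A i \<mu>))"
    "reflQ n (sQ n A i c) (sP n A i \<alpha>) \<beta> = sQ n A i (reflQ n c \<alpha> (sQ n A i \<beta>))"
proof -
  have 2: "\<langle>sg i, alphaW n A i\<rangle> = 2" using assms by (simp add: lookup_alphaW A_diag)
  let ?P = "reflP n (sg i) (alphaW n A i)" and ?Q = "reflQ n (sg i) (alphaW n A i)"
  have "?P (reflP n c \<alpha> (?P \<mu>)) = ?P (?P \<mu>) - fc \<langle>c,?P \<mu>\<rangle> (?P \<alpha>)"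
    by (simp add: reflP_def[of n c])
  then show "reflP n (sQ n A i c) (sP n A i \<alpha>) \<mu> = sP n A i (reflP n c \<alpha> (sP n A i \<mu>))"
    unfolding sP_refl[OF assms] sQ_refl[OF assms]
    by (simp only: refl_invol[OF 2] reflP_def[of n "?Q c"] refl_adjoint)
  have "?Q (reflQ n c \<alpha> (?Q \<beta>)) = ?Q (?Q \<beta>) - fc \<langle>?Q \<beta>,\<alpha>\<rangle> (?Q c)"
    by (simp add: reflQ_def[of n c])
  then show "reflQ n (sQ n A i c) (sP n A i \<alpha>) \<beta> = sQ n A i (reflQ n c \<alpha> (sQ n A i \<beta>))"
    unfolding sP_refl[OF assms] sQ_refl[OF assms]
    by (simp only: refl_invol[OF 2] reflQ_def[of n "?Q c"] refl_adjoint)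
qed

lemma toW_sR: "i \<in> I \<Longrightarrow> tW (sR n A i \<gamma>) = sP n A i (tW \<gamma>)"
  by (simp add: sR_refl sP_refl)

lemma reflR_sR:
  assumes i: "i \<in> I" and L: "L \<gamma>" "L \<delta>"
  shows "reflR n A (sQ n A i c) (sR n A i \<gamma>) \<delta> = sR n A i (reflR n A c \<gamma> (sR n A i \<delta>))"
proof (rule toW_inj)
  show "L (reflR n A (sQ n A i c) (sR n A i \<gamma>) \<delta>)" "L (sR n A i (reflR n A c \<gamma> (sR n A i \<delta>)))"
    using i L by (simp_all add: sR_refl reflR_def)
  show "tW (reflR n A (sQ n A i c) (sR n A i \<gamma>) \<delta>) = tW (sR n A i (reflR n A c \<gamma> (sR n A i \<delta>)))"
    using i by (simp add: toW_sR refl_conj)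
qed

text \<open>Closure under all reflections, although \<open>rootpairs\<close> is generated by the
  simple ones: the reflection in s_i gamma is a conjugate of the one in gamma, which drives an
  induction on the reflecting root.\<close>

lemma rootpair_refl:
  assumes "(\<gamma>, c) \<in> RP" "(\<delta>, b) \<in> RP"
  shows "(reflR n A c \<gamma> \<delta>, reflQ n c (tW \<gamma>) b) \<in> RP"
  using assms
proof (induction \<gamma> c arbitrary: \<delta> b rule: rootpairs.induct)
  case (simple i)
  then show ?case using rootpairs.refl[of \<delta> b n A i] by (simp add: sR_refl sQ_refl)
next
  case (refl \<gamma> c i)
  have "(sR n A i (reflR n A c \<gamma> (sR n A i \<delta>)), sQ n A i (reflQ n c (tW \<gamma>) (sQ n A i b))) \<in> RP"
    using refl by (intro rootpairs.refl refl.IH)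
  then show ?case
    by (simp only: reflR_sR[OF refl.hyps(2) rootpair_lattice[OF refl.hyps(1), THEN conjunct1]
        rootpair_lattice[OF refl.prems, THEN conjunct1]] toW_sR[OF refl.hyps(2)] refl_conj[OF refl.hyps(2)])
qed

lemma rootpair_uminus: "(\<gamma>, c) \<in> RP \<Longrightarrow> (- \<gamma>, - c) \<in> RP"
proof -
  assume a: "(\<gamma>, c) \<in> RP"
  have "reflR n A c \<gamma> \<gamma> = - \<gamma>" "reflQ n c (tW \<gamma>) c = - c"
    by (rule poly_mapping_eqI, simp add: reflR_def reflQ_def rootpair_pairing[OF a] lookup_minus)+
  then show ?thesis using rootpair_refl[OF a a] by simp
qed

text \<open>The norm is \<open>e\<close> times the sum of a symmetric integral matrix with even diagonal.\<close>

lemma norm_ge: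
  assumes x: "L x" "x \<noteq> 0" and e: "0 < e" and y: "\<And>i. i \<in> I \<Longrightarrow> d i * of_int (lk x i) = e * of_int (y i)"
  shows "2 * e \<le> form x x"
proof -
  define B where "B i j = y i * A i j * lk x j" for i j
  have B: "of_int (lk x i) * d i * of_int (A i j) * of_int (lk x j) = e * of_int (B i j)" if "i \<in> I" for i j
    using y[OF that] by (simp add: B_def mult.commute[of "of_int (lk x i)"])
  have Bs: "B i j = B j i" if "i \<in> I" "j \<in> I" for i j
  proof -
    have "e * of_int (B i j) = of_int (lk x i) * (d i * of_int (A i j)) * of_int (lk x j)" using B[OF that(1), of j] by simp
    also have "\<dots> = of_int (lk x j) * d j * of_int (A j i) * of_int (lk x i)" by (simp add: d_sym[OF that])
    also have "\<dots> = e * of_int (B j i)" using B[OF that(2)] by simp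
    finally show ?thesis using e by simp
  qed
  have even: "even (\<Sum>i\<in>S. \<Sum>j\<in>S. B i j)" if "finite S" "S \<subseteq> I" for S
    using that
  proof (induction S rule: finite_induct)
    case (insert k S)
    have "(\<Sum>i\<in>insert k S. \<Sum>j\<in>insert k S. B i j) = B k k + (\<Sum>j\<in>S. B k j) + (\<Sum>i\<in>S. B i k) + (\<Sum>i\<in>S. \<Sum>j\<in>S. B i j)"
      using insert.hyps by (simp add: sum.distrib)
    also have "(\<Sum>i\<in>S. B i k) = (\<Sum>j\<in>S. B k j)" using insert.prems by (intro sum.cong) (auto intro!: Bs)
    moreover have "even (B k k)" using insert.prems by (simp add: B_def A_diag)
    ultimately show ?case using insert by auto
  qed simp
  have f: "form x x = e * of_int (\<Sum>i\<in>I. \<Sum>j\<in>I. B i j)"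
    unfolding form_def by (simp add: sum_distrib_left B)
  then have "0 < (\<Sum>i\<in>I. \<Sum>j\<in>I. B i j)" using form_pos[OF x] e by (auto simp only: zero_less_mult_iff of_int_0_less_iff)
  with even[of I] have "2 \<le> (\<Sum>i\<in>I. \<Sum>j\<in>I. B i j)" by (auto elim: evenE)
  then have "e * 2 \<le> e * of_int (\<Sum>i\<in>I. \<Sum>j\<in>I. B i j)"
    using e by (intro mult_left_mono) linarith+
  then show ?thesis unfolding f by simp
qed

section \<open>Signs and finiteness of roots\<close>

definition nonneg :: "wt \<Rightarrow> bool" where "nonneg x \<longleftrightarrow> (\<forall>i. 0 \<le> lk x i)"

text \<open>If \<open>\<gamma> = p - q\<close> had mixed signs, then by \<open>norm_ge\<close> both \<open>p\<close> and \<open>q\<close> would be at least as long as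
  \<open>\<gamma>\<close>, although \<open>(p, q) \<le> 0\<close>.\<close>

lemma root_sign:
  assumes "(\<gamma>, c) \<in> RP"
  shows "nonneg \<gamma> \<or> nonneg (- \<gamma>)"
proof (rule ccontr)
  assume neg: "\<not> ?thesis"
  obtain e where e: "root_norm \<gamma> c e" using rootpair_norm[OF assms] by blast
  define p where "p = Abs_poly_mapping (\<lambda>i. max 0 (lk \<gamma> i))"
  define q where "q = Abs_poly_mapping (\<lambda>i. max 0 (- lk \<gamma> i))"
  have "{i. max 0 (lk \<gamma> i) \<noteq> 0} \<subseteq> {i. lk \<gamma> i \<noteq> 0}" "{i. max 0 (- lk \<gamma> i) \<noteq> 0} \<subseteq> {i. lk \<gamma> i \<noteq> 0}" by auto
  then have p: "lk p = (\<lambda>i. max 0 (lk \<gamma> i))" and q: "lk q = (\<lambda>i. max 0 (- lk \<gamma> i))"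
    unfolding p_def q_def by (auto intro!: lookup_Abs_poly_mapping finite_subset[OF _ finite_lookup])
  have g: "\<gamma> = p - q" by (rule poly_mapping_eqI) (auto simp: lookup_minus p q)
  have L: "L p" "L q" using e by (auto simp: root_norm_def in_lattice_iff p q)
  have nz: "p \<noteq> 0" "q \<noteq> 0" proof -
    obtain i j where "lk \<gamma> i < 0" "0 < lk \<gamma> j" using neg by (auto simp: nonneg_def not_le)
    then have "lk q i \<noteq> 0" "lk p j \<noteq> 0" by (simp_all add: p q)
    then show "p \<noteq> 0" "q \<noteq> 0" by auto
  qed
  have "form p q = (\<Sum>i\<in>I. \<Sum>j\<in>I. d i * of_int (lk p i * A i j * lk q j))" by (simp add: form_def algebra_simps)
  also have "\<dots> \<le> 0"
  proof (intro sum_nonpos mult_nonneg_nonpos)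
    fix i j assume ij: "i \<in> I" "j \<in> I"
    show "0 \<le> d i" using d_pos ij by (simp add: less_imp_le)
    show "real_of_int (lk p i * A i j * lk q j) \<le> 0"
    proof (cases "i = j")
      case True then show ?thesis by (auto simp: p q max_def)
    next
      case False
      have "lk p i * A i j \<le> 0" using A_le[OF ij False] by (intro mult_nonneg_nonpos) (auto simp: p)
      then have "lk p i * A i j * lk q j \<le> 0" by (rule mult_nonpos_nonneg) (auto simp: q)
      then show ?thesis by linarith
    qed
  qed
  finally have pq: "form p q \<le> 0" .
  have c: "d i * of_int (lk \<gamma> i) = e * of_int (lk c i)" if "i \<in> I" for i using e that by (auto simp: root_norm_def)
  have e0: "0 < e" using e by (simp add: root_norm_def)
  have "2 * e \<le> form p p"
    by (rule norm_ge[OF L(1) nz(1) e0, where y = "\<lambda>i. if 0 \<le> lk \<gamma> i then lk c i else 0"]) (use c in \<open>auto simp: p max_def\<close>)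
  moreover have "2 * e \<le> form q q"
    by (rule norm_ge[OF L(2) nz(2) e0, where y = "\<lambda>i. if 0 \<le> lk \<gamma> i then 0 else - lk c i"]) (use c in \<open>auto simp: q max_def\<close>)
  moreover have "form \<gamma> \<gamma> = form p p + form q q - 2 * form p q" by (simp add: g form_sym[of q p])
  moreover have "form \<gamma> \<gamma> = 2 * e" using e by (simp add: root_norm_def)
  ultimately show False using pq e0 by linarith
qed

text \<open>For gamma = k alpha_i the norm gives e = k^2 d_i, while the coroot satisfies d_i k = e
  c_i; hence k c_i = 1 in the integers.\<close>

lemma root_multiple:
  assumes "(\<gamma>, c) \<in> RP" "i \<in> I" "\<And>j. j \<noteq> i \<Longrightarrow> lk \<gamma> j = 0" "nonneg \<gamma>"
  shows "\<gamma> = sg i"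
proof -
  have g: "\<gamma> = fc (lk \<gamma> i) (sg i)" by (rule poly_mapping_eqI) (use assms in \<open>auto simp: lookup_single when_def\<close>)
  obtain e where e: "root_norm \<gamma> c e" using rootpair_norm[OF assms(1)] by blast
  have ci: "d i * of_int (lk \<gamma> i) = e * of_int (lk c i)" "0 < e" "form \<gamma> \<gamma> = 2 * e" using e assms by (auto simp: root_norm_def)
  have di: "0 < d i" using assms d_pos by auto
  have "form \<gamma> \<gamma> = form (fc (lk \<gamma> i) (sg i)) (fc (lk \<gamma> i) (sg i))" using g by metis
  then have "form \<gamma> \<gamma> = of_int (lk \<gamma> i) * (2 * d i * of_int (lk \<gamma> i))"
    using assms by (simp add: form_single lookup_alphaW A_diag)
  with ci(3) have "e = of_int (lk \<gamma> i) * (d i * of_int (lk \<gamma> i))" by simp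
  also note ci(1)
  finally have "e = of_int (lk \<gamma> i) * (e * of_int (lk c i))" .
  then have "e * 1 = e * of_int (lk \<gamma> i * lk c i)"
    by (simp only: of_int_mult mult.left_commute[of "of_int (lk \<gamma> i)"] mult_1_right)
  then have "1 = real_of_int (lk \<gamma> i * lk c i)" using ci(2) by (simp only: mult_cancel_left) simp
  then have "1 = lk \<gamma> i * lk c i" by linarith
  moreover have "0 \<le> lk \<gamma> i" using assms by (auto simp: nonneg_def)
  ultimately have "lk \<gamma> i = 1" by (metis abs_of_nonneg zmult_eq_1_iff abs_1 abs_minus_cancel)
  then show ?thesis using g by simp
qed

text \<open>Cauchy-Schwarz in integral form: 2 delta - p gamma is twice the component of delta
  orthogonal to gamma, it lies in the lattice, and its norm is nonnegative.\<close>

lemma pair_prod_le: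
  assumes "root_norm \<gamma> c e" "root_norm \<delta> b f"
  shows "\<langle>c,tW \<delta>\<rangle> * \<langle>b,tW \<gamma>\<rangle> \<le> 4"
proof -
  let ?p = "\<langle>c,tW \<delta>\<rangle>" and ?q = "\<langle>b,tW \<gamma>\<rangle>"
  have L: "L (fc 2 \<delta> - fc ?p \<gamma>)" and e: "0 < e" "0 < f" "form \<gamma> \<gamma> = 2 * e" "form \<delta> \<delta> = 2 * f"
    using assms by (simp_all add: root_norm_def)
  have "0 \<le> form (fc 2 \<delta> - fc ?p \<gamma>) (fc 2 \<delta> - fc ?p \<gamma>)" using form_nonneg[OF L] .
  also have "\<dots> = 8 * f - 2 * of_int ?p * (e * of_int ?p)"
    using root_norm_form[OF assms(1), of \<delta>] e by (simp add: form_sym[of \<delta> \<gamma>] algebra_simps)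
  also have "e * of_int ?p = f * of_int ?q" using assms by (rule pairing_sym_form)
  finally have "f * of_int (?p * ?q) \<le> f * 4" by (simp add: mult.commute)
  then have "real_of_int (?p * ?q) \<le> 4" using e by (simp only: mult_le_cancel_left_pos)
  then show ?thesis by linarith
qed

lemma pair_signs:
  assumes "root_norm \<gamma> c e" "root_norm \<delta> b f"
  shows "0 < \<langle>c,tW \<delta>\<rangle> \<longleftrightarrow> 0 < \<langle>b,tW \<gamma>\<rangle>" "\<langle>c,tW \<delta>\<rangle> = 0 \<longleftrightarrow> \<langle>b,tW \<gamma>\<rangle> = 0"
proof -
  have *: "e * of_int \<langle>c,tW \<delta>\<rangle> = f * of_int \<langle>b,tW \<gamma>\<rangle>" using assms by (rule pairing_sym_form)
  have e: "0 < e" "0 < f" using assms by (auto simp: root_norm_def)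
  show "0 < \<langle>c,tW \<delta>\<rangle> \<longleftrightarrow> 0 < \<langle>b,tW \<gamma>\<rangle>"
    using e arg_cong[OF *, of "\<lambda>x. 0 < x"] by (simp add: zero_less_mult_iff)
  show "\<langle>c,tW \<delta>\<rangle> = 0 \<longleftrightarrow> \<langle>b,tW \<gamma>\<rangle> = 0"
    using e arg_cong[OF *, of "\<lambda>x. x = 0"] by simp
qed

lemma pair_abs_le:
  assumes "root_norm \<gamma> c e" "root_norm \<delta> b f"
  shows "\<langle>c,tW \<delta>\<rangle> \<in> {-4..4}"
proof -
  let ?p = "\<langle>c,tW \<delta>\<rangle>" and ?q = "\<langle>b,tW \<gamma>\<rangle>"
  note s = pair_signs[OF assms] and pq = pair_prod_le[OF assms]
  have "\<bar>?p\<bar> \<le> 4"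
  proof (cases "?p = 0")
    case False
    have "\<bar>?p\<bar> * 1 \<le> \<bar>?p\<bar> * \<bar>?q\<bar>" using s False by (intro mult_left_mono) auto
    also have "\<dots> = ?p * ?q" using s by (simp add: abs_mult[symmetric]) (smt (verit) mult_pos_pos mult_neg_neg mult_eq_0_iff)
    finally show ?thesis using pq by linarith
  qed simp
  then show ?thesis by auto
qed

text \<open>A root is determined by its pairings with the simple coroots, which are bounded by 4.\<close>

lemma finite_roots: "finite (roots n A)"
proof -
  let ?F = "{f. \<forall>i. (i \<in> I \<longrightarrow> f i \<in> {-4..4::int}) \<and> (i \<notin> I \<longrightarrow> f i = 0)}"
  have "(\<lambda>\<gamma>. lk (tW \<gamma>)) ` roots n A \<subseteq> ?F"
  proof clarify
    fix \<gamma> i assume "\<gamma> \<in> roots n A"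
    then obtain c e where "root_norm \<gamma> c e" using rootpair_norm unfolding roots_def by fastforce
    then show "(i \<in> I \<longrightarrow> lk (tW \<gamma>) i \<in> {-4..4}) \<and> (i \<notin> I \<longrightarrow> lk (tW \<gamma>) i = 0)"
      using pair_abs_le[OF root_norm_simple, of i \<gamma> c e] by (auto simp: lookup_toW)
  qed
  moreover have "finite ?F" by (rule finite_set_of_finite_funs) auto
  moreover have "inj_on (\<lambda>\<gamma>. lk (tW \<gamma>)) (roots n A)"
    by (rule inj_onI, rule toW_inj) (auto simp: roots_def dest: rootpair_lattice)
  ultimately show ?thesis by (meson finite_imageD finite_subset)
qed

section \<open>Heights, dominance and the highest root\<close>

definition ht :: "wt \<Rightarrow> int" where "ht x = (\<Sum>i\<in>I. lk x i)"

lemma ht_diff [simp]: "ht (x - y) = ht x - ht y"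
  by (simp add: ht_def lookup_minus sum_subtractf)

lemma ht_pos:
  assumes "(\<gamma>, c) \<in> RP" "nonneg \<gamma>" shows "0 < ht \<gamma>"
proof -
  have "\<exists>i. lk \<gamma> i \<noteq> 0" using rootpair_nonzero(1)[OF assms(1)] by (metis lookup_zero poly_mapping_eqI)
  then obtain i where i: "lk \<gamma> i \<noteq> 0" by blast
  then have "i \<in> I" using rootpair_lattice[OF assms(1)] by (auto simp: in_lattice_iff)
  then show ?thesis unfolding ht_def using i assms(2)
    by (intro sum_pos2[of _ i]) (auto simp: nonneg_def less_le)
qed

lemma sR_apply: "i \<in> I \<Longrightarrow> sR n A i \<gamma> = \<gamma> - msingle i (lk (tW \<gamma>) i)"
  by (simp add: sR_def lookup_toW)

lemma ht_single: "i \<in> I \<Longrightarrow> ht (msingle i k) = k"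
  unfolding ht_def by (subst sum.remove[of _ i]) (auto simp: lookup_single when_def)

lemma sR_raise:
  assumes "i \<in> I" "lk (tW \<gamma>) i < 0"
  shows "ht \<gamma> < ht (sR n A i \<gamma>)" "lk \<gamma> j \<le> lk (sR n A i \<gamma>) j" "lk \<gamma> i < lk (sR n A i \<gamma>) i"
  using assms by (auto simp: sR_apply ht_single lookup_minus lookup_single when_def)

definition dominant :: "wt \<Rightarrow> bool" where "dominant \<gamma> \<longleftrightarrow> (\<forall>i\<in>I. 0 \<le> lk (tW \<gamma>) i)"

text \<open>Otherwise indecomposability joins a node k of the support to a node j outside it. The
  coefficient at j vanishes, so the pairing with the j-th coroot is a sum of nonpositive terms with
  a negative one from k, against dominance.\<close>

lemma dominant_full_support:
  assumes "(\<gamma>, c) \<in> RP" "nonneg \<gamma>" "dominant \<gamma>" "i \<in> I"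
  shows "0 < lk \<gamma> i"
proof (rule ccontr)
  assume "\<not> 0 < lk \<gamma> i"
  then have i0: "lk \<gamma> i = 0" using assms by (auto simp: nonneg_def intro: antisym)
  define J where "J = {j \<in> I. lk \<gamma> j \<noteq> 0}"
  have "J \<noteq> {}" using rootpair_nonzero(1)[OF assms(1)] rootpair_lattice[OF assms(1)]
    by (metis (mono_tags, lifting) J_def empty_Collect_eq in_lattice_eqI in_lattice_simps(1) lookup_zero)
  moreover have "J \<noteq> I" "J \<subseteq> I" using i0 assms(4) by (auto simp: J_def)
  ultimately obtain k j where kj: "k \<in> J" "j \<in> I - J" "A k j \<noteq> 0"
    using indec unfolding indecomposable_def by blast
  have kI: "k \<in> I" "j \<in> I" "k \<noteq> j" and gk: "0 < lk \<gamma> k" and gj: "lk \<gamma> j = 0"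
    using kj assms(2) by (auto simp: J_def nonneg_def less_le)
  have "A j k < 0" using A_le[of j k] A_zero[of k j] kI kj by (auto simp: less_le)
  have "lk (tW \<gamma>) j = (\<Sum>l\<in>I. A j l * lk \<gamma> l)" using kI by (simp add: lookup_toW)
  also have "\<dots> = A j k * lk \<gamma> k + (\<Sum>l\<in>I-{k}. A j l * lk \<gamma> l)" using kI by (intro sum.remove) auto
  also have "\<dots> < 0"
  proof -
    have "(\<Sum>l\<in>I-{k}. A j l * lk \<gamma> l) \<le> 0"
    proof (rule sum_nonpos)
      fix l assume "l \<in> I - {k}"
      then show "A j l * lk \<gamma> l \<le> 0" using A_le[of j l] kI gj assms(2)
        by (cases "l = j") (auto simp: nonneg_def intro: mult_nonpos_nonneg)
    qed
    moreover have "A j k * lk \<gamma> k < 0" using \<open>A j k < 0\<close> gk by (rule mult_neg_pos)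
    ultimately show ?thesis by linarith
  qed
  finally show False using assms(3) kI by (auto simp: dominant_def)
qed

lemma form_dominant_nonneg:
  assumes "nonneg x" "dominant y" shows "0 \<le> form x y"
  unfolding form_alt using assms d_pos
  by (intro sum_nonneg mult_nonneg_nonneg) (auto simp: nonneg_def dominant_def less_imp_le)

lemma form_dominant_pos:
  assumes "\<And>i. i \<in> I \<Longrightarrow> 0 < lk x i" "dominant \<gamma>" "(\<gamma>, c) \<in> RP"
  shows "0 < form x \<gamma>"
proof -
  have "L \<gamma>" "\<gamma> \<noteq> 0" using assms rootpair_lattice rootpair_nonzero by auto
  then have "tW \<gamma> \<noteq> tW 0" using toW_inj[of \<gamma> 0] by auto
  then obtain i where i: "lk (tW \<gamma>) i \<noteq> 0" by (metis toW_linear(5) lookup_zero poly_mapping_eqI)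
  then have iI: "i \<in> I" by (auto simp: lookup_toW split: if_splits)
  show ?thesis unfolding form_alt
  proof (rule sum_pos2[of _ i])
    show "0 < real_of_int (lk x i) * d i * real_of_int (lk (tW \<gamma>) i)"
      using assms(1,2) iI i d_pos[OF iI] by (auto simp: dominant_def less_le intro!: mult_pos_pos)
    show "0 \<le> real_of_int (lk x j) * d j * real_of_int (lk (tW \<gamma>) j)" if "j \<in> I" for j
      using assms(1,2) that d_pos[OF that] by (auto simp: dominant_def less_le intro!: mult_nonneg_nonneg)
  qed (use iI in auto)
qed

text \<open>A root theta of maximal height is dominant with full support. Among the roots not below
  it choose delta of maximal height: raising by a simple reflection keeps the offending coefficient,
  so delta is dominant as well and (theta, delta) > 0, which leaves no room for two different
  roots.\<close>

lemma highest_root: "\<exists>\<theta>\<in>roots n A. \<forall>\<gamma>\<in>roots n A. \<forall>i. lk \<gamma> i \<le> lk \<theta> i"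
proof -
  have one: "1 \<in> I" using n_pos by (auto simp: Iset_def)
  have s1: "sg 1 \<in> roots n A" using rootpairs.simple[OF one] by (force simp: roots_def)
  obtain \<theta> where th: "\<theta> \<in> roots n A" "\<And>\<gamma>. \<gamma> \<in> roots n A \<Longrightarrow> ht \<gamma> \<le> ht \<theta>"
    using obtain_max[OF finite_roots, of ht] s1 by auto
  obtain c where c: "(\<theta>, c) \<in> RP" using th(1) by (auto simp: roots_def)
  have sR: "sR n A i \<gamma> \<in> roots n A" if "\<gamma> \<in> roots n A" "i \<in> I" for \<gamma> i
    using that rootpairs.refl[of _ _ n A i] by (force simp: roots_def)
  have dom: "dominant \<theta>"
    unfolding dominant_def using sR_raise(1)[of _ \<theta>] th sR[OF th(1)] by (meson not_less)
  have ht\<theta>: "0 < ht \<theta>" using th(2)[OF s1] one by (simp add: ht_single)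
  have nn: "nonneg \<theta>"
    using root_sign[OF c] ht_pos[OF rootpair_uminus[OF c]] ht\<theta> by (auto simp: ht_def sum_negf)
  note full = dominant_full_support[OF c nn dom]
  have "lk \<gamma> i \<le> lk \<theta> i" if g: "\<gamma> \<in> roots n A" for \<gamma> i
  proof (rule ccontr)
    define S where "S = {\<gamma> \<in> roots n A. \<exists>i. \<not> lk \<gamma> i \<le> lk \<theta> i}"
    assume "\<not> lk \<gamma> i \<le> lk \<theta> i"
    then have "S \<noteq> {}" "finite S" using g finite_roots by (auto simp: S_def)
    then obtain \<delta> where \<delta>: "\<delta> \<in> S" "\<And>\<gamma>. \<gamma> \<in> S \<Longrightarrow> ht \<gamma> \<le> ht \<delta>"
      using obtain_max[of S ht] by auto
    obtain j where j: "lk \<theta> j < lk \<delta> j" and \<delta>r: "\<delta> \<in> roots n A" using \<delta>(1) by (auto simp: S_def not_le)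
    then obtain b where b: "(\<delta>, b) \<in> RP" by (auto simp: roots_def)
    have domd: "dominant \<delta>" unfolding dominant_def
    proof (rule ballI, rule ccontr)
      fix k assume k: "k \<in> I" "\<not> 0 \<le> lk (tW \<delta>) k"
      then have r: "ht \<delta> < ht (sR n A k \<delta>)" "lk \<delta> j \<le> lk (sR n A k \<delta>) j" by (auto intro: sR_raise)
      then have "sR n A k \<delta> \<in> S" using sR[OF \<delta>r k(1)] j unfolding S_def by (auto intro!: exI[of _ j])
      with \<delta>(2) r(1) show False by fastforce
    qed
    have nnd: "nonneg \<delta>"
    proof -
      have "0 < lk \<delta> j" using j nn by (auto simp: nonneg_def intro: le_less_trans)
      then show ?thesis using root_sign[OF b] by (auto simp: nonneg_def) (meson not_le)
    qed
    obtain e f where e: "root_norm \<theta> c e" "root_norm \<delta> b f" using c b rootpair_norm by blast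
    let ?p = "\<langle>c,tW \<delta>\<rangle>" and ?q = "\<langle>b,tW \<theta>\<rangle>"
    have "0 < form \<theta> \<delta>" using form_dominant_pos[OF full domd b] .
    then have p0: "0 < ?p" using e root_norm_form[OF e(1), of \<delta>] by (auto simp: root_norm_def zero_less_mult_iff)
    then have q0: "0 < ?q" using pair_signs[OF e] by simp
    have htd: "ht \<delta> \<le> ht \<theta>" using th(2) \<delta>r by blast
    \<comment> \<open>The coefficient at j is negative, so this root would be negative, whereas ht
      delta <= ht theta.\<close>
    have no: "(\<theta> - \<delta>, x) \<notin> RP" for x
    proof
      assume x: "(\<theta> - \<delta>, x) \<in> RP"
      from root_sign[OF x] show False
      proof
        assume "nonneg (\<theta> - \<delta>)"
        then have "0 \<le> lk (\<theta> - \<delta>) j" by (auto simp: nonneg_def)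
        then show False using j by (simp add: lookup_minus)
      next
        assume "nonneg (- (\<theta> - \<delta>))"
        from ht_pos[OF rootpair_uminus[OF x] this] show False using htd by simp
      qed
    qed
    consider "?p = 1" | "?q = 1" | "2 \<le> ?p" "2 \<le> ?q" using p0 q0 by linarith
    then show False
    proof cases
      case 1
      then have "reflR n A c \<theta> \<delta> = - (\<theta> - \<delta>)" by (simp add: reflR_def)
      with rootpair_refl[OF c b] rootpair_uminus[of "- (\<theta> - \<delta>)"] no show False by force
    next
      case 2
      then have "reflR n A b \<delta> \<theta> = \<theta> - \<delta>" by (simp add: reflR_def)
      with rootpair_refl[OF b c] no show False by force
    next
      case 3
      have f: "form \<theta> \<delta> = e * of_int ?p" "form \<theta> \<delta> = f * of_int ?q" "form \<theta> \<theta> = 2 * e" "form \<delta> \<delta> = 2 * f" "0 < e" "0 < f"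
        using root_norm_form[OF e(1), of \<delta>] root_norm_form[OF e(2), of \<theta>] e by (auto simp: form_sym root_norm_def)
      have "e * 2 \<le> e * of_int ?p" "f * 2 \<le> f * of_int ?q" using 3 f by (intro mult_left_mono; simp)+
      \<comment> \<open>Both Cartan integers are at least 2, so (theta, delta) is at least each of
        the two squared lengths.\<close>
      then have "form (\<theta> - \<delta>) (\<theta> - \<delta>) \<le> 0" using f(1-4) by (simp add: form_sym[of \<delta> \<theta>])
      then have "\<theta> = \<delta>" using form_pos[of "\<theta> - \<delta>"] e by (force simp: root_norm_def)
      then show False using j by simp
    qed
  qed
  then show ?thesis using th(1) by blast
qed

abbreviation "thR \<equiv> thetaR n A"
abbreviation "thV \<equiv> thetaV n A"
abbreviation "thW \<equiv> thetaW n A"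

lemma thetaR_roots: "thR \<in> roots n A" and thetaR_ge: "\<gamma> \<in> roots n A \<Longrightarrow> lk \<gamma> i \<le> lk thR i"
proof -
  have "\<exists>!\<theta>. \<theta> \<in> roots n A \<and> (\<forall>\<gamma>\<in>roots n A. \<forall>i. lk \<gamma> i \<le> lk \<theta> i)"
    using highest_root by (auto intro!: poly_mapping_eqI antisym)
  from theI'[OF this] show "thR \<in> roots n A" "\<gamma> \<in> roots n A \<Longrightarrow> lk \<gamma> i \<le> lk thR i"
    unfolding thetaR_def by auto
qed

lemma theta_RP: "(thR, thV) \<in> RP"
proof -
  have "\<exists>!c. (thR, c) \<in> RP" using thetaR_roots coroot_unique by (auto simp: roots_def)
  from theI'[OF this] show ?thesis unfolding thetaV_def .
qed

lemma theta_nonneg: "nonneg thR"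
  using root_sign[OF theta_RP] thetaR_ge[of "- thR"] rootpair_uminus[OF theta_RP]
  unfolding nonneg_def roots_def by force

lemma theta_dominant: "dominant thR"
  unfolding dominant_def
proof (rule ballI, rule ccontr)
  fix i assume i: "i \<in> I" "\<not> 0 \<le> lk (tW thR) i"
  have "sR n A i thR \<in> roots n A" using rootpairs.refl[OF theta_RP i(1)] by (force simp: roots_def)
  from thetaR_ge[OF this, of i] sR_raise(3)[of i thR] i show False by simp
qed

lemma theta_pair_nonneg:
  assumes "nonneg \<gamma>" shows "0 \<le> \<langle>thV,tW \<gamma>\<rangle>"
proof -
  obtain e where e: "root_norm thR thV e" using rootpair_norm[OF theta_RP] by blast
  have "0 \<le> form thR \<gamma>" using form_dominant_nonneg[OF assms theta_dominant] by (simp add: form_sym)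
  then show ?thesis using e root_norm_form[OF e, of \<gamma>] by (auto simp: root_norm_def zero_le_mult_iff)
qed

text \<open>Minus the reflection of gamma in theta is the root k theta - gamma. It lies below theta,
  so (k - 1) theta <= gamma <= theta, and k >= 2 forces equality.\<close>

lemma theta_pair_le1:
  assumes "(\<gamma>, c) \<in> RP" "nonneg \<gamma>" "\<gamma> \<noteq> thR" shows "\<langle>thV,tW \<gamma>\<rangle> \<le> 1"
proof (rule ccontr)
  let ?k = "\<langle>thV,tW \<gamma>\<rangle>"
  assume "\<not> ?k \<le> 1" then have k: "2 \<le> ?k" by simp
  have "(- reflR n A thV thR \<gamma>, - reflQ n thV (tW thR) c) \<in> RP"
    by (intro rootpair_uminus rootpair_refl theta_RP assms)
  then have "- reflR n A thV thR \<gamma> \<in> roots n A" by (force simp: roots_def)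
  then have "?k * lk thR i - lk \<gamma> i \<le> lk thR i" for i
    using thetaR_ge[of "- reflR n A thV thR \<gamma>" i] by (simp add: reflR_def lookup_minus)
  moreover have "2 * lk thR i \<le> ?k * lk thR i" for i
    using k theta_nonneg by (intro mult_right_mono) (auto simp: nonneg_def)
  moreover have "lk \<gamma> i \<le> lk thR i" for i using assms(1) by (intro thetaR_ge) (force simp: roots_def)
  ultimately have "\<gamma> = thR" by (intro poly_mapping_eqI) (smt (verit))
  with assms(3) show False ..
qed

section \<open>The affine Weyl group\<close>

text \<open>The affine simple root \<open>\<alpha>\<^sub>0 = - \<theta> + \<delta>\<close> has finite part \<open>rw 0\<close>, coroot \<open>rc 0\<close> and \<open>\<delta>\<close>-coefficient \<open>lv 0\<close>.\<close>

definition rw :: "nat \<Rightarrow> wt" where "rw i = (if i = 0 then - thW else alphaW n A i)"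
definition rc :: "nat \<Rightarrow> wt" where "rc i = (if i = 0 then - thV else sg i)"
definition lv :: "nat \<Rightarrow> int" where "lv i = (if i = 0 then 1 else 0)"

abbreviation "J \<equiv> {0..n}"
abbreviation "E \<equiv> word_eval n A"
abbreviation "s \<equiv> gen n A"
abbreviation wm (infixl "\<cdot>" 70) where "x \<cdot> y \<equiv> wmul x y"
abbreviation "W \<equiv> Waf n A"
abbreviation "WI \<equiv> Wfin n A"

lemma J_eq: "J = insert 0 I" by (auto simp: Iset_def)
lemma I_J: "i \<in> I \<Longrightarrow> i \<in> J" by (auto simp: Iset_def)
lemma I_nz: "i \<in> I \<Longrightarrow> i \<noteq> 0" by (auto simp: Iset_def)

lemma rootsI: "(\<gamma>, c) \<in> RP \<Longrightarrow> \<gamma> \<in> roots n A" by (force simp: roots_def)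

lemma simple_RP:
  assumes "i \<in> J" obtains \<gamma> where "(\<gamma>, rc i) \<in> RP" "tW \<gamma> = rw i"
  using assms rootpair_uminus[OF theta_RP] rootpairs.simple[of i n A]
  by (auto simp: J_eq rw_def rc_def thetaW_toW I_nz)

lemma rc_rw: "i \<in> J \<Longrightarrow> \<langle>rc i,rw i\<rangle> = 2"
  by (erule simple_RP) (metis rootpair_pairing)

lemma gen_eq:
  "i \<in> J \<Longrightarrow> s i = (fc (- lv i) (rc i), reflP n (rc i) (rw i), reflQ n (rc i) (rw i))"
proof -
  have "sthP n A = reflP n thV thW" "sthQ n A = reflQ n thV thW"
    by (rule ext, simp add: sthP_def reflP_def sthQ_def reflQ_def)+
  then show "i \<in> J \<Longrightarrow> ?thesis"
    by (auto simp: gen_def J_eq rc_def rw_def lv_def reflP_uminus sP_refl sQ_refl I_nz)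
qed

text \<open>The type \<open>waf\<close> contains triples of arbitrary functions. Additivity is what
  associativity of \<open>wmul\<close> rests on, and invariance of the pairing makes
  \<open>ract\<close> an action.\<close>

definition good :: "waf \<Rightarrow> bool" where
  "good x \<longleftrightarrow> (case x of (b, f, g) \<Rightarrow> (\<forall>\<mu> \<nu>. f (\<mu> + \<nu>) = f \<mu> + f \<nu>) \<and> (\<forall>\<beta> \<gamma>. g (\<beta> + \<gamma>) = g \<beta> + g \<gamma>)
     \<and> (\<forall>\<beta> \<mu>. \<langle>g \<beta>,f \<mu>\<rangle> = \<langle>\<beta>,\<mu>\<rangle>))"

lemma good_gen: "i \<in> J \<Longrightarrow> good (s i)"
  by (simp add: gen_eq good_def refl_pairing rc_rw)

lemma good_mul: "good x \<Longrightarrow> good y \<Longrightarrow> good (x \<cdot> y)"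
  by (auto simp: good_def wmul_def split: prod.splits)

lemma wmul_assoc: "good x \<Longrightarrow> (x \<cdot> y) \<cdot> z = x \<cdot> (y \<cdot> z)"
  by (auto simp: good_def wmul_def add.assoc comp_assoc split: prod.splits)

lemma wone_simps [simp]: "wone \<cdot> x = x" "good x \<Longrightarrow> x \<cdot> wone = x" "good wone"
proof -
  assume x: "good x"
  obtain b f g where xx: "x = (b, f, g)" by (cases x)
  have "g (0 + 0) = g 0 + g 0" using x unfolding xx good_def by blast
  then have "g 0 = 0" by (metis add.right_neutral add_cancel_left_left)
  then show "x \<cdot> wone = x" by (simp add: xx wmul_def wone_def)
qed (auto simp: good_def wmul_def wone_def split: prod.splits)

lemma gen_invol [simp]: "i \<in> J \<Longrightarrow> s i \<cdot> s i = wone"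
  by (simp add: gen_eq wmul_def wone_def fun_eq_iff refl_invol rc_rw)
     (rule poly_mapping_eqI, simp add: reflQ_def lookup_add lookup_minus rc_rw)

lemma gen_cancel [simp]: "i \<in> J \<Longrightarrow> s i \<cdot> (s i \<cdot> x) = x"
  by (metis gen_invol good_gen wmul_assoc wone_simps(1))

lemma E_simps [simp]: "E [] = wone" "E (i # ws) = s i \<cdot> E ws"
  by (simp_all add: word_eval_def)

lemma E_good: "set ws \<subseteq> J \<Longrightarrow> good (E ws)"
  by (induction ws) (auto simp: good_mul good_gen)

lemma E_append: "set u \<subseteq> J \<Longrightarrow> E (u @ v) = E u \<cdot> E v"
  by (induction u) (auto simp: wmul_assoc good_gen)

lemma E_rev: "set u \<subseteq> J \<Longrightarrow> E (rev u) \<cdot> E u = wone"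
  by (induction u) (auto simp: E_append wmul_assoc E_good good_gen)

lemma Waf_word: "x \<in> W \<longleftrightarrow> (\<exists>ws. set ws \<subseteq> J \<and> E ws = x)" by (auto simp: Waf_def)
lemma Wfin_word: "x \<in> WI \<longleftrightarrow> (\<exists>ws. set ws \<subseteq> I \<and> E ws = x)" by (auto simp: Wfin_def)
lemma word_Waf: "set ws \<subseteq> J \<Longrightarrow> E ws \<in> W" by (auto simp: Waf_word)
lemma Wfin_Waf: "x \<in> WI \<Longrightarrow> x \<in> W" using I_J by (fastforce simp: Waf_word Wfin_word)
lemma W_good: "x \<in> W \<Longrightarrow> good x" by (auto simp: Waf_word E_good)
lemma W_mul: "x \<in> W \<Longrightarrow> y \<in> W \<Longrightarrow> x \<cdot> y \<in> W"
  unfolding Waf_word by (metis E_append Un_least set_append)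
lemma WI_mul: "x \<in> WI \<Longrightarrow> y \<in> WI \<Longrightarrow> x \<cdot> y \<in> WI"
  unfolding Wfin_word by (metis E_append I_J Un_least set_append subset_iff)
lemma gen_W: "i \<in> J \<Longrightarrow> s i \<in> W" using word_Waf[of "[i]"] by (simp add: good_gen)
lemma gen_WI: "i \<in> I \<Longrightarrow> s i \<in> WI" unfolding Wfin_word using I_J[of i] good_gen[of i] by (intro exI[of _ "[i]"]) simp
lemma wone_W: "wone \<in> W" "wone \<in> WI" unfolding Waf_word Wfin_word by (rule exI[of _ "[]"], simp)+

lemma W_assoc: "x \<in> W \<Longrightarrow> (x \<cdot> y) \<cdot> z = x \<cdot> (y \<cdot> z)" by (rule wmul_assoc[OF W_good])

definition winv :: "waf \<Rightarrow> waf" where "winv x = (SOME y. y \<in> W \<and> (x \<in> WI \<longrightarrow> y \<in> WI) \<and> y \<cdot> x = wone \<and> x \<cdot> y = wone)"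

lemma winv:
  assumes "x \<in> W"
  shows "winv x \<in> W" "x \<in> WI \<Longrightarrow> winv x \<in> WI" "winv x \<cdot> x = wone" "x \<cdot> winv x = wone"
proof -
  have "I \<subseteq> J" using I_J by blast
  then have "\<exists>ws. set ws \<subseteq> J \<and> E ws = x \<and> (x \<in> WI \<longrightarrow> set ws \<subseteq> I)"
    using assms Waf_word[of x] Wfin_word[of x] by (metis order_trans)
  then obtain ws where ws: "set ws \<subseteq> J" "E ws = x" "x \<in> WI \<Longrightarrow> set ws \<subseteq> I" by blast
  have "x \<in> WI \<longrightarrow> E (rev ws) \<in> WI" unfolding Wfin_word[of "E (rev ws)"] using ws(3) by (metis set_rev)
  moreover have "E (rev ws) \<in> W" "E (rev ws) \<cdot> x = wone" "x \<cdot> E (rev ws) = wone"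
    using ws(1,2) E_rev[of ws] E_rev[of "rev ws"] word_Waf[of "rev ws"] by simp_all
  ultimately have "\<exists>y. y \<in> W \<and> (x \<in> WI \<longrightarrow> y \<in> WI) \<and> y \<cdot> x = wone \<and> x \<cdot> y = wone" by blast
  from someI_ex[OF this, folded winv_def]
  show "winv x \<in> W" "x \<in> WI \<Longrightarrow> winv x \<in> WI" "winv x \<cdot> x = wone" "x \<cdot> winv x = wone" by auto
qed

lemma winv_cancel:
  assumes "x \<in> W" shows "winv x \<cdot> (x \<cdot> y) = y" "x \<cdot> (winv x \<cdot> y) = y"
  using assms by (metis W_assoc winv(1,3,4) wone_simps(1))+

text \<open>The action on pairs \<open>(\<mu>, m)\<close>, standing for \<open>\<mu> + m \<delta>\<close>.\<close>

definition ract :: "waf \<Rightarrow> wt \<times> int \<Rightarrow> wt \<times> int" where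
  "ract x \<rho> = (case x of (b, f, g) \<Rightarrow> (f (fst \<rho>), snd \<rho> - \<langle>b,f (fst \<rho>)\<rangle>))"

definition rsmul :: "int \<Rightarrow> wt \<times> int \<Rightarrow> wt \<times> int" where "rsmul k \<rho> = (fc k (fst \<rho>), k * snd \<rho>)"

definition al :: "nat \<Rightarrow> wt \<times> int" where "al i = (rw i, lv i)"

lemma ract_mul: "good x \<Longrightarrow> ract (x \<cdot> y) \<rho> = ract x (ract y \<rho>)"
  by (auto simp: ract_def good_def wmul_def split: prod.splits)

lemma ract_one [simp]: "ract wone \<rho> = \<rho>" by (simp add: ract_def wone_def)

lemma good_diff:
  assumes "\<And>\<beta> \<gamma>. g (\<beta> + \<gamma>) = g \<beta> + g (\<gamma>::wt)"
  shows "g 0 = (0::wt)" "g (- x) = - g x" "g (x - y) = g x - g y" "g (fc k x) = fc k (g x)"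
proof -
  show 0: "g 0 = (0::wt)" using assms[of 0 0] by simp
  show m: "g (- x) = - g x" for x using assms[of x "-x"] 0 by (simp add: eq_neg_iff_add_eq_0 add.commute)
  show "g (x - y) = g x - g y" using assms[of x "-y"] m by simp
  have nat: "g (fc (int k) x) = fc (int k) (g x)" for k
    by (induction k) (simp_all add: 0 frag_cmul_distrib assms)
  show "g (fc k x) = fc k (g x)"
    using nat[of "nat k"] nat[of "nat (- k)"] m[of "fc (- k) x"] by (cases "0 \<le> k") simp_all
qed

lemma ract_linear:
  assumes "good x"
  shows "ract x (\<rho> + \<sigma>) = ract x \<rho> + ract x \<sigma>" "ract x (- \<rho>) = - ract x \<rho>"
    "ract x (rsmul k \<rho>) = rsmul k (ract x \<rho>)"
proof -
  obtain b f g where x: "x = (b, f, g)" by (cases x)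
  have f: "f (\<mu> + \<nu>) = f \<mu> + f \<nu>" for \<mu> \<nu> using assms by (auto simp: x good_def)
  show "ract x (\<rho> + \<sigma>) = ract x \<rho> + ract x \<sigma>" "ract x (- \<rho>) = - ract x \<rho>"
    "ract x (rsmul k \<rho>) = rsmul k (ract x \<rho>)"
    by (simp_all add: x ract_def prod_eq_iff rsmul_def f good_diff[of f, OF f] algebra_simps)
qed

lemma ract_gen: "i \<in> J \<Longrightarrow> ract (s i) \<rho> = \<rho> - rsmul \<langle>rc i,fst \<rho>\<rangle> (al i)"
  by (simp add: gen_eq ract_def prod_eq_iff rsmul_def al_def reflP_def rc_rw algebra_simps)

lemma ract_gen_al: "i \<in> J \<Longrightarrow> ract (s i) (al i) = - al i"
proof (rule prod_eqI)
  assume i: "i \<in> J"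
  show "fst (ract (s i) (al i)) = fst (- al i)"
    by (rule poly_mapping_eqI) (simp add: ract_gen[OF i] rsmul_def al_def rc_rw[OF i] lookup_minus)
qed (simp add: ract_gen rsmul_def al_def rc_rw)

section \<open>Positivity of affine roots\<close>

definition cone :: "wt \<Rightarrow> bool" where "cone \<mu> \<longleftrightarrow> (\<exists>\<gamma>. L \<gamma> \<and> nonneg \<gamma> \<and> \<gamma> \<noteq> 0 \<and> \<mu> = tW \<gamma>)"
text \<open>Positivity is declared on all of P + Z delta instead of on roots alone, which makes it
  additive; on real affine roots it is the usual positive system with simple roots
  \<open>al i\<close>.\<close>

definition apos :: "wt \<times> int \<Rightarrow> bool" where "apos \<rho> \<longleftrightarrow> 0 < snd \<rho> \<or> snd \<rho> = 0 \<and> cone (fst \<rho>)"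
definition aroot :: "wt \<times> int \<Rightarrow> bool" where "aroot \<rho> \<longleftrightarrow> fst \<rho> \<in> tW ` roots n A"

lemma nonneg_add_0: "nonneg x \<Longrightarrow> nonneg y \<Longrightarrow> x + y = 0 \<Longrightarrow> x = 0"
  by (rule poly_mapping_eqI) (metis add_nonneg_eq_0_iff lookup_add lookup_zero nonneg_def)

lemma cone_add: "cone \<mu> \<Longrightarrow> cone \<nu> \<Longrightarrow> cone (\<mu> + \<nu>)"
proof -
  assume "cone \<mu>" "cone \<nu>"
  then obtain x y where x: "L x" "nonneg x" "x \<noteq> 0" "\<mu> = tW x" "L y" "nonneg y" "y \<noteq> 0" "\<nu> = tW y"
    by (auto simp: cone_def)
  then have "x + y \<noteq> 0" "nonneg (x + y)" using nonneg_add_0 by (blast, simp add: nonneg_def lookup_add)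
  with x show "cone (\<mu> + \<nu>)" unfolding cone_def
    by (intro exI[of _ "x + y"]) auto
qed

lemma cone_neg: "cone \<mu> \<Longrightarrow> \<not> cone (- \<mu>)"
proof
  assume "cone \<mu>" "cone (- \<mu>)"
  from cone_add[OF this] have "cone 0" by simp
  then obtain \<gamma> where "L \<gamma>" "\<gamma> \<noteq> 0" "tW 0 = tW \<gamma>" by (auto simp: cone_def)
  then show False using toW_inj[of 0 \<gamma>] by simp
qed

lemma apos_add: "apos \<rho> \<Longrightarrow> apos \<sigma> \<Longrightarrow> apos (\<rho> + \<sigma>)"
  by (auto simp: apos_def cone_add)

lemma apos_neg: "apos \<rho> \<Longrightarrow> \<not> apos (- \<rho>)"
  by (auto simp: apos_def cone_neg)

lemma rootsE: assumes "\<gamma> \<in> roots n A" obtains c where "(\<gamma>, c) \<in> RP"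
  using assms by (auto simp: roots_def)

lemma coneI: "L \<gamma> \<Longrightarrow> nonneg \<gamma> \<Longrightarrow> \<gamma> \<noteq> 0 \<Longrightarrow> cone (tW \<gamma>)"
  by (auto simp: cone_def)

lemma nonneg_root_cone: "(\<gamma>, c) \<in> RP \<Longrightarrow> nonneg \<gamma> \<Longrightarrow> cone (tW \<gamma>)"
  using coneI rootpair_lattice rootpair_nonzero by blast

lemma roots_uminus: "\<gamma> \<in> roots n A \<Longrightarrow> - \<gamma> \<in> roots n A"
  by (elim rootsE) (rule rootsI, rule rootpair_uminus)

lemma root_cone: "\<gamma> \<in> roots n A \<Longrightarrow> cone (tW \<gamma>) \<or> cone (- tW \<gamma>)"
proof (elim rootsE)
  fix c assume c: "(\<gamma>, c) \<in> RP"
  from root_sign[OF c] show ?thesis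
    using nonneg_root_cone[OF c] nonneg_root_cone[OF rootpair_uminus[OF c]] by auto
qed

lemma aroot_pos: "aroot \<rho> \<Longrightarrow> \<not> apos \<rho> \<Longrightarrow> apos (- \<rho>)"
proof -
  assume "aroot \<rho>" and n: "\<not> apos \<rho>"
  then obtain \<gamma> where "\<gamma> \<in> roots n A" "fst \<rho> = tW \<gamma>" by (auto simp: aroot_def)
  with n root_cone[of \<gamma>] show "apos (- \<rho>)" by (auto simp: apos_def)
qed

lemma aroot_uminus: "aroot \<rho> \<Longrightarrow> aroot (- \<rho>)"
proof -
  assume "aroot \<rho>"
  then obtain \<gamma> where "\<gamma> \<in> roots n A" "fst \<rho> = tW \<gamma>" by (auto simp: aroot_def)
  then show "aroot (- \<rho>)" using roots_uminus[of \<gamma>] unfolding aroot_def by (intro image_eqI[of _ _ "- \<gamma>"]) auto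
qed

lemma aroot_al: "i \<in> J \<Longrightarrow> aroot (al i)"
  by (erule simple_RP) (auto simp: aroot_def al_def intro!: image_eqI[OF sym] rootsI)

lemma cone_alpha: "i \<in> I \<Longrightarrow> cone (alphaW n A i)"
  unfolding cone_def
  by (rule exI[of _ "sg i"]) (auto simp: nonneg_def lookup_single when_def poly_mapping_eq_iff fun_eq_iff)

lemma apos_al: "i \<in> J \<Longrightarrow> apos (al i)"
  by (auto simp: J_eq apos_def al_def lv_def rw_def cone_alpha I_nz)

lemma Waf_rootpair:
  assumes "x \<in> W" "(\<gamma>, c) \<in> RP"
  shows "\<exists>\<gamma>'. (\<gamma>', snd (snd x) c) \<in> RP \<and> tW \<gamma>' = fst (snd x) (tW \<gamma>)"
proof -
  obtain ws where "set ws \<subseteq> J" "x = E ws" using assms by (auto simp: Waf_word)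
  moreover have "set ws \<subseteq> J \<Longrightarrow> \<exists>\<gamma>'. (\<gamma>', snd (snd (E ws)) c) \<in> RP \<and> tW \<gamma>' = fst (snd (E ws)) (tW \<gamma>)"
  proof (induction ws)
    case Nil then show ?case using assms by (auto simp: wone_def)
  next
    case (Cons i ws)
    then obtain \<gamma>' where g: "(\<gamma>', snd (snd (E ws)) c) \<in> RP" "tW \<gamma>' = fst (snd (E ws)) (tW \<gamma>)" by auto
    have "i \<in> J" using Cons.prems by simp
    then obtain \<delta> where \<delta>: "(\<delta>, rc i) \<in> RP" "tW \<delta> = rw i" by (rule simple_RP)
    show ?case using rootpair_refl[OF \<delta>(1) g(1)] \<delta>(2) g(2) Cons.prems
      by (intro exI[of _ "reflR n A (rc i) \<delta> \<gamma>'"]) (auto simp: wmul_def gen_eq split: prod.splits)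
  qed
  ultimately show ?thesis by blast
qed

lemma aroot_ract: "x \<in> W \<Longrightarrow> aroot \<rho> \<Longrightarrow> aroot (ract x \<rho>)"
proof -
  assume x: "x \<in> W" and "aroot \<rho>"
  then obtain \<gamma> c where g: "(\<gamma>, c) \<in> RP" "fst \<rho> = tW \<gamma>" by (auto simp: aroot_def roots_def)
  from Waf_rootpair[OF x g(1)] g(2) show ?thesis unfolding aroot_def ract_def
    by (auto split: prod.splits) (metis rootsI image_eqI)
qed

lemma root_pos_nonneg:
  assumes "(\<gamma>, c) \<in> RP" "cone (tW \<gamma>)" shows "nonneg \<gamma>"
  using assms root_sign[OF assms(1)] unfolding cone_def
  by (metis rootpair_lattice toW_inj)

text \<open>For i in I at level 0 some coefficient other than the i-th is positive and stays
  unchanged, since only multiples of alpha_i lack one. For i = 0 the level moves by the pairing with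
  theta^vee, which is at least -1 unless the finite part is -theta.\<close>

lemma gen_perm:
  assumes i: "i \<in> J" and \<rho>: "aroot \<rho>" "apos \<rho>" "\<rho> \<noteq> al i"
  shows "apos (ract (s i) \<rho>)"
proof -
  obtain \<gamma> c m where g: "(\<gamma>, c) \<in> RP" "\<rho> = (tW \<gamma>, m)" using \<rho>(1) by (cases \<rho>) (auto simp: aroot_def roots_def)
  have r: "aroot (ract (s i) \<rho>)" using aroot_ract[OF gen_W[OF i] \<rho>(1)] .
  show ?thesis
  proof (cases "i = 0")
    case False
    then have iI: "i \<in> I" using i by (auto simp: J_eq)
    have sn: "snd (ract (s i) \<rho>) = m" and f: "fst (ract (s i) \<rho>) = tW (sR n A i \<gamma>)"
      using i iI False by (simp_all add: ract_gen rsmul_def al_def lv_def g rw_def rc_def sR_def reflP_def lookup_toW toW_single)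
    show ?thesis
    proof (cases "0 < m")
      case True then show ?thesis using sn by (simp add: apos_def)
    next
      case m: False
      then have m0: "m = 0" and cg: "cone (tW \<gamma>)" using \<rho>(2) g by (auto simp: apos_def)
      then have nn: "nonneg \<gamma>" using root_pos_nonneg g by blast
      have "\<gamma> \<noteq> sg i" using \<rho>(3) g m0 iI False by (auto simp: al_def rw_def lv_def)
      then obtain j where j: "j \<noteq> i" "lk \<gamma> j \<noteq> 0" using root_multiple[OF g(1) iI _ nn] by blast
      then have "0 < lk (sR n A i \<gamma>) j" using nn iI by (auto simp: sR_apply lookup_minus lookup_single nonneg_def less_le)
      then have "\<not> nonneg (- sR n A i \<gamma>)" by (auto simp: nonneg_def not_le)
      moreover have sRP: "(sR n A i \<gamma>, sQ n A i c) \<in> RP" using g iI rootpairs.refl by blast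
      ultimately have "nonneg (sR n A i \<gamma>)" using root_sign by blast
      then have "cone (fst (ract (s i) \<rho>))" unfolding cone_def f
        using rootpair_lattice[OF sRP] rootpair_nonzero[OF sRP] by blast
      then show ?thesis using sn m0 by (simp add: apos_def)
    qed
  next
    case True
    let ?k = "\<langle>thV,tW \<gamma>\<rangle>"
    have sn: "snd (ract (s i) \<rho>) = m + ?k" and f: "fst (ract (s i) \<rho>) = tW \<gamma> - fc ?k thW"
      using i True by (simp_all add: ract_gen rsmul_def al_def lv_def g rw_def rc_def)
    show ?thesis
    proof (cases "nonneg \<gamma>")
      case nn: True
      then have k: "0 \<le> ?k" by (rule theta_pair_nonneg)
      have m: "0 \<le> m" using \<rho>(2) g by (auto simp: apos_def)
      show ?thesis
      proof (cases "?k = 0")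
        case True
        then show ?thesis using \<rho>(2) sn f g by (simp add: apos_def)
      next
        case False
        then show ?thesis using k m sn by (simp add: apos_def)
      qed
    next
      case nn: False
      then have nn': "nonneg (- \<gamma>)" using root_sign[OF g(1)] by blast
      have m: "0 < m" using \<rho>(2) g nn root_pos_nonneg[OF g(1)] by (auto simp: apos_def)
      have gm: "(- \<gamma>, - c) \<in> RP" using g rootpair_uminus by blast
      show ?thesis
      proof (cases "- \<gamma> = thR")
        case True
        then have "tW \<gamma> = - thW" by (metis minus_equation_iff thetaW_toW toW_linear(3))
        then have k: "?k = - 2" using rootpair_pairing[OF theta_RP] by (simp add: thetaW_toW)
        \<comment> \<open>At level 1 this would be alpha_0 itself; from level 2 on the image is
          theta at level m - 2.\<close>
        have "m \<noteq> 1" using \<rho>(3) g \<open>tW \<gamma> = - thW\<close> \<open>i = 0\<close> by (auto simp: al_def rw_def lv_def)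
        then have m2: "2 \<le> m" using m by simp
        have "tW \<gamma> - fc ?k thW = thW" using k \<open>tW \<gamma> = - thW\<close> by (intro poly_mapping_eqI) (simp add: lookup_minus)
        moreover have "cone thW" unfolding cone_def thetaW_toW
          using theta_nonneg rootpair_lattice[OF theta_RP] rootpair_nonzero[OF theta_RP] by blast
        ultimately show ?thesis using sn f k m2 by (auto simp: apos_def)
      next
        case False
        then have k: "?k = 0 \<or> ?k = - 1"
          using theta_pair_le1[OF gm nn' False] theta_pair_nonneg[OF nn'] by auto
        show ?thesis
        proof (cases "0 < m + ?k")
          case True then show ?thesis using sn by (simp add: apos_def)
        next
          case False
          \<comment> \<open>The level drops exactly to 0, and positivity now rests on the maximality
            of theta: the finite part becomes gamma + theta.\<close>
          then have km: "?k = - 1" "m = 1" using k m by auto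
          have "fst (ract (s i) \<rho>) = tW (\<gamma> + thR)" using f km by (simp add: thetaW_toW)
          moreover have "nonneg (\<gamma> + thR)"
            using thetaR_ge[OF rootsI[OF gm]] by (simp add: nonneg_def lookup_add) (metis add.commute neg_le_iff_le minus_le_iff diff_ge_0_iff_ge diff_minus_eq_add)
          moreover have "\<gamma> + thR \<noteq> 0" using \<open>- \<gamma> \<noteq> thR\<close> by (simp add: add_eq_0_iff)
          moreover have "L (\<gamma> + thR)" using rootpair_lattice[OF g(1)] rootpair_lattice[OF theta_RP] by simp
          ultimately have "cone (fst (ract (s i) \<rho>))" unfolding cone_def by blast
          then show ?thesis using sn km by (simp add: apos_def)
        qed
      qed
    qed
  qed
qed

text \<open>An affine root determines its reflection. Equality on Q^vee also requires x to match the
  coroots; it does, because x carries root pairs to root pairs and a root has only one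
  coroot.\<close>

lemma gen_conj:
  assumes x: "x \<in> W" and ik: "i \<in> J" "k \<in> J" and eq: "ract x (al i) = al k"
  shows "x \<cdot> s i = s k \<cdot> x"
proof -
  obtain b f g where xx: "x = (b, f, g)" by (cases x)
  have gx: "good x" using x by (rule W_good)
  then have fa: "\<And>\<mu> \<nu>. f (\<mu> + \<nu>) = f \<mu> + f \<nu>" and ga: "\<And>\<mu> \<nu>. g (\<mu> + \<nu>) = g \<mu> + g \<nu>"
    and pr: "\<And>\<beta> \<mu>. \<langle>g \<beta>,f \<mu>\<rangle> = \<langle>\<beta>,\<mu>\<rangle>" by (auto simp: xx good_def)
  have fi: "f (rw i) = rw k" and l: "lv i = lv k + \<langle>b,rw k\<rangle>"
    using eq by (auto simp: ract_def xx al_def)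
  obtain \<gamma> where g: "(\<gamma>, rc i) \<in> RP" "tW \<gamma> = rw i" by (rule simple_RP[OF ik(1)])
  obtain \<delta> where d: "(\<delta>, rc k) \<in> RP" "tW \<delta> = rw k" by (rule simple_RP[OF ik(2)])
  obtain \<gamma>' where g': "(\<gamma>', g (rc i)) \<in> RP" "tW \<gamma>' = f (rw i)" using Waf_rootpair[OF x g(1)] g(2) by (auto simp: xx)
  have "tW \<gamma>' = tW \<delta>" unfolding g' d by (rule fi)
  then have "\<gamma>' = \<delta>" using toW_inj rootpair_lattice[OF g'(1)] rootpair_lattice[OF d(1)] by blast
  then have gi: "g (rc i) = rc k" using coroot_unique[of \<delta>] g'(1) d(1) by blast
  have kf: "\<langle>rc k,f \<mu>\<rangle> = \<langle>rc i,\<mu>\<rangle>" and kg: "\<langle>g \<beta>,rw k\<rangle> = \<langle>\<beta>,rw i\<rangle>" for \<mu> \<beta>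
    using pr[of "rc i" \<mu>] pr[of \<beta> "rw i"] by (simp_all add: gi fi)
  show ?thesis
    by (simp add: xx gen_eq[OF ik(1)] gen_eq[OF ik(2)] wmul_def fun_eq_iff reflP_def reflQ_def good_diff[OF fa] good_diff[OF ga] fi gi kf kg)
       (rule poly_mapping_eqI, simp add: lookup_add lookup_minus l algebra_simps)
qed

text \<open>Reading \<open>ws\<close> from the right, the root alpha_i turns negative at some letter
  k. By \<open>gen_perm\<close> it equals alpha_k just before, and \<open>gen_conj\<close> moves s_i
  to that place, where it cancels s_k.\<close>

lemma exchange:
  assumes "set ws \<subseteq> J" "i \<in> J" "apos (- ract (E ws) (al i))"
  shows "\<exists>vs. set vs \<subseteq> J \<and> Suc (length vs) = length ws \<and> E vs = E ws \<cdot> s i"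
  using assms(1,3)
proof (induction ws)
  case Nil then show ?case using apos_neg apos_al[OF assms(2)] by auto
next
  case (Cons k ws)
  then have k: "k \<in> J" and ws: "set ws \<subseteq> J" by auto
  let ?\<rho> = "ract (E ws) (al i)"
  have r: "ract (E (k # ws)) (al i) = ract (s k) ?\<rho>" using k by (simp add: ract_mul good_gen)
  have ar: "aroot ?\<rho>" by (intro aroot_ract word_Waf ws aroot_al assms)
  show ?case
  proof (cases "apos ?\<rho>")
    case False
    then have "apos (- ?\<rho>)" using aroot_pos ar by blast
    from Cons.IH[OF ws this] obtain vs where "set vs \<subseteq> J" "Suc (length vs) = length ws" "E vs = E ws \<cdot> s i" by blast
    then show ?thesis using k by (intro exI[of _ "k # vs"]) (auto simp: wmul_assoc good_gen)
  next
    case True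
    then have "?\<rho> = al k" using gen_perm[OF k ar] Cons.prems(2) apos_neg unfolding r by blast
    from gen_conj[OF word_Waf[OF ws] assms(2) k this] show ?thesis
      using k ws by (intro exI[of _ ws]) (simp add: wmul_assoc good_gen)
  qed
qed

section \<open>Length and reduced words\<close>

abbreviation "\<l> \<equiv> len n A"

lemma len_le: "set ws \<subseteq> J \<Longrightarrow> \<l> (E ws) \<le> length ws"
  unfolding len_def by (rule Least_le) blast

lemma reduced_exists:
  assumes "x \<in> W" shows "\<exists>ws. reduced_word n A x ws"
proof -
  have "\<exists>k ws. set ws \<subseteq> J \<and> length ws = k \<and> E ws = x" using assms by (auto simp: Waf_word)
  from LeastI_ex[OF this] show ?thesis unfolding reduced_word_def len_def by metis
qed

abbreviation "red \<equiv> reduced_word n A"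

lemma redD: "red x ws \<Longrightarrow> set ws \<subseteq> J" "red x ws \<Longrightarrow> E ws = x" "red x ws \<Longrightarrow> length ws = \<l> x"
  by (auto simp: reduced_word_def)

lemma len_mul_le: "x \<in> W \<Longrightarrow> y \<in> W \<Longrightarrow> \<l> (x \<cdot> y) \<le> \<l> x + \<l> y"
proof -
  assume "x \<in> W" "y \<in> W"
  then obtain u v where "red x u" "red y v" using reduced_exists by blast
  then show ?thesis using len_le[of "u @ v"] by (auto simp: E_append redD)
qed

lemma len_gen_le: "i \<in> J \<Longrightarrow> \<l> (s i) \<le> 1"
  using len_le[of "[i]"] by (simp add: good_gen)

lemma mul_gen_gen: "x \<in> W \<Longrightarrow> i \<in> J \<Longrightarrow> x \<cdot> s i \<cdot> s i = x"
  by (simp add: W_assoc W_good)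

lemma len_desc:
  assumes "x \<in> W" "i \<in> J" "apos (- ract x (al i))" shows "Suc (\<l> (x \<cdot> s i)) = \<l> x"
proof -
  obtain ws where ws: "red x ws" using assms reduced_exists by blast
  obtain vs where "set vs \<subseteq> J" "Suc (length vs) = length ws" "E vs = x \<cdot> s i"
    using exchange[of ws i] assms redD[OF ws] by auto
  then have "Suc (\<l> (x \<cdot> s i)) \<le> \<l> x" using len_le redD[OF ws] by (metis Suc_le_mono)
  moreover have "\<l> (x \<cdot> s i \<cdot> s i) \<le> \<l> (x \<cdot> s i) + 1"
    using len_mul_le[of "x \<cdot> s i" "s i"] len_gen_le assms W_mul gen_W by (meson add_left_mono order_trans)
  ultimately show ?thesis using assms by (simp add: mul_gen_gen)
qed

lemma ract_mul_gen: "x \<in> W \<Longrightarrow> i \<in> J \<Longrightarrow> ract (x \<cdot> s i) (al i) = - ract x (al i)"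
  by (simp add: ract_mul W_good ract_gen_al ract_linear)

lemma len_asc:
  assumes "x \<in> W" "i \<in> J" "apos (ract x (al i))" shows "\<l> (x \<cdot> s i) = Suc (\<l> x)"
  using len_desc[of "x \<cdot> s i" i] assms by (simp add: W_mul gen_W ract_mul_gen mul_gen_gen)

lemma len_asc_iff: "x \<in> W \<Longrightarrow> i \<in> J \<Longrightarrow> apos (ract x (al i)) \<longleftrightarrow> \<l> x < \<l> (x \<cdot> s i)"
  using len_asc[of x i] len_desc[of x i] aroot_pos[OF aroot_ract[OF _ aroot_al], of x i] by fastforce

text \<open>The last letter of a nonempty reduced word is a descent. This yields faithfulness of the
  root action, the means of identifying group elements.\<close>

lemma no_desc:
  assumes "x \<in> W" "\<And>i. i \<in> J \<Longrightarrow> apos (ract x (al i))" shows "x = wone"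
proof -
  obtain ws where ws: "red x ws" using assms reduced_exists by blast
  show ?thesis
  proof (cases ws rule: rev_cases)
    case Nil then show ?thesis using redD[OF ws] by simp
  next
    case (snoc vs i)
    then have i: "i \<in> J" "set vs \<subseteq> J" using redD[OF ws] by auto
    have x: "x = E vs \<cdot> s i" using redD[OF ws] snoc i by (simp add: E_append good_gen)
    then have "x \<cdot> s i = E vs" using i by (simp add: mul_gen_gen word_Waf)
    then have "\<l> (x \<cdot> s i) < \<l> x" using len_le[OF i(2)] redD[OF ws] snoc by simp
    then show ?thesis using len_asc[OF assms(1) i(1) assms(2)[OF i(1)]] by simp
  qed
qed

lemma winv_E: "set u \<subseteq> J \<Longrightarrow> winv (E u) = E (rev u)"
proof -
  assume u: "set u \<subseteq> J"
  have "winv (E u) = E (rev u) \<cdot> E u \<cdot> winv (E u)" using u by (simp add: E_rev)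
  also have "\<dots> = E (rev u)" using u by (simp add: wmul_assoc E_good winv word_Waf)
  finally show ?thesis .
qed

lemma red_rev: "red x ws \<Longrightarrow> red (winv x) (rev ws)"
proof -
  assume ws: "red x ws"
  note r = redD[OF ws]
  have ix: "winv x = E (rev ws)" using winv_E r by blast
  obtain vs where vs: "red (winv x) vs" using reduced_exists winv(1) r word_Waf by blast
  have "E (rev vs) = winv (winv x)" using winv_E redD[OF vs] by metis
  also have "\<dots> = x" using winv_E[of "rev ws"] r ix by simp
  finally have "length ws \<le> length vs" using len_le[of "rev vs"] redD[OF vs] r by simp
  then have "length (rev ws) = \<l> (winv x)" using len_le[of "rev ws"] r ix redD[OF vs] by simp
  then show ?thesis using r ix by (simp add: reduced_word_def)
qed

lemma red_tl: "red x (i # u) \<Longrightarrow> red (E u) u"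
proof -
  assume r: "red x (i # u)"
  note d = redD[OF r]
  have i: "i \<in> J" and u: "set u \<subseteq> J" using d by auto
  have "\<l> x \<le> \<l> (s i) + \<l> (E u)" using len_mul_le[OF gen_W[OF i] word_Waf[OF u]] d by simp
  then have "length u \<le> \<l> (E u)" using len_gen_le[OF i] d by simp
  then show ?thesis using len_le[OF u] u by (simp add: reduced_word_def)
qed

lemma red_append: "red x u \<Longrightarrow> red y v \<Longrightarrow> \<l> (x \<cdot> y) = \<l> x + \<l> y \<Longrightarrow> red (x \<cdot> y) (u @ v)"
  by (auto simp: reduced_word_def E_append)

lemma red_snoc: "red x u \<Longrightarrow> i \<in> J \<Longrightarrow> \<l> (x \<cdot> s i) = Suc (\<l> x) \<Longrightarrow> red (x \<cdot> s i) (u @ [i])"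
  using good_gen[of i] by (auto simp: reduced_word_def E_append)

lemma ract_winv: "x \<in> W \<Longrightarrow> ract (winv x) (ract x \<rho>) = \<rho>" "x \<in> W \<Longrightarrow> ract x (ract (winv x) \<rho>) = \<rho>"
  by (simp_all flip: ract_mul add: W_good winv)

text \<open>The hypothesis says that the inversion sets of x and of the inverse of y are disjoint.
  The induction moves the first letter i of a reduced word of y over to x; disjointness survives
  because s_i changes the sign of no positive root but alpha_i.\<close>

lemma len_add:
  assumes "x \<in> W" "y \<in> W"
    and "\<And>\<sigma>. aroot \<sigma> \<Longrightarrow> apos (- \<sigma>) \<Longrightarrow> apos (ract y \<sigma>) \<Longrightarrow> apos (ract x (ract y \<sigma>))"
  shows "\<l> (x \<cdot> y) = \<l> x + \<l> y"
proof -
  obtain ys where "red y ys" using reduced_exists assms by blast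
  then show ?thesis using assms
  proof (induction ys arbitrary: x y)
    case Nil
    then have "y = wone" using redD(2)[OF Nil(1)] by simp
    then show ?case using redD[OF Nil(1)] W_good[OF Nil(2)] by simp
  next
    case (Cons i ys)
    note r = redD[OF Cons.prems(1)] and x = Cons.prems(2) and cond = Cons.prems(4)
    let ?y = "E ys"
    have i: "i \<in> J" and ys: "set ys \<subseteq> J" and y: "y = s i \<cdot> ?y" using r by auto
    have y': "?y \<in> W" using ys by (rule word_Waf)
    have ry: "red ?y ys" using red_tl Cons.prems(1) by blast
    have iy: "winv y = winv ?y \<cdot> s i"
      using winv_E[of "i # ys"] winv_E[OF ys] r i ys good_gen[of i] by (simp add: E_append)
    have "\<l> (winv ?y) < \<l> (winv ?y \<cdot> s i)"
      using redD(3)[OF red_rev[OF ry]] redD(3)[OF red_rev[OF Cons.prems(1)]] iy by simp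
    then have pos: "apos (ract (winv ?y) (al i))" using len_asc_iff[OF winv(1)[OF y'] i] by blast
    \<comment> \<open>The negative root that y carries to alpha_i; the hypothesis applied to it
      shows that x s_i is longer than x.\<close>
    let ?\<sigma> = "- ract (winv ?y) (al i)"
    have y\<sigma>: "ract y ?\<sigma> = al i"
      unfolding y by (simp add: ract_mul good_gen[OF i] ract_linear W_good winv y' ract_winv ract_gen_al[OF i])
    have ys': "ract y \<rho> = ract (s i) (ract ?y \<rho>)" for \<rho> unfolding y by (simp add: ract_mul good_gen[OF i])
    have "aroot ?\<sigma>" by (intro aroot_uminus aroot_ract winv y' aroot_al i)
    then have "apos (ract x (al i))" using cond[of ?\<sigma>] y\<sigma> pos apos_al[OF i] by simp
    then have xs: "\<l> (x \<cdot> s i) = Suc (\<l> x)" using len_asc x i by blast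
    have "\<l> (x \<cdot> s i \<cdot> ?y) = \<l> (x \<cdot> s i) + \<l> ?y"
    proof (rule Cons.IH[OF ry _ y'])
      show "x \<cdot> s i \<in> W" using x i W_mul gen_W by blast
      fix \<sigma> assume s: "aroot \<sigma>" "apos (- \<sigma>)" "apos (ract ?y \<sigma>)"
      have "ract ?y \<sigma> \<noteq> al i"
      proof
        assume "ract ?y \<sigma> = al i"
        then have "\<sigma> = ract (winv ?y) (al i)" using ract_winv(1)[OF y', of \<sigma>] by simp
        then show False using pos s(2) apos_neg by blast
      qed
      then have "apos (ract y \<sigma>)" unfolding ys' using gen_perm[OF i aroot_ract[OF y' s(1)] s(3)] by blast
      then have "apos (ract x (ract y \<sigma>))" using cond s by blast
      then show "apos (ract (x \<cdot> s i) (ract ?y \<sigma>))" by (simp add: ract_mul W_good[OF x] ys')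
    qed
    also have "x \<cdot> s i \<cdot> ?y = x \<cdot> y" using W_assoc[OF x] y by simp
    finally show ?case using xs r redD(3)[OF ry] by simp
  qed
qed

section \<open>The finite Weyl group and its longest element\<close>

lemma WI_fst: assumes "v \<in> WI" shows "fst v = 0"
proof -
  obtain ws where "set ws \<subseteq> I" "v = E ws" using assms by (auto simp: Wfin_word)
  moreover have "set ws \<subseteq> I \<Longrightarrow> fst (E ws) = 0"
  proof (induction ws)
    case (Cons i ws)
    then have "i \<in> J" "i \<in> I" using I_J by auto
    then show ?case using Cons by (auto simp: gen_eq[OF \<open>i \<in> J\<close>] wmul_def lv_def I_nz split: prod.splits)
  qed (simp add: wone_def)
  ultimately show ?thesis by simp
qed

lemma WI_ract: "v \<in> WI \<Longrightarrow> ract v \<rho> = (fst (snd v) (fst \<rho>), snd \<rho>)"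
  using WI_fst[of v] by (auto simp: ract_def split: prod.splits)

lemma WI_al0: "v \<in> WI \<Longrightarrow> apos (ract v (al 0))"
  by (simp add: WI_ract al_def lv_def apos_def)

lemma WI_no_desc: "v \<in> WI \<Longrightarrow> (\<And>i. i \<in> I \<Longrightarrow> apos (ract v (al i))) \<Longrightarrow> v = wone"
  using no_desc[of v] WI_al0[of v] Wfin_Waf[of v] by (auto simp: J_eq)

text \<open>\<open>len\<close> ranges over words in all affine generators. Elements of
  \<open>WI\<close> keep alpha_0 at level 1, so their descents lie in I and a reduced word can be
  peeled off within I.\<close>

lemma WI_red: "v \<in> WI \<Longrightarrow> \<exists>ws. red v ws \<and> set ws \<subseteq> I"
proof (induction "\<l> v" arbitrary: v rule: less_induct)
  case less
  show ?case
  proof (cases "v = wone")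
    case True
    have "\<l> wone = 0" using len_le[of "[]"] by simp
    then show ?thesis using True by (intro exI[of _ "[]"]) (simp add: reduced_word_def)
  next
    case False
    then obtain i where i: "i \<in> I" "\<not> apos (ract v (al i))" using WI_no_desc less.prems by blast
    have v: "v \<in> W" and iJ: "i \<in> J" using less.prems Wfin_Waf i I_J by auto
    have "apos (- ract v (al i))" using aroot_pos[OF aroot_ract[OF v aroot_al[OF iJ]]] i by blast
    from len_desc[OF v iJ this] have l: "\<l> v = Suc (\<l> (v \<cdot> s i))" by simp
    then obtain ws where ws: "red (v \<cdot> s i) ws" "set ws \<subseteq> I"
      using less.hyps[of "v \<cdot> s i"] WI_mul[OF less.prems gen_WI[OF i(1)]] by auto
    have "red (v \<cdot> s i \<cdot> s i) (ws @ [i])" using red_snoc[OF ws(1) iJ] l v iJ by (simp add: mul_gen_gen)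
    then show ?thesis using ws i v iJ by (intro exI[of _ "ws @ [i]"]) (simp add: mul_gen_gen)
  qed
qed

lemma WI_eqI:
  assumes "u \<in> WI" "v \<in> WI" "\<And>i. i \<in> I \<Longrightarrow> ract u (al i) = ract v (al i)"
  shows "u = v"
proof -
  have u: "u \<in> W" "winv u \<in> WI" using assms winv Wfin_Waf by auto
  have "winv u \<cdot> v = wone"
  proof (rule WI_no_desc)
    show "winv u \<cdot> v \<in> WI" using u assms WI_mul by blast
    fix i assume i: "i \<in> I"
    have "ract (winv u \<cdot> v) (al i) = ract (winv u) (ract u (al i))"
      using assms(3)[OF i] by (simp add: ract_mul W_good winv u)
    also have "\<dots> = al i" using u by (simp add: ract_winv)
    finally show "apos (ract (winv u \<cdot> v) (al i))" using apos_al I_J i by simp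
  qed
  then have "u \<cdot> (winv u \<cdot> v) = u \<cdot> wone" by simp
  then show ?thesis using winv_cancel(2)[OF u(1)] W_good[OF u(1)] by simp
qed

lemma WI_finite: "finite WI"
proof -
  let ?F = "{f. \<forall>i. (i \<in> I \<longrightarrow> f i \<in> tW ` roots n A) \<and> (i \<notin> I \<longrightarrow> f i = 0)}"
  let ?h = "\<lambda>v i. if i \<in> I then fst (ract v (al i)) else 0"
  have "?h ` WI \<subseteq> ?F"
    using aroot_ract[OF Wfin_Waf aroot_al[OF I_J]] by (auto simp: aroot_def)
  moreover have "finite ?F" by (rule finite_set_of_finite_funs) (auto simp: finite_roots)
  moreover have "inj_on ?h WI"
  proof (rule inj_onI)
    fix u v assume uv: "u \<in> WI" "v \<in> WI" "?h u = ?h v"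
    show "u = v"
    proof (rule WI_eqI[OF uv(1,2)])
      fix i assume "i \<in> I"
      then have "fst (ract u (al i)) = fst (ract v (al i))" using fun_cong[OF uv(3), of i] by simp
      then show "ract u (al i) = ract v (al i)" using uv by (simp add: WI_ract)
    qed
  qed
  ultimately show ?thesis by (meson finite_imageD finite_subset)
qed

lemma rsmul_simps [simp]: "rsmul 0 \<rho> = 0" "rsmul 1 \<rho> = \<rho>" "fst (rsmul k \<rho>) = fc k (fst \<rho>)" "snd (rsmul k \<rho>) = k * snd \<rho>"
  by (simp_all add: rsmul_def prod_eq_iff)

lemma apos_smul: "apos \<rho> \<Longrightarrow> 0 < k \<Longrightarrow> apos (rsmul k \<rho>)"
proof -
  assume a: "apos \<rho>" "0 < k"
  have "cone (fc k \<mu>)" if c: "cone \<mu>" for \<mu>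
  proof -
    obtain \<gamma> where "L \<gamma>" "nonneg \<gamma>" "\<gamma> \<noteq> 0" "\<mu> = tW \<gamma>" using c unfolding cone_def by blast
    then show ?thesis using a(2) coneI[of "fc k \<gamma>"] by (simp add: nonneg_def)
  qed
  then show ?thesis using a by (auto simp: apos_def)
qed

lemma apos_sum:
  assumes "finite S" "\<And>i. i \<in> S \<Longrightarrow> 0 \<le> k i" "\<And>i. i \<in> S \<Longrightarrow> apos (\<rho> i)"
  shows "(\<Sum>i\<in>S. rsmul (k i) (\<rho> i)) = 0 \<and> (\<forall>i\<in>S. k i = 0) \<or> apos (\<Sum>i\<in>S. rsmul (k i) (\<rho> i))"
  using assms
proof (induction S rule: finite_induct)
  case (insert j S)
  then have IH: "(\<Sum>i\<in>S. rsmul (k i) (\<rho> i)) = 0 \<and> (\<forall>i\<in>S. k i = 0) \<or> apos (\<Sum>i\<in>S. rsmul (k i) (\<rho> i))" by simp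
  show ?case
  proof (cases "k j = 0")
    case True then show ?thesis using insert IH by simp
  next
    case False
    then have "0 < k j" using insert.prems(1)[of j] by simp
    then have "apos (rsmul (k j) (\<rho> j))" using insert.prems(2)[of j] by (simp add: apos_smul)
    then have "apos (rsmul (k j) (\<rho> j) + (\<Sum>i\<in>S. rsmul (k i) (\<rho> i)))"
      using IH apos_add by (metis add.right_neutral)
    then show ?thesis using insert.hyps by simp
  qed
qed simp

lemma ract_sum: "good x \<Longrightarrow> ract x (\<Sum>i\<in>S. \<rho> i) = (\<Sum>i\<in>S. ract x (\<rho> i))"
proof (induction S rule: infinite_finite_induct)
  case (insert j S) then show ?case by (simp add: ract_linear)
next
  case empty
  have "ract x (0 + 0) = ract x 0 + ract x 0" using empty by (rule ract_linear)
  then show ?case by (metis add.right_neutral add_cancel_left_left sum.empty)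
next
  case (infinite S)
  have "ract x (0 + 0) = ract x 0 + ract x 0" using infinite(2) by (rule ract_linear)
  then show ?case using infinite(1) by (metis add.right_neutral add_cancel_left_left sum.infinite)
qed

lemma fst_sum: "fst (\<Sum>i\<in>S. (\<rho> i :: wt \<times> int)) = (\<Sum>i\<in>S. fst (\<rho> i))"
  and snd_sum: "snd (\<Sum>i\<in>S. (\<rho> i :: wt \<times> int)) = (\<Sum>i\<in>S. snd (\<rho> i))"
  by (induction S rule: infinite_finite_induct) auto

lemma ract_cone:
  assumes "x \<in> W" "cone \<mu>"
  shows "(\<And>i. i \<in> I \<Longrightarrow> apos (ract x (al i))) \<Longrightarrow> apos (ract x (\<mu>, 0))"
    and "(\<And>i. i \<in> I \<Longrightarrow> apos (- ract x (al i))) \<Longrightarrow> apos (- ract x (\<mu>, 0))"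
proof -
  obtain \<gamma> where g: "L \<gamma>" "nonneg \<gamma>" "\<gamma> \<noteq> 0" "\<mu> = tW \<gamma>" using assms(2) by (auto simp: cone_def)
  have "(\<mu>, 0) = (\<Sum>i\<in>I. rsmul (lk \<gamma> i) (al i))"
    by (auto simp: prod_eq_iff g fst_sum snd_sum toW_def al_def rw_def lv_def I_nz intro!: sum.cong sum.neutral[symmetric])
  then have e: "ract x (\<mu>, 0) = (\<Sum>i\<in>I. rsmul (lk \<gamma> i) (ract x (al i)))"
    using assms(1) by (simp add: ract_sum ract_linear W_good)
  have e': "- ract x (\<mu>, 0) = (\<Sum>i\<in>I. rsmul (lk \<gamma> i) (- ract x (al i)))"
    unfolding e sum_negf[symmetric] by (intro sum.cong) (auto simp: prod_eq_iff)
  have nz: "\<not> (\<forall>i\<in>I. lk \<gamma> i = 0)" using g by (metis in_lattice_eqI in_lattice_simps(1) lookup_zero)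
  have nn: "0 \<le> lk \<gamma> i" for i using g by (simp add: nonneg_def)
  show "apos (ract x (\<mu>, 0))" if a: "\<And>i. i \<in> I \<Longrightarrow> apos (ract x (al i))"
    unfolding e using apos_sum[of I "lk \<gamma>" "\<lambda>i. ract x (al i)", OF finite_Iset nn a] nz by blast
  show "apos (- ract x (\<mu>, 0))" if a: "\<And>i. i \<in> I \<Longrightarrow> apos (- ract x (al i))"
    unfolding e' using apos_sum[of I "lk \<gamma>" "\<lambda>i. - ract x (al i)", OF finite_Iset nn a] nz by blast
qed

text \<open>The inversions of the inverse of v are positive finite roots at level 0, and x keeps all
  of these positive.\<close>

lemma len_min_coset:
  assumes "x \<in> W" "\<And>i. i \<in> I \<Longrightarrow> apos (ract x (al i))" "v \<in> WI"
  shows "\<l> (x \<cdot> v) = \<l> x + \<l> v"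
proof (rule len_add)
  show "x \<in> W" "v \<in> W" using assms Wfin_Waf by auto
  fix \<sigma> assume s: "aroot \<sigma>" "apos (- \<sigma>)" "apos (ract v \<sigma>)"
  then have "snd \<sigma> = 0" "cone (fst (snd v) (fst \<sigma>))" by (auto simp: WI_ract assms(3) apos_def)
  then show "apos (ract x (ract v \<sigma>))" using ract_cone(1)[OF assms(1) _ assms(2)] by (simp add: WI_ract assms(3))
qed

text \<open>The description requires uniqueness: a longest element makes every positive root of
  level 0 negative, so for two of them, x and y, the product of y with the inverse of x keeps the
  simple roots positive and is the identity.\<close>

lemma w0_WI: "w0 n A \<in> WI"
proof -
  have "WI \<noteq> {}" using wone_W by auto
  then obtain x where x: "x \<in> WI" "\<And>y. y \<in> WI \<Longrightarrow> \<l> y \<le> \<l> x" using obtain_max[OF WI_finite, of \<l>] by blast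
  have desc: "apos (- ract z (al i))" if z: "z \<in> WI" "\<And>y. y \<in> WI \<Longrightarrow> \<l> y \<le> \<l> z" "i \<in> I" for z i
  proof (rule ccontr)
    assume "\<not> apos (- ract z (al i))"
    then have "apos (ract z (al i))" using aroot_pos aroot_ract Wfin_Waf aroot_al I_J z by blast
    then have "\<l> (z \<cdot> s i) = Suc (\<l> z)" using len_asc Wfin_Waf I_J z by blast
    then show False using z(2)[OF WI_mul[OF z(1) gen_WI[OF z(3)]]] by simp
  qed
  have "y = x" if y: "y \<in> WI" "\<And>z. z \<in> WI \<Longrightarrow> \<l> z \<le> \<l> y" for y
  proof -
    have iW: "winv x \<in> W" "winv x \<in> WI" and xW: "x \<in> W" and yW: "y \<in> W" using winv x y Wfin_Waf by auto
    have neg: "apos (- ract z (\<mu>, 0))" if z: "z \<in> WI" "\<And>i. i \<in> I \<Longrightarrow> apos (- ract z (al i))" "cone \<mu>" for z \<mu>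
      using ract_cone(2)[OF Wfin_Waf[OF z(1)] z(3)] z(2) by blast
    have "y \<cdot> winv x = wone"
    proof (rule WI_no_desc)
      show "y \<cdot> winv x \<in> WI" using iW y WI_mul by blast
      fix i assume i: "i \<in> I"
      obtain \<mu> where m: "ract (winv x) (al i) = (\<mu>, 0)" using WI_ract[OF iW(2)] i by (auto simp: al_def lv_def I_nz)
      have ar: "aroot (\<mu>, 0)" using aroot_ract[OF iW(1) aroot_al[OF I_J[OF i]]] m by simp
      have "\<not> cone \<mu>"
      proof
        assume "cone \<mu>"
        then have "apos (- ract x (\<mu>, 0))" using neg[OF x(1) desc[OF x]] by blast
        then have "apos (- al i)" using m ract_winv(2)[OF xW, of "al i"] by simp
        then show False using apos_al[OF I_J[OF i]] apos_neg by blast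
      qed
      then have "cone (- \<mu>)" using aroot_pos[OF ar] by (auto simp: apos_def)
      then have "apos (- ract y (- \<mu>, 0))" using neg[OF y(1) desc[OF y]] by blast
      moreover have "- ract y (- \<mu>, 0) = ract y (\<mu>, 0)" using ract_linear(2)[OF W_good[OF yW], of "(\<mu>, 0)"] by simp
      ultimately show "apos (ract (y \<cdot> winv x) (al i))" using m by (simp add: ract_mul W_good yW)
    qed
    then have "y \<cdot> winv x \<cdot> x = x" by simp
    then show ?thesis using W_assoc[OF yW] winv(3)[OF xW] W_good[OF yW] by simp
  qed
  then have "\<exists>!x. x \<in> WI \<and> (\<forall>y\<in>WI. \<l> y \<le> \<l> x)" using x by blast
  from theI'[OF this] show ?thesis unfolding w0_def by blast
qed

section \<open>Translations\<close>

lemma sP_sQ_linear: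
  assumes "i \<in> I" shows "sQ n A i 0 = 0" "sP n A i 0 = 0" using assms by (simp_all add: sQ_refl sP_refl)

text \<open>Conjugation by s_i follows the generation of \<open>rootpairs\<close>; in particular the
  linear part of s_0 lies in \<open>WI\<close>.\<close>

lemma refl_WI: "(\<gamma>, c) \<in> RP \<Longrightarrow> (0, reflP n c (tW \<gamma>), reflQ n c (tW \<gamma>)) \<in> WI"
proof (induction \<gamma> c rule: rootpairs.induct)
  case (simple i)
  then have "s i = (0, reflP n (sg i) (tW (sg i)), reflQ n (sg i) (tW (sg i)))"
    by (simp add: gen_def I_nz sP_refl sQ_refl)
  then show ?case using gen_WI[OF simple] by simp
next
  case (refl \<gamma> c i)
  let ?x = "(0, reflP n c (tW \<gamma>), reflQ n c (tW \<gamma>))"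
  have "s i \<cdot> ?x \<cdot> s i = (0, reflP n (sQ n A i c) (tW (sR n A i \<gamma>)), reflQ n (sQ n A i c) (tW (sR n A i \<gamma>)))"
    using refl.hyps(2) by (simp add: gen_def I_nz wmul_def fun_eq_iff toW_sR refl_conj sP_sQ_linear)
  then show ?case using WI_mul[OF WI_mul[OF gen_WI[OF refl.hyps(2)] refl.IH] gen_WI[OF refl.hyps(2)]] by simp
qed

definition fin :: "waf \<Rightarrow> waf" where "fin x = (0, fst (snd x), snd (snd x))"

lemma Waf_fin: assumes "x \<in> W" shows "fin x \<in> WI" "L (fst x)"
proof -
  obtain ws where "set ws \<subseteq> J" "x = E ws" using assms by (auto simp: Waf_word)
  moreover have "set ws \<subseteq> J \<Longrightarrow> fin (E ws) \<in> WI \<and> L (fst (E ws))"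
  proof (induction ws)
    case Nil then show ?case using wone_W by (simp add: fin_def wone_def)
  next
    case (Cons i ws)
    then have i: "i \<in> J" and IH: "fin (E ws) \<in> WI" "L (fst (E ws))" by auto
    obtain \<gamma> where g: "(\<gamma>, rc i) \<in> RP" "tW \<gamma> = rw i" by (rule simple_RP[OF i])
    have "fin (s i) \<in> WI" using refl_WI[OF g(1)] g(2) by (simp add: fin_def gen_eq[OF i])
    then have "fin (s i) \<cdot> fin (E ws) \<in> WI" using IH WI_mul by blast
    moreover have "fin (s i) \<cdot> fin (E ws) = fin (E (i # ws))"
      by (simp add: fin_def wmul_def gen_eq[OF i] split: prod.splits)
    moreover have "L (fst (E (i # ws)))" using IH(2) rootpair_lattice[OF g(1)]
      by (cases "E ws") (simp add: wmul_def gen_eq[OF i] reflQ_def)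
    ultimately show ?case by simp
  qed
  ultimately show "fin x \<in> WI" "L (fst x)" by auto
qed

lemma transl_fin: "x = transl (fst x) \<cdot> fin x"
  by (simp add: transl_def fin_def wmul_def split: prod.splits)

lemma good_transl [simp]: "good (transl \<beta>)" by (simp add: transl_def good_def)

lemma transl_mul: "transl a \<cdot> transl b = transl (a + b)" "transl 0 = wone"
  by (simp_all add: transl_def wmul_def wone_def)

lemma transl_fst: assumes "x \<in> W" shows "transl (fst x) = x \<cdot> winv (fin x)" "transl (fst x) \<in> W"
proof -
  have f: "fin x \<in> W" using Waf_fin[OF assms] Wfin_Waf by blast
  have "x \<cdot> winv (fin x) = transl (fst x) \<cdot> fin x \<cdot> winv (fin x)" using transl_fin by metis
  also have "\<dots> = transl (fst x)" using winv(4)[OF f] by (simp add: wmul_assoc)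
  finally show "transl (fst x) = x \<cdot> winv (fin x)" by simp
  then show "transl (fst x) \<in> W" using W_mul[OF assms winv(1)[OF f]] by simp
qed

text \<open>The translations that are products of generators; that they exhaust the coroot lattice
  has to be proved.\<close>

definition T :: "wt set" where "T = {c. transl c \<in> W}"

lemma T_add: "a \<in> T \<Longrightarrow> b \<in> T \<Longrightarrow> a + b \<in> T"
  using W_mul[of "transl a" "transl b"] by (simp add: T_def transl_mul)

lemma winv_transl: "transl c \<in> W \<Longrightarrow> winv (transl c) = transl (- c)"
proof -
  assume c: "transl c \<in> W"
  have "winv (transl c) = transl (- c) \<cdot> transl c \<cdot> winv (transl c)" by (simp add: transl_mul)
  also have "\<dots> = transl (- c)" by (simp add: wmul_assoc winv c)
  finally show ?thesis .
qed

lemma T_uminus: "a \<in> T \<Longrightarrow> - a \<in> T"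
  using winv(1)[of "transl a"] winv_transl[of a] by (simp add: T_def)

lemma T_zero: "0 \<in> T" using wone_W by (simp add: T_def transl_mul)

lemma T_cmul: "a \<in> T \<Longrightarrow> fc k a \<in> T"
proof -
  assume a: "a \<in> T"
  have nat: "fc (int m) b \<in> T" if "b \<in> T" for m b
    by (induction m) (simp_all add: T_zero frag_cmul_distrib T_add that)
  show ?thesis using nat[OF a, of "nat k"] nat[OF T_uminus[OF a], of "nat (- k)"] by (cases "0 \<le> k") simp_all
qed

lemma T_sum: "finite S \<Longrightarrow> (\<And>i. i \<in> S \<Longrightarrow> f i \<in> T) \<Longrightarrow> sum f S \<in> T"
  by (induction S rule: finite_induct) (auto simp: T_zero T_add)

lemma T_sQ: assumes "i \<in> I" "c \<in> T" shows "sQ n A i c \<in> T"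
proof -
  have i: "s i \<in> W" using assms I_J gen_W by blast
  have "s i \<cdot> transl c \<in> W" using assms i W_mul by (auto simp: T_def)
  from transl_fst(2)[OF this] show ?thesis using assms
    by (simp add: T_def gen_def I_nz wmul_def transl_def)
qed

text \<open>That theta^vee is a short coroot, in a form stable under simple reflections and carrying
  along membership in \<open>T\<close>.\<close>

definition short_pair :: "wt \<Rightarrow> wt \<Rightarrow> bool" where
  "short_pair \<gamma> c \<longleftrightarrow> (\<gamma>, c) \<in> RP \<and> c \<in> T \<and> (\<forall>\<delta>\<in>roots n A. \<delta> = \<gamma> \<or> \<delta> = - \<gamma> \<or> \<bar>\<langle>c,tW \<delta>\<rangle>\<bar> \<le> 1)"

lemma short_theta: "short_pair thR thV"
proof -
  have "thV \<in> T" using transl_fst(2)[OF gen_W[of 0]] by (simp add: T_def gen_def)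
  moreover have "\<delta> = thR \<or> \<delta> = - thR \<or> \<bar>\<langle>thV,tW \<delta>\<rangle>\<bar> \<le> 1" if d: "\<delta> \<in> roots n A" for \<delta>
  proof -
    obtain b where b: "(\<delta>, b) \<in> RP" by (rule rootsE[OF d])
    consider "nonneg \<delta>" | "nonneg (- \<delta>)" using root_sign[OF b] by blast
    then show ?thesis
    proof cases
      case 1 then show ?thesis using theta_pair_le1[OF b] theta_pair_nonneg[of \<delta>] by auto
    next
      case 2 then show ?thesis using theta_pair_le1[OF rootpair_uminus[OF b]] theta_pair_nonneg[of "- \<delta>"] by (auto simp: minus_equation_iff[of \<delta>])
    qed
  qed
  ultimately show ?thesis using theta_RP by (auto simp: short_pair_def)
qed

lemma sR_sR: assumes "i \<in> I" "L \<delta>" shows "sR n A i (sR n A i \<delta>) = \<delta>"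
proof (rule toW_inj)
  have "\<langle>sg i, alphaW n A i\<rangle> = 2" using assms by (simp add: lookup_alphaW A_diag)
  then show "tW (sR n A i (sR n A i \<delta>)) = tW \<delta>" using assms(1) by (simp add: toW_sR sP_refl refl_invol)
qed (use assms in \<open>simp_all add: sR_refl reflR_def\<close>)

lemma short_refl: assumes "i \<in> I" "short_pair \<gamma> c" shows "short_pair (sR n A i \<gamma>) (sQ n A i c)"
proof -
  have gc: "(\<gamma>, c) \<in> RP" "c \<in> T" using assms(2) by (auto simp: short_pair_def)
  have "\<delta> = sR n A i \<gamma> \<or> \<delta> = - sR n A i \<gamma> \<or> \<bar>\<langle>sQ n A i c,tW \<delta>\<rangle>\<bar> \<le> 1" if d: "\<delta> \<in> roots n A" for \<delta>
  proof -
    obtain b where b: "(\<delta>, b) \<in> RP" by (rule rootsE[OF d])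
    have s: "sR n A i (sR n A i \<delta>) = \<delta>" using sR_sR assms(1) rootpair_lattice[OF b] by blast
    have "sR n A i \<delta> \<in> roots n A" using rootpairs.refl[OF b assms(1)] rootsI by blast
    then have "sR n A i \<delta> = \<gamma> \<or> sR n A i \<delta> = - \<gamma> \<or> \<bar>\<langle>c,tW (sR n A i \<delta>)\<rangle>\<bar> \<le> 1"
      using assms(2) by (auto simp: short_pair_def)
    moreover have "sR n A i (- \<gamma>) = - sR n A i \<gamma>" using assms(1) by (simp add: sR_refl reflR_def)
    moreover have "\<langle>c,tW (sR n A i \<delta>)\<rangle> = \<langle>sQ n A i c,tW \<delta>\<rangle>"
      using assms(1) by (simp add: toW_sR sP_refl sQ_refl refl_adjoint)
    ultimately show ?thesis using s by metis
  qed
  then show ?thesis using rootpairs.refl[OF gc(1) assms(1)] T_sQ[OF assms(1) gc(2)] by (auto simp: short_pair_def)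
qed

text \<open>If alpha_j is gamma or -gamma, then c is already its coroot up to sign. Otherwise the
  pairing k is 1 or -1, and k (c - s_j c) = k^2 alpha_j^vee.\<close>

lemma short_simple:
  assumes "short_pair \<gamma> c" "j \<in> I" "\<langle>c, alphaW n A j\<rangle> \<noteq> 0"
  shows "sg j \<in> T"
proof -
  have gc: "(\<gamma>, c) \<in> RP" "c \<in> T" using assms(1) by (auto simp: short_pair_def)
  have j: "(sg j, sg j) \<in> RP" using assms(2) by (rule rootpairs.simple)
  have "sg j = \<gamma> \<or> sg j = - \<gamma> \<or> \<bar>\<langle>c,tW (sg j)\<rangle>\<bar> \<le> 1" using assms(1) rootsI[OF j] by (auto simp: short_pair_def)
  then consider "sg j = \<gamma>" | "sg j = - \<gamma>" | "\<bar>\<langle>c, alphaW n A j\<rangle>\<bar> \<le> 1" using assms(2) by auto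
  then show ?thesis
  proof cases
    case 1 then show ?thesis using coroot_unique[OF gc(1)] j gc(2) by force
  next
    case 2 then show ?thesis using coroot_unique[OF rootpair_uminus[OF gc(1)]] j T_uminus[OF gc(2)] by metis
  next
    case 3
    let ?k = "\<langle>c, alphaW n A j\<rangle>"
    have "?k = 1 \<or> ?k = - 1" using 3 assms(3) by linarith
    then have k: "?k * ?k = 1" by auto
    have "sg j = fc ?k (c + - sQ n A j c)"
      by (rule poly_mapping_eqI) (simp add: sQ_def lookup_minus lookup_add lookup_single when_def k)
    then show ?thesis using T_cmul[OF T_add[OF gc(2) T_uminus[OF T_sQ[OF assms(2) gc(2)]]]] by metis
  qed
qed

text \<open>The coroots in the orbit of \<open>\<theta>\<^sup>\<or>\<close> pair with all but two roots in \<open>{-1, 0, 1}\<close>, so their differences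
  under \<open>s\<^sub>j\<close> are \<open>\<plusminus> \<alpha>\<^sub>j\<^sup>\<or>\<close> or 0; by indecomposability every \<open>j\<close> is reached.\<close>

lemma transl_W: assumes "L \<beta>" shows "transl \<beta> \<in> W"
proof -
  define S where "S = {j \<in> I. \<exists>\<gamma> c. short_pair \<gamma> c \<and> \<langle>c, alphaW n A j\<rangle> \<noteq> 0}"
  have "S = I"
  proof (rule ccontr)
    assume SI: "S \<noteq> I"
    have "S \<noteq> {}"
    proof
      assume "S = {}"
      then have "\<And>j. j \<in> I \<Longrightarrow> \<langle>thV, alphaW n A j\<rangle> = 0" using short_theta by (auto simp: S_def)
      then have "\<langle>thV, tW thR\<rangle> = 0" by (simp add: toW_def pairing_sum_right)
      then show False using rootpair_pairing[OF theta_RP] by simp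
    qed
    then obtain i j where ij: "i \<in> S" "j \<in> I - S" "A i j \<noteq> 0"
      using indec SI unfolding indecomposable_def S_def by (metis (lifting) mem_Collect_eq subsetI)
    obtain \<gamma> c where c: "short_pair \<gamma> c" "\<langle>c, alphaW n A i\<rangle> \<noteq> 0" "i \<in> I" using ij(1) by (auto simp: S_def)
    have c0: "\<langle>c, alphaW n A j\<rangle> = 0" using ij(2) c(1) by (auto simp: S_def)
    have "\<langle>sQ n A i c, alphaW n A j\<rangle> = - \<langle>c, alphaW n A i\<rangle> * A i j"
      using c(3) c0 ij by (simp add: sQ_refl reflQ_def lookup_alphaW)
    then have "\<langle>sQ n A i c, alphaW n A j\<rangle> \<noteq> 0" using c(2) ij(3) by simp
    then have "j \<in> S" using short_refl[OF c(3,1)] ij(2) by (auto simp: S_def)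
    then show False using ij by simp
  qed
  then have sT: "sg j \<in> T" if "j \<in> I" for j using that short_simple by (auto simp: S_def)
  have "\<beta> = (\<Sum>i\<in>I. fc (lk \<beta> i) (sg i))"
    by (rule in_lattice_eqI[OF assms]) (auto simp: in_lattice_iff lookup_sum lookup_single when_def if_distrib cong: if_cong)
  then have "\<beta> \<in> T" using T_sum[of I] T_cmul sT by (metis (lifting) finite_Iset)
  then show ?thesis by (simp add: T_def)
qed

section \<open>Antidominant translations and minimal coset representatives\<close>

lemma ract_transl: "ract (transl \<beta>) \<rho> = (fst \<rho>, snd \<rho> - \<langle>\<beta>,fst \<rho>\<rangle>)"
  by (simp add: ract_def transl_def)

definition antidominant :: "wt \<Rightarrow> bool" where
  "antidominant \<beta> \<longleftrightarrow> L \<beta> \<and> (\<forall>i\<in>I. \<langle>\<beta>,alphaW n A i\<rangle> < 0)"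

lemma antidominant_cone: assumes "antidominant \<beta>" "cone \<mu>" shows "\<langle>\<beta>,\<mu>\<rangle> < 0"
proof -
  obtain \<gamma> where g: "L \<gamma>" "nonneg \<gamma>" "\<gamma> \<noteq> 0" "\<mu> = tW \<gamma>" using assms(2) by (auto simp: cone_def)
  obtain i where i: "i \<in> I" "lk \<gamma> i \<noteq> 0" using g by (metis in_lattice_eqI in_lattice_simps(1) lookup_zero)
  have "0 < (\<Sum>i\<in>I. lk \<gamma> i * - \<langle>\<beta>,alphaW n A i\<rangle>)"
  proof (rule sum_pos2[of _ i])
    have "0 < lk \<gamma> i" "0 < - \<langle>\<beta>,alphaW n A i\<rangle>" using i g(2) assms(1) by (auto simp: nonneg_def antidominant_def less_le)
    then show "0 < lk \<gamma> i * - \<langle>\<beta>,alphaW n A i\<rangle>" by (rule mult_pos_pos)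
    show "0 \<le> lk \<gamma> j * - \<langle>\<beta>,alphaW n A j\<rangle>" if "j \<in> I" for j
      using that g(2) assms(1) by (intro mult_nonneg_nonneg) (auto simp: nonneg_def antidominant_def less_imp_le)
  qed (use i in auto)
  then show ?thesis by (simp add: g toW_def pairing_sum_right sum_negf)
qed

text \<open>Minimality in the coset x W, expressed as the absence of descents in I.\<close>

definition ascI :: "waf \<Rightarrow> bool" where "ascI x \<longleftrightarrow> x \<in> W \<and> (\<forall>i\<in>I. apos (ract x (al i)))"

lemma ascI_root: assumes "ascI x" "cone \<mu>" "0 \<le> m" shows "apos (ract x (\<mu>, m))"
proof -
  have x: "good x" "x \<in> W" using assms W_good by (auto simp: ascI_def)
  have "apos (ract x (\<mu>, 0))" using assms ract_cone(1) by (auto simp: ascI_def)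
  then show ?thesis using assms(3) by (auto simp: ract_def apos_def split: prod.splits)
qed

text \<open>A negative root made positive by t_beta has level m <= 0 and finite part mu with <beta,
  mu> <= m, so antidominance makes mu positive. Its image is mu at a level >= 0, which x keeps
  positive.\<close>

lemma len_antidominant:
  assumes "ascI x" "antidominant \<beta>"
  shows "\<l> (x \<cdot> transl \<beta>) = \<l> x + \<l> (transl \<beta>)" "ascI (x \<cdot> transl \<beta>)"
proof -
  have x: "x \<in> W" and t: "transl \<beta> \<in> W" using assms transl_W by (auto simp: ascI_def antidominant_def)
  show "\<l> (x \<cdot> transl \<beta>) = \<l> x + \<l> (transl \<beta>)"
  proof (rule len_add[OF x t])
    fix \<sigma> assume s: "aroot \<sigma>" "apos (- \<sigma>)" "apos (ract (transl \<beta>) \<sigma>)"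
    obtain \<mu> m where \<sigma>: "\<sigma> = (\<mu>, m)" by (cases \<sigma>)
    have mm: "m \<le> 0" "\<langle>\<beta>,\<mu>\<rangle> \<le> m" using s by (auto simp: \<sigma> apos_def ract_transl)
    have "cone \<mu>"
    proof (rule ccontr)
      assume "\<not> cone \<mu>"
      then have "cone (- \<mu>)" using s(1) root_cone by (auto simp: aroot_def \<sigma>)
      from antidominant_cone[OF assms(2) this] mm show False by simp
    qed
    then show "apos (ract x (ract (transl \<beta>) \<sigma>))"
      using ascI_root[OF assms(1)] mm by (simp add: ract_transl \<sigma>)
  qed
  have "apos (ract (x \<cdot> transl \<beta>) (al i))" if i: "i \<in> I" for i
    using ascI_root[OF assms(1) cone_alpha[OF i], of "- \<langle>\<beta>,alphaW n A i\<rangle>"] i assms(2)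
    by (simp add: ract_mul W_good x ract_transl al_def rw_def lv_def I_nz antidominant_def less_imp_le)
  then show "ascI (x \<cdot> transl \<beta>)" using W_mul[OF x t] by (auto simp: ascI_def)
qed

text \<open>A left descent of t_beta is a right descent of its inverse, and the inverse sends
  alpha_i to alpha_i + <beta, alpha_i> delta, a negative root.\<close>

lemma red_left:
  assumes "antidominant \<beta>" "i \<in> I" shows "\<exists>u. red (transl \<beta>) (i # u)"
proof -
  have b: "L \<beta>" "L (- \<beta>)" and i: "i \<in> J" using assms I_J by (auto simp: antidominant_def)
  note t = transl_W[OF b(1)] and t' = transl_W[OF b(2)]
  have "apos (- ract (transl (- \<beta>)) (al i))"
    using assms by (simp add: ract_transl al_def rw_def lv_def I_nz antidominant_def apos_def)
  from len_desc[OF t' i this] have l: "\<l> (transl (- \<beta>) \<cdot> s i \<cdot> s i) = Suc (\<l> (transl (- \<beta>) \<cdot> s i))"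
    using mul_gen_gen[OF t' i] by simp
  obtain u where u: "red (transl (- \<beta>) \<cdot> s i) u" using reduced_exists W_mul t' gen_W i by blast
  have "red (transl (- \<beta>)) (u @ [i])" using red_snoc[OF u i l] mul_gen_gen[OF t' i] by simp
  from red_rev[OF this] have "red (transl \<beta>) (i # rev u)" using winv_transl[OF t'] by simp
  then show ?thesis by blast
qed

lemma Waf_minus_ascI: "w \<in> Waf_minus n A \<Longrightarrow> ascI w"
  unfolding ascI_def
proof (intro conjI ballI)
  assume w: "w \<in> Waf_minus n A"
  then show x: "w \<in> W" by (simp add: Waf_minus_def)
  fix i assume i: "i \<in> I"
  have "\<l> w \<le> \<l> (w \<cdot> s i)" using w gen_WI[OF i] by (auto simp: Waf_minus_def)
  then show "apos (ract w (al i))"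
    using len_desc[OF x I_J[OF i]] aroot_pos[OF aroot_ract[OF x aroot_al[OF I_J[OF i]]]] by force
qed

lemma ascI_exists: assumes "x \<in> W" shows "\<exists>y. ascI y \<and> fst y = fst x \<and> (\<forall>z\<in>W. fst z = fst x \<longrightarrow> \<l> y \<le> \<l> z)"
proof -
  obtain y where y: "y \<in> W" "fst y = fst x" "\<And>z. z \<in> W \<Longrightarrow> fst z = fst x \<Longrightarrow> \<l> y \<le> \<l> z"
    using ex_has_least_nat[of "\<lambda>y. y \<in> W \<and> fst y = fst x" x \<l>] assms by blast
  have "y \<in> Waf_minus n A" unfolding Waf_minus_def
  proof (safe intro!: y(1))
    fix v assume v: "v \<in> WI"
    have "fst (y \<cdot> v) = fst y"
      using WI_fst[OF v] W_good[OF y(1)] good_diff(1)[of "snd (snd y)"] by (auto simp: wmul_def good_def split: prod.splits)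
    then show "\<l> y \<le> \<l> (y \<cdot> v)" using y(3)[of "y \<cdot> v"] W_mul[OF y(1) Wfin_Waf[OF v]] y(2) by simp
  qed
  then show ?thesis using Waf_minus_ascI y by blast
qed

text \<open>This links the class at beta, defined through D of the translation, with the minimal
  representative of its coset: the letters of I at the end of the word will act trivially on
  1.\<close>

lemma ascI_transl:
  assumes "ascI x"
  shows "\<exists>u v. red x u \<and> set v \<subseteq> I \<and> red (transl (fst x)) (u @ v)"
proof -
  have x: "x \<in> W" using assms by (auto simp: ascI_def)
  have v: "winv (fin x) \<in> WI" using winv(2) Waf_fin[OF x] Wfin_Waf by blast
  have t: "transl (fst x) = x \<cdot> winv (fin x)" using transl_fst[OF x] by simp
  obtain u where u: "red x u" using reduced_exists x by blast
  obtain w where w: "red (winv (fin x)) w" "set w \<subseteq> I" using WI_red[OF v] by blast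
  have "\<l> (x \<cdot> winv (fin x)) = \<l> x + \<l> (winv (fin x))"
    using len_min_coset[OF x _ v] assms by (auto simp: ascI_def)
  from red_append[OF u w(1) this] show ?thesis using u w t by auto
qed

end

section \<open>Independence of the reduced word\<close>

fun alt :: "'a \<Rightarrow> 'a \<Rightarrow> nat \<Rightarrow> 'a list" where
  "alt i j 0 = []"
| "alt i j (Suc m) = i # alt j i m"

lemma set_alt: "set (alt i j m) \<subseteq> {i, j}"
  by (induction i j m rule: alt.induct) auto

lemma length_alt [simp]: "length (alt i j m) = m"
  by (induction i j m rule: alt.induct) auto

context cartan
begin

definition cm :: "nat \<Rightarrow> nat \<Rightarrow> int" where "cm i j = \<langle>rc i, rw j\<rangle>"

text \<open>The order of s_i s_j read off from the affine Cartan matrix. The last case also catches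
  the product 4, the infinite dihedral case; relations built on \<open>cox\<close> therefore assume
  or derive \<open>rank2_types\<close>.\<close>

definition cox :: "nat \<Rightarrow> nat \<Rightarrow> nat" where
  "cox i j = (if cm i j * cm j i = 0 then 2 else if cm i j * cm j i = 1 then 3 else if cm i j * cm j i = 2 then 4 else 6)"

definition rank2_types :: "(int \<times> int) set" where
  "rank2_types = {(0, 0), (-1, -1), (-1, -2), (-2, -1), (-1, -3), (-3, -1)}"

lemma simple_norms:
  assumes "i \<in> J" "j \<in> J"
  obtains \<gamma> e \<delta> f where "root_norm \<gamma> (rc i) e" "tW \<gamma> = rw i" "root_norm \<delta> (rc j) f" "tW \<delta> = rw j"
  using simple_RP[OF assms(1)] simple_RP[OF assms(2)] rootpair_norm by metis

lemma cm_basic: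
  assumes "i \<in> J" "j \<in> J"
  shows "cm i j * cm j i \<le> 4" "0 < cm i j \<longleftrightarrow> 0 < cm j i" "cm i j = 0 \<longleftrightarrow> cm j i = 0"
proof -
  obtain \<gamma> e \<delta> f where g: "root_norm \<gamma> (rc i) e" "tW \<gamma> = rw i" "root_norm \<delta> (rc j) f" "tW \<delta> = rw j"
    by (rule simple_norms[OF assms])
  show "cm i j * cm j i \<le> 4" "0 < cm i j \<longleftrightarrow> 0 < cm j i" "cm i j = 0 \<longleftrightarrow> cm j i = 0"
    using pair_prod_le[OF g(1,3)] pair_signs[OF g(1,3)] by (simp_all add: g cm_def)
qed

lemma cm_nonpos: assumes "i \<in> J" "j \<in> J" "i \<noteq> j" shows "cm i j \<le> 0"
proof -
  have 0: "cm 0 k \<le> 0" if "k \<in> I" for k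
    using theta_pair_nonneg[of "sg k"] that by (simp add: cm_def rc_def rw_def I_nz nonneg_def lookup_single when_def)
  have "cm k l \<le> 0" if "k \<in> I" "l \<in> I" "k \<noteq> l" for k l
    using that A_le by (simp add: cm_def rc_def rw_def I_nz lookup_alphaW)
  then show ?thesis using assms 0 cm_basic(2)[OF assms(1,2)] by (auto simp: J_eq not_less[symmetric])
qed

lemma rank2_type:
  assumes "i \<in> J" "j \<in> J" "i \<noteq> j" "cm i j * cm j i \<noteq> 4"
  shows "(cm i j, cm j i) \<in> rank2_types"
proof -
  let ?a = "- cm i j" and ?b = "- cm j i"
  have ab: "0 \<le> ?a" "0 \<le> ?b" "?a * ?b \<le> 3" "?a = 0 \<longleftrightarrow> ?b = 0"
    using cm_nonpos[OF assms(1-3)] cm_nonpos[OF assms(2,1)] cm_basic[OF assms(1,2)] assms(3,4) by auto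
  have b: "?a \<le> 3" "?b \<le> 3"
  proof -
    show "?a \<le> 3" using ab mult_left_mono[of 1 ?b ?a] by (cases "?b = 0") auto
    show "?b \<le> 3" using ab mult_right_mono[of 1 ?a ?b] by (cases "?a = 0") auto
  qed
  have "cm i j = 0 \<or> cm i j = - 1 \<or> cm i j = - 2 \<or> cm i j = - 3"
    "cm j i = 0 \<or> cm j i = - 1 \<or> cm j i = - 2 \<or> cm j i = - 3" using ab(1,2) b by linarith+
  then show ?thesis using ab(3,4) unfolding rank2_types_def by (elim disjE) simp_all
qed

definition comb :: "nat \<Rightarrow> nat \<Rightarrow> int \<Rightarrow> int \<Rightarrow> wt \<times> int" where
  "comb i j x y = rsmul x (al i) + rsmul y (al j)"

lemma comb_al: "al i = comb i j 1 0" "al j = comb i j 0 1"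
  by (simp_all add: comb_def)

text \<open>Words in s_i and s_j move rho only by multiples of alpha_i and alpha_j. Coxeter
  relations thereby reduce to integer arithmetic on two coordinates, with the pairings of rho as
  parameters.\<close>

lemma ract_comb:
  assumes "i \<in> J" "j \<in> J"
  shows "ract (s i) (\<rho> + comb i j x y) = \<rho> + comb i j (- \<langle>rc i,fst \<rho>\<rangle> - x - cm i j * y) y"
    "ract (s j) (\<rho> + comb i j x y) = \<rho> + comb i j x (- \<langle>rc j,fst \<rho>\<rangle> - y - cm j i * x)"
  unfolding ract_gen[OF assms(1)] ract_gen[OF assms(2)]
  using rc_rw[OF assms(1)] rc_rw[OF assms(2)]
  by (auto intro!: prod_eqI poly_mapping_eqI simp: comb_def al_def cm_def lookup_add lookup_minus algebra_simps)

lemma W_eqI: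
  assumes "u \<in> W" "v \<in> W" "\<And>\<rho>. ract u \<rho> = ract v \<rho>"
  shows "u = v"
proof -
  have "winv u \<cdot> v = wone"
  proof (rule no_desc)
    show "winv u \<cdot> v \<in> W" using assms W_mul winv by blast
    fix i assume i: "i \<in> J"
    have "ract (winv u \<cdot> v) (al i) = al i"
      using assms(3)[of "al i"] ract_winv(1)[OF assms(1), of "al i"] by (simp add: ract_mul W_good winv assms(1))
    then show "apos (ract (winv u \<cdot> v) (al i))" using apos_al[OF i] by simp
  qed
  then have "u \<cdot> (winv u \<cdot> v) = u \<cdot> wone" by simp
  then show ?thesis using winv_cancel(2)[OF assms(1)] W_good[OF assms(1)] by simp
qed

lemma alt_simps:
  "alt i j 2 = [i, j]" "alt i j 3 = [i, j, i]" "alt i j 4 = [i, j, i, j]" "alt i j 6 = [i, j, i, j, i, j]"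
  by (simp_all add: numeral_eq_Suc)

lemma alt_J: "i \<in> J \<Longrightarrow> j \<in> J \<Longrightarrow> set (alt i j m) \<subseteq> J"
  using set_alt[of i j m] by blast

lemma E_alt_ract:
  assumes "i \<in> J" "j \<in> J"
  shows "ract (E (alt i j m)) \<rho> = foldr (\<lambda>k. ract (s k)) (alt i j m) \<rho>"
proof -
  have "set w \<subseteq> J \<Longrightarrow> ract (E w) \<rho> = foldr (\<lambda>k. ract (s k)) w \<rho>" for w
    by (induction w) (simp_all add: ract_mul good_gen)
  then show ?thesis using alt_J[OF assms] by blast
qed

lemma coxeter_relation:
  assumes ij: "i \<in> J" "j \<in> J" and t: "(cm i j, cm j i) \<in> rank2_types"
  shows "E (alt i j (cox i j)) = E (alt j i (cox i j))"
proof (rule W_eqI)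
  show "E (alt i j (cox i j)) \<in> W" "E (alt j i (cox i j)) \<in> W" using alt_J word_Waf ij by blast+
  fix \<rho>
  have \<rho>: "\<rho> = \<rho> + comb i j 0 0" by (simp add: comb_def)
  have "foldr (\<lambda>k. ract (s k)) (alt i j (cox i j)) (\<rho> + comb i j 0 0)
    = foldr (\<lambda>k. ract (s k)) (alt j i (cox i j)) (\<rho> + comb i j 0 0)"
    using t unfolding rank2_types_def
    by (auto simp add: cox_def alt_simps ract_comb[OF ij] intro!: arg_cong2[where f = "comb i j"])
  then show "ract (E (alt i j (cox i j))) \<rho> = ract (E (alt j i (cox i j))) \<rho>"
    unfolding \<rho>[symmetric] E_alt_ract[OF ij] E_alt_ract[OF ij(2,1)] .
qed

section \<open>Dihedral factors and Matsumoto's theorem\<close>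

fun descents :: "waf \<Rightarrow> nat list \<Rightarrow> bool" where
  "descents x [] = True"
| "descents x (k # w) = (apos (- ract x (al k)) \<and> descents (x \<cdot> s k) w)"

lemma len_descents:
  "x \<in> W \<Longrightarrow> set w \<subseteq> J \<Longrightarrow> descents x w \<Longrightarrow> \<l> (x \<cdot> E w) + length w = \<l> x"
proof (induction w arbitrary: x)
  case Nil then show ?case by (simp add: W_good)
next
  case (Cons k w)
  then have k: "k \<in> J" by simp
  have "\<l> (x \<cdot> s k \<cdot> E w) + length w = \<l> (x \<cdot> s k)"
    using Cons W_mul[OF Cons.prems(1) gen_W[OF k]] by simp
  then show ?case using len_desc[OF Cons.prems(1) k] Cons.prems(3) W_assoc[OF Cons.prems(1)] by simp
qed

lemma comb_neg:
  assumes "x \<in> W" "apos (- ract x (al i))" "apos (- ract x (al j))" "0 \<le> a" "0 \<le> b" "a \<noteq> 0 \<or> b \<noteq> 0"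
  shows "apos (- ract x (comb i j a b))"
proof -
  have e: "- ract x (comb i j a b) = rsmul a (- ract x (al i)) + rsmul b (- ract x (al j))"
    by (simp add: comb_def ract_linear W_good assms(1) prod_eq_iff)
  show ?thesis
  proof (cases "a = 0 \<or> b = 0")
    case True
    then show ?thesis unfolding e
      using assms apos_smul[OF assms(2), of a] apos_smul[OF assms(3), of b] by auto
  next
    case False
    then show ?thesis unfolding e using assms by (intro apos_add apos_smul) auto
  qed
qed

text \<open>Two descents whose Cartan entries have product 4 would make a multiple of \<open>\<delta>\<close> negative.\<close>

lemma two_descents:
  assumes x: "x \<in> W" and ij: "i \<in> J" "j \<in> J" "i \<noteq> j"
    and d: "apos (- ract x (al i))" "apos (- ract x (al j))"
  shows "(cm i j, cm j i) \<in> rank2_types"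
proof (rule rank2_type[OF ij])
  show "cm i j * cm j i \<noteq> 4"
  proof
    assume 4: "cm i j * cm j i = 4"
    obtain \<gamma> e \<delta> f where g: "root_norm \<gamma> (rc i) e" "tW \<gamma> = rw i" "root_norm \<delta> (rc j) f" "tW \<delta> = rw j"
      by (rule simple_norms[OF ij(1,2)])
    let ?p = "cm i j"
    have p: "?p = \<langle>rc i,tW \<delta>\<rangle>" and q: "cm j i = \<langle>rc j,tW \<gamma>\<rangle>" by (simp_all add: cm_def g)
    have p0: "?p \<le> 0" using cm_nonpos[OF ij] .
    have "e * of_int ?p = f * of_int (cm j i)" using pairing_sym_form[OF g(1,3)] p q by simp
    then have "of_int ?p * (e * of_int ?p) = f * of_int (?p * cm j i)" by simp
    then have pp: "of_int ?p * (e * of_int ?p) = f * 4" using 4 by simp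
    \<comment> \<open>Equality in Cauchy-Schwarz: the finite parts become proportional, so -p
      alpha_i + 2 alpha_j is a multiple of delta, with coefficient >= 0.\<close>
    have "form (fc 2 \<delta> - fc ?p \<gamma>) (fc 2 \<delta> - fc ?p \<gamma>) = 8 * f - 2 * (of_int ?p * (e * of_int ?p))"
      using root_norm_form[OF g(1), of \<delta>] g p by (simp add: form_sym[of \<delta> \<gamma>] root_norm_def algebra_simps)
    then have "form (fc 2 \<delta> - fc ?p \<gamma>) (fc 2 \<delta> - fc ?p \<gamma>) = 0" using pp by simp
    moreover have "L (fc 2 \<delta> - fc ?p \<gamma>)" using g by (simp add: root_norm_def)
    ultimately have "fc 2 \<delta> - fc ?p \<gamma> = 0" using form_pos by fastforce
    then have "tW (fc 2 \<delta> - fc ?p \<gamma>) = tW 0" by simp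
    then have z: "fst (comb i j (- ?p) 2) = 0" by (simp add: comb_def al_def g) (rule poly_mapping_eqI, simp add: lookup_add)
    have "?p * lv i \<le> 0" using p0 by (intro mult_nonpos_nonneg) (auto simp: lv_def)
    moreover have "0 \<le> lv j" by (simp add: lv_def)
    ultimately have k: "0 \<le> snd (comb i j (- ?p) 2)" by (simp add: comb_def al_def)
    have "apos (- ract x (comb i j (- ?p) 2))" using p0 by (intro comb_neg[OF x d]) auto
    moreover have "ract x (comb i j (- ?p) 2) = (0, snd (comb i j (- ?p) 2))"
    proof -
      have "fst (snd x) 0 = 0" using W_good[OF x] good_diff(1)[of "fst (snd x)"] by (auto simp: good_def split: prod.splits)
      then show ?thesis using z by (cases x) (simp add: ract_def)
    qed
    ultimately have "apos (0, - snd (comb i j (- ?p) 2))" by simp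
    then show False using k cone_neg[of 0] by (auto simp: apos_def)
  qed
qed

text \<open>The roots met along the alternating word are the positive roots of the rank 2 subsystem,
  hence nonnegative combinations of alpha_i and alpha_j, and x makes all of them negative.\<close>

lemma descents_alt:
  assumes x: "x \<in> W" and ij: "i \<in> J" "j \<in> J" and t: "(cm i j, cm j i) \<in> rank2_types"
    and d: "apos (- ract x (al i))" "apos (- ract x (al j))"
  shows "descents x (alt i j (cox i j))"
proof -
  have g: "good (s i)" "good (s j)" "good x" using good_gen ij W_good x by auto
  note 0 = ract_comb[OF ij, of 0, simplified]
  have a: "ract y (al i) = ract y (comb i j 1 0)" "ract y (al j) = ract y (comb i j 0 1)" for y
    by (simp_all add: comb_al[symmetric])
  show ?thesis using t unfolding rank2_types_def
    by (auto simp add: cox_def alt_simps a good_mul g ract_mul 0 intro!: comb_neg[OF x d])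
qed

lemma cox_sym: "cox i j = cox j i"
  by (simp add: cox_def mult.commute)

text \<open>Stripping the alternating word from x on the right leaves y, with x = y w, lengths
  adding and w the longest dihedral element. The reversal undoes the stripping, so the two words end
  in i and in j.\<close>

lemma two_descents_factor:
  assumes x: "x \<in> W" and ij: "i \<in> J" "j \<in> J" "i \<noteq> j"
    and d: "apos (- ract x (al i))" "apos (- ract x (al j))"
  shows "\<exists>r. red x (r @ rev (alt i j (cox i j))) \<and> red x (r @ rev (alt j i (cox i j)))"
proof -
  let ?m = "cox i j"
  note t = two_descents[OF assms]
  let ?y = "x \<cdot> E (alt i j ?m)"
  have J: "set (alt i j ?m) \<subseteq> J" "set (alt j i ?m) \<subseteq> J" using alt_J ij by blast+
  have rel: "E (alt i j ?m) = E (alt j i ?m)" using coxeter_relation[OF ij(1,2) t] .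
  have l: "\<l> ?y + ?m = \<l> x" using len_descents[OF x J(1) descents_alt[OF x ij(1,2) t d]] by simp
  have yW: "?y \<in> W" using W_mul[OF x word_Waf[OF J(1)]] .
  then obtain r where r: "red ?y r" using reduced_exists by blast
  have "red x (r @ rev w)" if w: "w = alt i j ?m \<or> w = alt j i ?m" for w
  proof -
    have wJ: "set w \<subseteq> J" and Ew: "E w = E (alt i j ?m)" and lw: "length w = ?m" using w J rel by auto
    have "E (r @ rev w) = ?y \<cdot> E (rev w)" using redD[OF r] by (simp add: E_append)
    also have "\<dots> = x \<cdot> (E w \<cdot> E (rev w))" unfolding Ew[symmetric] using W_assoc[OF x] by simp
    also have "\<dots> = x" using E_rev[of "rev w"] wJ W_good[OF x] by simp
    finally show ?thesis using redD[OF r] wJ lw l by (simp add: reduced_word_def)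
  qed
  then show ?thesis by blast
qed

lemma red_snocD:
  assumes "red x (u @ [i])" shows "i \<in> J" "apos (- ract x (al i))" "red (x \<cdot> s i) u"
proof -
  note r = redD[OF assms]
  have i: "i \<in> J" and u: "set u \<subseteq> J" using r by auto
  have xW: "x \<in> W" using r(2) word_Waf[OF r(1)] by simp
  have "x = E u \<cdot> s i" using r i u good_gen[OF i] by (simp add: E_append)
  then have xs: "x \<cdot> s i = E u" using mul_gen_gen[OF word_Waf[OF u] i] by simp
  have l: "\<l> (x \<cdot> s i) \<le> length u" using len_le[OF u] xs by simp
  then have lt: "\<l> (x \<cdot> s i) < \<l> x" using r by simp
  show "i \<in> J" by (rule i)
  show d: "apos (- ract x (al i))"
  proof (rule ccontr)
    assume "\<not> ?thesis"
    then have "apos (ract x (al i))" using aroot_pos[OF aroot_ract[OF xW aroot_al[OF i]]] by blast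
    then show False using len_asc[OF xW i] lt by simp
  qed
  show "red (x \<cdot> s i) u" using len_desc[OF xW i d] r xs u by (simp add: reduced_word_def)
qed

text \<open>Words with the same last letter are settled by induction. If the last letters are i and
  j, both are descents, and each word is compared with one ending in the longest dihedral element,
  where the braid relation applies. Two descents always span a finite rank 2 type, so only these
  relations are demanded.\<close>

lemma matsumoto:
  fixes D :: "nat \<Rightarrow> 'm \<Rightarrow> 'm"
  assumes braid: "\<And>i j. i \<in> J \<Longrightarrow> j \<in> J \<Longrightarrow> (cm i j, cm j i) \<in> rank2_types \<Longrightarrow>
      foldr D (rev (alt i j (cox i j))) = foldr D (rev (alt j i (cox i j)))"
  assumes "red x u" "red x v"
  shows "foldr D u = foldr D v"
  using assms(2,3)
proof (induction "length u" arbitrary: x u v rule: less_induct)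
  case less
  note ru = redD[OF less.prems(1)] and rv = redD[OF less.prems(2)]
  have luv: "length u = length v" using ru rv by simp
  show ?case
  proof (cases u rule: rev_cases)
    case Nil then show ?thesis using luv by simp
  next
    case u: (snoc u' i)
    then obtain v' j where v: "v = v' @ [j]" using luv by (cases v rule: rev_cases) auto
    note du = red_snocD[OF less.prems(1)[unfolded u]] and dv = red_snocD[OF less.prems(2)[unfolded v]]
    have IH: "foldr D w = foldr D w'"
      if "red x w" "red x w'" "w = a @ [k]" "w' = b @ [k]" for w w' a b k
      using less.hyps[of a "x \<cdot> s k" b] red_snocD(3)[of x a k] red_snocD(3)[of x b k] that
        redD(3)[OF that(1)] ru(3) by auto
    show ?thesis
    proof (cases "i = j")
      case True then show ?thesis using IH[OF less.prems u] v by blast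
    next
      case False
      have xW: "x \<in> W" using ru word_Waf by metis
      obtain r where r: "red x (r @ rev (alt i j (cox i j)))" "red x (r @ rev (alt j i (cox i j)))"
        using two_descents_factor[OF xW du(1) dv(1) False du(2) dv(2)] by blast
      \<comment> \<open>A positive exponent ensures that the reversed alternating word starting from
        i really ends in i.\<close>
      have "cox i j \<noteq> 0" by (simp add: cox_def)
      then obtain m where m: "cox i j = Suc m" using not0_implies_Suc by blast
      have "foldr D u = foldr D (r @ rev (alt i j (cox i j)))"
        by (rule IH[OF less.prems(1) r(1) u, of "r @ rev (alt j i m)"]) (simp add: m)
      also have "\<dots> = foldr D (r @ rev (alt j i (cox i j)))"
        using braid[OF du(1) dv(1) two_descents[OF xW du(1) dv(1) False du(2) dv(2)]] by (simp add: fun_eq_iff)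
      also have "\<dots> = foldr D v"
        by (rule IH[OF r(2) less.prems(2) _ v, of "r @ rev (alt i j m)"]) (simp add: m)
      finally show ?thesis .
    qed
  qed
qed

end

section \<open>Braid relations of Demazure operators\<close>

text \<open>The action of D_i on functions on Q^vee with values in C(P), in abstract form: s acts on
  the field, p on the index set, and a is e^alpha.\<close>

definition demazure :: "'k::field \<Rightarrow> ('k \<Rightarrow> 'k) \<Rightarrow> ('g \<Rightarrow> 'g) \<Rightarrow> ('g \<Rightarrow> 'k) \<Rightarrow> 'g \<Rightarrow> 'k" where
  "demazure a s p c g = (c g - a * s (c (p g))) / (1 - a)"

locale field_hom = fixes s :: "'k::field \<Rightarrow> 'k" assumes add: "s (x + y) = s x + s y" and mult: "s (x * y) = s x * s y" and one: "s 1 = 1"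
begin
lemma zero: "s 0 = 0" by (metis add add.right_neutral add_cancel_left_left)

lemma minus: "s (- x) = - s x" using add[of x "-x"] zero by (simp add: eq_neg_iff_add_eq_0 add.commute)

lemma diff: "s (x - y) = s x - s y" using add[of x "-y"] minus by simp

lemma inv: "s (inverse x) = inverse (s x)"
  by (cases "x=0") (simp_all add: zero inverse_unique flip: mult, metis inverse_unique mult one right_inverse)

lemma divide: "s (x / y) = s x / s y" by (simp add: divide_inverse mult inv)

lemma power: "s (x ^ n) = s x ^ n" by (induct n) (auto simp: one mult)

lemmas hom = add mult one zero minus diff divide power

end

locale reflection_pair = S: field_hom s + T: field_hom t for s t :: "'k::field \<Rightarrow> 'k" +
  fixes p q :: "'g \<Rightarrow> 'g" and a b r10 r01 :: 'k
  assumes ss [simp]: "s (s x) = x" and tt [simp]: "t (t x) = x" and pp [simp]: "p (p g) = g" and qq [simp]: "q (q g) = g"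
  and nz: "a \<noteq> 0" "b \<noteq> 0" "r10 \<noteq> 0" "r01 \<noteq> 0"
  and r: "r10 = 1 - a" "r01 = 1 - b" and sa: "s a = 1 / a" and tb: "t b = 1 / b"
begin
abbreviation "Ds \<equiv> demazure a s p"
abbreviation "Dt \<equiv> demazure b t q"

end

lemmas term_congs = arg_cong2[where f = "(+)"] arg_cong2[where f = "(*)"] HOL.refl

text \<open>The alternating products of \<open>Ds\<close>, \<open>Dt\<close> are expanded in the elements of the dihedral group, with \<open>rij\<close>
  standing for \<open>1 - a\<^sup>i b\<^sup>j\<close>. Collecting terms with opaque coefficients first keeps the denominators of
  different group elements apart.\<close>

lemma collect2: "(f1 * x1 + f2 * x3 - a * (g1 * x2 + g2 * x4)) / r =
      f1 / r * x1
    + - (a * g1) / r * x2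
    + f2 / r * x3
    + - (a * g2) / r * x4"
  for r :: "'k::field" by (simp add: diff_divide_distrib add_divide_distrib algebra_simps)

lemma collect3: "(f1 * x1 + f2 * x3 + f3 * x2 + f4 * x5 - a * (g1 * x2 + g2 * x4 + g3 * x1 + g4 * x6)) / r =
      (f1 - a * g3) / r * x1
    + (f3 - a * g1) / r * x2
    + f2 / r * x3
    + - (a * g2) / r * x4
    + f4 / r * x5
    + - (a * g4) / r * x6"
  for r :: "'k::field" by (simp add: diff_divide_distrib add_divide_distrib algebra_simps)

lemma collect4: "(f1 * x1 + f2 * x3 + f3 * x2 + f4 * x5 + f5 * x4 + f6 * x7 - a * (g1 * x2 + g2 * x4 + g3 * x1 + g4 * x6 + g5 * x3 + g6 * x8)) / r =
      (f1 - a * g3) / r * x1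
    + (f3 - a * g1) / r * x2
    + (f2 - a * g5) / r * x3
    + (f5 - a * g2) / r * x4
    + f4 / r * x5
    + - (a * g4) / r * x6
    + f6 / r * x7
    + - (a * g6) / r * x8"
  for r :: "'k::field" by (simp add: diff_divide_distrib add_divide_distrib algebra_simps)

lemma collect5: "(f1 * x1 + f2 * x3 + f3 * x2 + f4 * x5 + f5 * x4 + f6 * x7 + f7 * x6 + f8 * x9 - a * (g1 * x2 + g2 * x4 + g3 * x1 + g4 * x6 + g5 * x3 + g6 * x8 + g7 * x5 + g8 * x10)) / r =
      (f1 - a * g3) / r * x1
    + (f3 - a * g1) / r * x2
    + (f2 - a * g5) / r * x3
    + (f5 - a * g2) / r * x4
    + (f4 - a * g7) / r * x5
    + (f7 - a * g4) / r * x6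
    + f6 / r * x7
    + - (a * g6) / r * x8
    + f8 / r * x9
    + - (a * g8) / r * x10"
  for r :: "'k::field" by (simp add: diff_divide_distrib add_divide_distrib algebra_simps)

lemma collect6: "(f1 * x1 + f2 * x3 + f3 * x2 + f4 * x5 + f5 * x4 + f6 * x7 + f7 * x6 + f8 * x9 + f9 * x8 + f10 * x11 - a * (g1 * x2 + g2 * x4 + g3 * x1 + g4 * x6 + g5 * x3 + g6 * x8 + g7 * x5 + g8 * x10 + g9 * x7 + g10 * x12)) / r =
      (f1 - a * g3) / r * x1
    + (f3 - a * g1) / r * x2
    + (f2 - a * g5) / r * x3
    + (f5 - a * g2) / r * x4
    + (f4 - a * g7) / r * x5
    + (f7 - a * g4) / r * x6
    + (f6 - a * g9) / r * x7
    + (f9 - a * g6) / r * x8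
    + f8 / r * x9
    + - (a * g8) / r * x10
    + f10 / r * x11
    + - (a * g10) / r * x12"
  for r :: "'k::field" by (simp add: diff_divide_distrib add_divide_distrib algebra_simps)

locale braid_A1 = reflection_pair s t p q a b r10 r01 for s t :: "'k::field \<Rightarrow> 'k" and p q :: "'g \<Rightarrow> 'g" and a b r10 r01 +
  assumes sb: "s b = b" and ta: "t a = a"
begin
lemma braid:
  assumes "\<And>x. s (t x) = t (s x)" and "\<And>g. p (q g) = q (p g)"
  shows "Ds (Dt c) = Dt (Ds c)"
  proof (rule ext)
  have "s r01 = r01" "t r10 = r10" by (simp_all add: r S.hom T.hom sb ta)
  then show "Ds (Dt c) g = Dt (Ds c) g" for g
    by (simp add: demazure_def S.hom T.hom sb ta assms nz divide_simps flip: r) (simp add: algebra_simps)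
qed

end

locale braid_A2 = reflection_pair s t p q a b r10 r01 for s t :: "'k::field \<Rightarrow> 'k" and p q :: "'g \<Rightarrow> 'g" and a b r10 r01 +
  fixes r11 :: 'k assumes sb: "s b = a * b" and ta: "t a = a * b"
    and nz2: "r11 \<noteq> 0"
    and r2: "r11 = 1 - a*b"
begin
text \<open>Each reflection permutes the positive roots other than its own, hence the denominators
  \<open>rij\<close>; its own root changes sign, and 1 - 1/a = -(1 - a)/a.\<close>

lemma act: "s r01 = r11" "s r10 = - r10 / a" "s r11 = r01" "t r01 = - r01 / b" "t r10 = r11" "t r11 = r10"
  by (simp_all add: nz r r2 S.hom T.hom sa sb ta tb field_simps power_numeral_reduce)

lemmas hom_act = S.hom T.hom sa sb ta tb act
lemmas clear = nz nz2 divide_simps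
lemmas expand = r r2 algebra_simps power_numeral_reduce

lemma st1: "Ds c g = 1 / r10 * c g
    + - a / r10 * s (c (p g))"
  by (simp add: demazure_def r diff_divide_distrib)

lemma st2: "Dt (Ds c) g = 1 / (r01 * r10) * c g
    + - b / (r01 * r11) * t (c (q g))
    + - a / (r01 * r10) * s (c (p g))
    + a*b^2 / (r01 * r11) * t (s (c (p (q g))))"
  unfolding demazure_def[of b t q "Ds c" g] st1 T.add T.mult tt qq r[symmetric] collect2
  by (intro term_congs; (simp add: hom_act)?; (simp add: clear)?; (simp add: expand)?)

text \<open>With the longest element reached, the constants follow a rule: the coefficient of w is
  (-1)^l(w) times e to the sum of the positive roots made negative by the inverse of w, over the
  product of 1 - e^gamma for all positive roots gamma. The rule is symmetric in s and t, which gives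
  \<open>braid\<close>.\<close>

lemma st3: "Ds (Dt (Ds c)) g = 1 / (r01 * r10 * r11) * c g
    + - a / (r01 * r10 * r11) * s (c (p g))
    + - b / (r01 * r10 * r11) * t (c (q g))
    + a^2*b / (r01 * r10 * r11) * s (t (c (q (p g))))
    + a*b^2 / (r01 * r10 * r11) * t (s (c (p (q g))))
    + - (a^2*b^2) / (r01 * r10 * r11) * s (t (s (c (p (q (p g))))))"
  unfolding demazure_def[of a s p "Dt (Ds c)" g] st2 S.add S.mult ss pp r[symmetric] collect3
  by (intro term_congs; (simp add: hom_act)?; (simp add: clear)?; (simp add: expand)?)

lemma ts1: "Dt c g = 1 / r01 * c g
    + - b / r01 * t (c (q g))"
  by (simp add: demazure_def r diff_divide_distrib)

lemma ts2: "Ds (Dt c) g = 1 / (r01 * r10) * c g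
    + - a / (r10 * r11) * s (c (p g))
    + - b / (r01 * r10) * t (c (q g))
    + a^2*b / (r10 * r11) * s (t (c (q (p g))))"
  unfolding demazure_def[of a s p "Dt c" g] ts1 S.add S.mult ss pp r[symmetric] collect2
  by (intro term_congs; (simp add: hom_act)?; (simp add: clear)?; (simp add: expand)?)

lemma ts3: "Dt (Ds (Dt c)) g = 1 / (r01 * r10 * r11) * c g
    + - b / (r01 * r10 * r11) * t (c (q g))
    + - a / (r01 * r10 * r11) * s (c (p g))
    + a*b^2 / (r01 * r10 * r11) * t (s (c (p (q g))))
    + a^2*b / (r01 * r10 * r11) * s (t (c (q (p g))))
    + - (a^2*b^2) / (r01 * r10 * r11) * t (s (t (c (q (p (q g))))))"
  unfolding demazure_def[of b t q "Ds (Dt c)" g] ts2 T.add T.mult tt qq r[symmetric] collect3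
  by (intro term_congs; (simp add: hom_act)?; (simp add: clear)?; (simp add: expand)?)

lemma braid:
  assumes "\<And>x. s (t (s x)) = t (s (t x))" and "\<And>g. p (q (p g)) = q (p (q g))"
  shows "Ds (Dt (Ds c)) = Dt (Ds (Dt c))"
  by (rule ext) (simp only: st3 ts3 assms add_ac)

end

text \<open>Here alpha is short, s adds 2 alpha to beta, and the positive roots are alpha, beta,
  alpha + beta and 2 alpha + beta. The prefixes \<open>st\<close> and \<open>ts\<close> name the
  leftmost operators of the full product, so the chain \<open>st\<close> starts with Dt.\<close>

locale braid_B2 = reflection_pair s t p q a b r10 r01 for s t :: "'k::field \<Rightarrow> 'k" and p q :: "'g \<Rightarrow> 'g" and a b r10 r01 +
  fixes r11 r21 :: 'k assumes sb: "s b = a^2 * b" and ta: "t a = a * b"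
    and nz2: "r11 \<noteq> 0" "r21 \<noteq> 0"
    and r2: "r11 = 1 - a*b" "r21 = 1 - a^2*b"
begin
lemma act: "s r01 = r21" "s r10 = - r10 / a" "s r11 = r11" "s r21 = r01" "t r01 = - r01 / b" "t r10 = r11" "t r11 = r10" "t r21 = r21"
  by (simp_all add: nz r r2 S.hom T.hom sa sb ta tb field_simps power_numeral_reduce)

lemmas hom_act = S.hom T.hom sa sb ta tb act
lemmas clear = nz nz2 divide_simps
lemmas expand = r r2 algebra_simps power_numeral_reduce

lemma st1: "Dt c g = 1 / r01 * c g
    + - b / r01 * t (c (q g))"
  by (simp add: demazure_def r diff_divide_distrib)

lemma st2: "Ds (Dt c) g = 1 / (r01 * r10) * c g
    + - a / (r10 * r21) * s (c (p g))
    + - b / (r01 * r10) * t (c (q g))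
    + a^3*b / (r10 * r21) * s (t (c (q (p g))))"
  unfolding demazure_def[of a s p "Dt c" g] st1 S.add S.mult ss pp r[symmetric] collect2
  by (intro term_congs; (simp add: hom_act)?; (simp add: clear)?; (simp add: expand)?)

lemma st3: "Dt (Ds (Dt c)) g = 1 / (r01 * r10 * r11) * c g
    + - b / (r01 * r10 * r11) * t (c (q g))
    + - a / (r01 * r10 * r21) * s (c (p g))
    + a*b^2 / (r01 * r11 * r21) * t (s (c (p (q g))))
    + a^3*b / (r01 * r10 * r21) * s (t (c (q (p g))))
    + - (a^3*b^3) / (r01 * r11 * r21) * t (s (t (c (q (p (q g))))))"
  unfolding demazure_def[of b t q "Ds (Dt c)" g] st2 T.add T.mult tt qq r[symmetric] collect3
  by (intro term_congs; (simp add: hom_act)?; (simp add: clear)?; (simp add: expand)?)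

lemma st4: "Ds (Dt (Ds (Dt c))) g = 1 / (r01 * r10 * r11 * r21) * c g
    + - a / (r01 * r10 * r11 * r21) * s (c (p g))
    + - b / (r01 * r10 * r11 * r21) * t (c (q g))
    + a^3*b / (r01 * r10 * r11 * r21) * s (t (c (q (p g))))
    + a*b^2 / (r01 * r10 * r11 * r21) * t (s (c (p (q g))))
    + - (a^4*b^2) / (r01 * r10 * r11 * r21) * s (t (s (c (p (q (p g))))))
    + - (a^3*b^3) / (r01 * r10 * r11 * r21) * t (s (t (c (q (p (q g))))))
    + a^4*b^3 / (r01 * r10 * r11 * r21) * s (t (s (t (c (q (p (q (p g))))))))"
  unfolding demazure_def[of a s p "Dt (Ds (Dt c))" g] st3 S.add S.mult ss pp r[symmetric] collect4
  by (intro term_congs; (simp add: hom_act)?; (simp add: clear)?; (simp add: expand)?)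

lemma ts1: "Ds c g = 1 / r10 * c g
    + - a / r10 * s (c (p g))"
  by (simp add: demazure_def r diff_divide_distrib)

lemma ts2: "Dt (Ds c) g = 1 / (r01 * r10) * c g
    + - b / (r01 * r11) * t (c (q g))
    + - a / (r01 * r10) * s (c (p g))
    + a*b^2 / (r01 * r11) * t (s (c (p (q g))))"
  unfolding demazure_def[of b t q "Ds c" g] ts1 T.add T.mult tt qq r[symmetric] collect2
  by (intro term_congs; (simp add: hom_act)?; (simp add: clear)?; (simp add: expand)?)

text \<open>The numerator 1 + a*b arises because two subwords of s t s multiply to the identity;
  such sums disappear once the longest element is reached.\<close>

lemma ts3: "Ds (Dt (Ds c)) g = (1 + a*b) / (r01 * r10 * r21) * c g
    + (-a - a^2*b) / (r01 * r10 * r21) * s (c (p g))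
    + - b / (r01 * r10 * r11) * t (c (q g))
    + a^3*b / (r10 * r11 * r21) * s (t (c (q (p g))))
    + a*b^2 / (r01 * r10 * r11) * t (s (c (p (q g))))
    + - (a^4*b^2) / (r10 * r11 * r21) * s (t (s (c (p (q (p g))))))"
  unfolding demazure_def[of a s p "Dt (Ds c)" g] ts2 S.add S.mult ss pp r[symmetric] collect3
  by (intro term_congs; (simp add: hom_act)?; (simp add: clear)?; (simp add: expand)?)

lemma ts4: "Dt (Ds (Dt (Ds c))) g = 1 / (r01 * r10 * r11 * r21) * c g
    + - b / (r01 * r10 * r11 * r21) * t (c (q g))
    + - a / (r01 * r10 * r11 * r21) * s (c (p g))
    + a*b^2 / (r01 * r10 * r11 * r21) * t (s (c (p (q g))))
    + a^3*b / (r01 * r10 * r11 * r21) * s (t (c (q (p g))))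
    + - (a^3*b^3) / (r01 * r10 * r11 * r21) * t (s (t (c (q (p (q g))))))
    + - (a^4*b^2) / (r01 * r10 * r11 * r21) * s (t (s (c (p (q (p g))))))
    + a^4*b^3 / (r01 * r10 * r11 * r21) * t (s (t (s (c (p (q (p (q g))))))))"
  unfolding demazure_def[of b t q "Ds (Dt (Ds c))" g] ts3 T.add T.mult tt qq r[symmetric] collect4
  by (intro term_congs; (simp add: hom_act)?; (simp add: clear)?; (simp add: expand)?)

lemma braid:
  assumes "\<And>x. s (t (s (t x))) = t (s (t (s x)))" and "\<And>g. p (q (p (q g))) = q (p (q (p g)))"
  shows "Ds (Dt (Ds (Dt c))) = Dt (Ds (Dt (Ds c)))"
  by (rule ext) (simp only: st4 ts4 assms add_ac)

end

text \<open>Again alpha is short, now with s beta = beta + 3 alpha; \<open>r31\<close> and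
  \<open>r32\<close> belong to the further roots 3 alpha + beta and 3 alpha + 2 beta.\<close>

locale braid_G2 = reflection_pair s t p q a b r10 r01 for s t :: "'k::field \<Rightarrow> 'k" and p q :: "'g \<Rightarrow> 'g" and a b r10 r01 +
  fixes r11 r21 r31 r32 :: 'k assumes sb: "s b = a^3 * b" and ta: "t a = a * b"
    and nz2: "r11 \<noteq> 0" "r21 \<noteq> 0" "r31 \<noteq> 0" "r32 \<noteq> 0"
    and r2: "r11 = 1 - a*b" "r21 = 1 - a^2*b" "r31 = 1 - a^3*b" "r32 = 1 - a^3*b^2"
begin
lemma act: "s r01 = r31" "s r10 = - r10 / a" "s r11 = r21" "s r21 = r11" "s r31 = r01" "s r32 = r32" "t r01 = - r01 / b" "t r10 = r11" "t r11 = r10" "t r21 = r21" "t r31 = r32" "t r32 = r31"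
  by (simp_all add: nz r r2 S.hom T.hom sa sb ta tb field_simps power_numeral_reduce)

lemmas hom_act = S.hom T.hom sa sb ta tb act
lemmas clear = nz nz2 divide_simps
lemmas expand = r r2 algebra_simps power_numeral_reduce

lemma st1: "Dt c g = 1 / r01 * c g
    + - b / r01 * t (c (q g))"
  by (simp add: demazure_def r diff_divide_distrib)

lemma st2: "Ds (Dt c) g = 1 / (r01 * r10) * c g
    + - a / (r10 * r31) * s (c (p g))
    + - b / (r01 * r10) * t (c (q g))
    + a^4*b / (r10 * r31) * s (t (c (q (p g))))"
  unfolding demazure_def[of a s p "Dt c" g] st1 S.add S.mult ss pp r[symmetric] collect2
  by (intro term_congs; (simp add: hom_act)?; (simp add: clear)?; (simp add: expand)?)

lemma st3: "Dt (Ds (Dt c)) g = 1 / (r01 * r10 * r11) * c g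
    + - b / (r01 * r10 * r11) * t (c (q g))
    + - a / (r01 * r10 * r31) * s (c (p g))
    + a*b^2 / (r01 * r11 * r32) * t (s (c (p (q g))))
    + a^4*b / (r01 * r10 * r31) * s (t (c (q (p g))))
    + - (a^4*b^4) / (r01 * r11 * r32) * t (s (t (c (q (p (q g))))))"
  unfolding demazure_def[of b t q "Ds (Dt c)" g] st2 T.add T.mult tt qq r[symmetric] collect3
  by (intro term_congs; (simp add: hom_act)?; (simp add: clear)?; (simp add: expand)?)

lemma st4: "Ds (Dt (Ds (Dt c))) g = (1 + a^2*b) / (r01 * r10 * r11 * r31) * c g
    + (-a - a^2*b) / (r01 * r10 * r21 * r31) * s (c (p g))
    + (-b - a^2*b^2) / (r01 * r10 * r11 * r31) * t (c (q g))
    + (a^4*b + a^5*b^2) / (r01 * r10 * r21 * r31) * s (t (c (q (p g))))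
    + a*b^2 / (r01 * r10 * r11 * r32) * t (s (c (p (q g))))
    + - (a^6*b^2) / (r10 * r21 * r31 * r32) * s (t (s (c (p (q (p g))))))
    + - (a^4*b^4) / (r01 * r10 * r11 * r32) * t (s (t (c (q (p (q g))))))
    + a^9*b^4 / (r10 * r21 * r31 * r32) * s (t (s (t (c (q (p (q (p g))))))))"
  unfolding demazure_def[of a s p "Dt (Ds (Dt c))" g] st3 S.add S.mult ss pp r[symmetric] collect4
  by (intro term_congs; (simp add: hom_act)?; (simp add: clear)?; (simp add: expand)?)

lemma st5: "Dt (Ds (Dt (Ds (Dt c)))) g = (1 + a^2*b) / (r01 * r10 * r11 * r31 * r32) * c g
    + (-b - a^2*b^2) / (r01 * r10 * r11 * r31 * r32) * t (c (q g))
    + - a / (r01 * r10 * r11 * r21 * r31) * s (c (p g))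
    + a*b^2 / (r01 * r10 * r11 * r21 * r32) * t (s (c (p (q g))))
    + a^4*b / (r01 * r10 * r11 * r21 * r31) * s (t (c (q (p g))))
    + - (a^4*b^4) / (r01 * r10 * r11 * r21 * r32) * t (s (t (c (q (p (q g))))))
    + - (a^6*b^2) / (r01 * r10 * r21 * r31 * r32) * s (t (s (c (p (q (p g))))))
    + a^6*b^5 / (r01 * r11 * r21 * r31 * r32) * t (s (t (s (c (p (q (p (q g))))))))
    + a^9*b^4 / (r01 * r10 * r21 * r31 * r32) * s (t (s (t (c (q (p (q (p g))))))))
    + - (a^9*b^6) / (r01 * r11 * r21 * r31 * r32) * t (s (t (s (t (c (q (p (q (p (q g))))))))))"
  unfolding demazure_def[of b t q "Ds (Dt (Ds (Dt c)))" g] st4 T.add T.mult tt qq r[symmetric] collect5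
  by (intro term_congs; (simp add: hom_act)?; (simp add: clear)?; (simp add: expand)?)

lemma st6: "Ds (Dt (Ds (Dt (Ds (Dt c))))) g = 1 / (r01 * r10 * r11 * r21 * r31 * r32) * c g
    + - a / (r01 * r10 * r11 * r21 * r31 * r32) * s (c (p g))
    + - b / (r01 * r10 * r11 * r21 * r31 * r32) * t (c (q g))
    + a^4*b / (r01 * r10 * r11 * r21 * r31 * r32) * s (t (c (q (p g))))
    + a*b^2 / (r01 * r10 * r11 * r21 * r31 * r32) * t (s (c (p (q g))))
    + - (a^6*b^2) / (r01 * r10 * r11 * r21 * r31 * r32) * s (t (s (c (p (q (p g))))))
    + - (a^4*b^4) / (r01 * r10 * r11 * r21 * r31 * r32) * t (s (t (c (q (p (q g))))))
    + a^9*b^4 / (r01 * r10 * r11 * r21 * r31 * r32) * s (t (s (t (c (q (p (q (p g))))))))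
    + a^6*b^5 / (r01 * r10 * r11 * r21 * r31 * r32) * t (s (t (s (c (p (q (p (q g))))))))
    + - (a^10*b^5) / (r01 * r10 * r11 * r21 * r31 * r32) * s (t (s (t (s (c (p (q (p (q (p g))))))))))
    + - (a^9*b^6) / (r01 * r10 * r11 * r21 * r31 * r32) * t (s (t (s (t (c (q (p (q (p (q g))))))))))
    + a^10*b^6 / (r01 * r10 * r11 * r21 * r31 * r32) * s (t (s (t (s (t (c (q (p (q (p (q (p g))))))))))))"
  unfolding demazure_def[of a s p "Dt (Ds (Dt (Ds (Dt c))))" g] st5 S.add S.mult ss pp r[symmetric] collect6
  by (intro term_congs; (simp add: hom_act)?; (simp add: clear)?; (simp add: expand)?)

lemma ts1: "Ds c g = 1 / r10 * c g
    + - a / r10 * s (c (p g))"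
  by (simp add: demazure_def r diff_divide_distrib)

lemma ts2: "Dt (Ds c) g = 1 / (r01 * r10) * c g
    + - b / (r01 * r11) * t (c (q g))
    + - a / (r01 * r10) * s (c (p g))
    + a*b^2 / (r01 * r11) * t (s (c (p (q g))))"
  unfolding demazure_def[of b t q "Ds c" g] ts1 T.add T.mult tt qq r[symmetric] collect2
  by (intro term_congs; (simp add: hom_act)?; (simp add: clear)?; (simp add: expand)?)

lemma ts3: "Ds (Dt (Ds c)) g = (1 + a*b + a^2*b) / (r01 * r10 * r31) * c g
    + (-a - a^2*b - a^3*b) / (r01 * r10 * r31) * s (c (p g))
    + - b / (r01 * r10 * r11) * t (c (q g))
    + a^4*b / (r10 * r21 * r31) * s (t (c (q (p g))))
    + a*b^2 / (r01 * r10 * r11) * t (s (c (p (q g))))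
    + - (a^6*b^2) / (r10 * r21 * r31) * s (t (s (c (p (q (p g))))))"
  unfolding demazure_def[of a s p "Dt (Ds c)" g] ts2 S.add S.mult ss pp r[symmetric] collect3
  by (intro term_congs; (simp add: hom_act)?; (simp add: clear)?; (simp add: expand)?)

lemma ts4: "Dt (Ds (Dt (Ds c))) g = (1 + a^2*b) / (r01 * r10 * r11 * r31) * c g
    + (-b - a^2*b^2) / (r01 * r10 * r11 * r32) * t (c (q g))
    + (-a - a^3*b) / (r01 * r10 * r11 * r31) * s (c (p g))
    + (a*b^2 + a^3*b^3) / (r01 * r10 * r11 * r32) * t (s (c (p (q g))))
    + a^4*b / (r01 * r10 * r21 * r31) * s (t (c (q (p g))))
    + - (a^4*b^4) / (r01 * r11 * r21 * r32) * t (s (t (c (q (p (q g))))))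
    + - (a^6*b^2) / (r01 * r10 * r21 * r31) * s (t (s (c (p (q (p g))))))
    + a^6*b^5 / (r01 * r11 * r21 * r32) * t (s (t (s (c (p (q (p (q g))))))))"
  unfolding demazure_def[of b t q "Ds (Dt (Ds c))" g] ts3 T.add T.mult tt qq r[symmetric] collect4
  by (intro term_congs; (simp add: hom_act)?; (simp add: clear)?; (simp add: expand)?)

lemma ts5: "Ds (Dt (Ds (Dt (Ds c)))) g = (1 + a^3*b^2) / (r01 * r10 * r11 * r21 * r31) * c g
    + (-a - a^4*b^2) / (r01 * r10 * r11 * r21 * r31) * s (c (p g))
    + (-b - a^2*b^2 - a^4*b^3) / (r01 * r10 * r11 * r31 * r32) * t (c (q g))
    + (a^4*b + a^5*b^2 + a^6*b^3) / (r01 * r10 * r21 * r31 * r32) * s (t (c (q (p g))))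
    + (a*b^2 + a^3*b^3 + a^5*b^4) / (r01 * r10 * r11 * r31 * r32) * t (s (c (p (q g))))
    + (-(a^6*b^2) - a^7*b^3 - a^8*b^4) / (r01 * r10 * r21 * r31 * r32) * s (t (s (c (p (q (p g))))))
    + - (a^4*b^4) / (r01 * r10 * r11 * r21 * r32) * t (s (t (c (q (p (q g))))))
    + a^9*b^4 / (r10 * r11 * r21 * r31 * r32) * s (t (s (t (c (q (p (q (p g))))))))
    + a^6*b^5 / (r01 * r10 * r11 * r21 * r32) * t (s (t (s (c (p (q (p (q g))))))))
    + - (a^10*b^5) / (r10 * r11 * r21 * r31 * r32) * s (t (s (t (s (c (p (q (p (q (p g))))))))))"
  unfolding demazure_def[of a s p "Dt (Ds (Dt (Ds c)))" g] ts4 S.add S.mult ss pp r[symmetric] collect5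
  by (intro term_congs; (simp add: hom_act)?; (simp add: clear)?; (simp add: expand)?)

lemma ts6: "Dt (Ds (Dt (Ds (Dt (Ds c))))) g = 1 / (r01 * r10 * r11 * r21 * r31 * r32) * c g
    + - b / (r01 * r10 * r11 * r21 * r31 * r32) * t (c (q g))
    + - a / (r01 * r10 * r11 * r21 * r31 * r32) * s (c (p g))
    + a*b^2 / (r01 * r10 * r11 * r21 * r31 * r32) * t (s (c (p (q g))))
    + a^4*b / (r01 * r10 * r11 * r21 * r31 * r32) * s (t (c (q (p g))))
    + - (a^4*b^4) / (r01 * r10 * r11 * r21 * r31 * r32) * t (s (t (c (q (p (q g))))))
    + - (a^6*b^2) / (r01 * r10 * r11 * r21 * r31 * r32) * s (t (s (c (p (q (p g))))))
    + a^6*b^5 / (r01 * r10 * r11 * r21 * r31 * r32) * t (s (t (s (c (p (q (p (q g))))))))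
    + a^9*b^4 / (r01 * r10 * r11 * r21 * r31 * r32) * s (t (s (t (c (q (p (q (p g))))))))
    + - (a^9*b^6) / (r01 * r10 * r11 * r21 * r31 * r32) * t (s (t (s (t (c (q (p (q (p (q g))))))))))
    + - (a^10*b^5) / (r01 * r10 * r11 * r21 * r31 * r32) * s (t (s (t (s (c (p (q (p (q (p g))))))))))
    + a^10*b^6 / (r01 * r10 * r11 * r21 * r31 * r32) * t (s (t (s (t (s (c (p (q (p (q (p (q g))))))))))))"
  unfolding demazure_def[of b t q "Ds (Dt (Ds (Dt (Ds c))))" g] ts5 T.add T.mult tt qq r[symmetric] collect6
  by (intro term_congs; (simp add: hom_act)?; (simp add: clear)?; (simp add: expand)?)

lemma braid:
  assumes "\<And>x. s (t (s (t (s (t x))))) = t (s (t (s (t (s x)))))" and "\<And>g. p (q (p (q (p (q g))))) = q (p (q (p (q (p g)))))"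
  shows "Ds (Dt (Ds (Dt (Ds (Dt c))))) = Dt (Ds (Dt (Ds (Dt (Ds c)))))"
  by (rule ext) (simp only: st6 ts6 assms add_ac)

end

section \<open>The twisted group algebra\<close>

text \<open>The common form of \<open>actCP\<close>, which moves exponents only, and of
  \<open>tau\<close>, which moves exponents and coefficients.\<close>

definition push_map :: "('a \<Rightarrow> 'c) \<Rightarrow> ('b \<Rightarrow> 'd) \<Rightarrow> ('a \<Rightarrow>\<^sub>0 'b::zero) \<Rightarrow> ('c \<Rightarrow>\<^sub>0 'd::comm_monoid_add)" where
  "push_map h \<phi> c = (\<Sum>\<mu>\<in>mkeys c. msingle (h \<mu>) (\<phi> (lk c \<mu>)))"

lemma poly_mapping_expand: "c = (\<Sum>\<mu>\<in>mkeys c. msingle \<mu> (lk c \<mu>))"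
  for c :: "'a \<Rightarrow>\<^sub>0 'b::comm_monoid_add"
proof (rule poly_mapping_eqI)
  fix k
  have "(\<Sum>\<mu>\<in>mkeys c. lk (msingle \<mu> (lk c \<mu>)) k)
      = (\<Sum>\<mu>\<in>mkeys c. if k = \<mu> then lk c \<mu> else 0)"
    by (intro sum.cong) (auto simp: lookup_single when_def)
  also have "\<dots> = lk c k" by (simp add: in_keys_iff)
  finally show "lk c k = lk (\<Sum>\<mu>\<in>mkeys c. msingle \<mu> (lk c \<mu>)) k"
    by (simp add: lookup_sum)
qed

lemma push_map_single: "\<phi> 0 = 0 \<Longrightarrow> push_map h \<phi> (msingle \<mu> a) = msingle (h \<mu>) (\<phi> a)"
  by (auto simp: push_map_def)

lemma push_map_zero [simp]: "push_map h \<phi> 0 = 0" by (simp add: push_map_def)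

lemma push_map_add:
  assumes "\<And>x y. \<phi> (x + y) = \<phi> x + \<phi> y" "\<phi> 0 = 0"
  shows "push_map h \<phi> (c + d) = push_map h \<phi> c + push_map h \<phi> d"
  unfolding push_map_def
  by (rule setsum_keys_plus_distrib) (simp_all add: assms single_add)

lemma push_map_sum:
  assumes "\<And>x y. \<phi> (x + y) = \<phi> x + \<phi> y" "\<phi> 0 = 0"
  shows "push_map h \<phi> (sum f S) = (\<Sum>i\<in>S. push_map h \<phi> (f i))"
  by (induction S rule: infinite_finite_induct) (simp_all add: push_map_add assms)

text \<open>Two further index maps are allowed because an affine map is not additive: it splits as
  itself on one summand plus its linear part on the other.\<close>

lemma push_map_mult:
  fixes \<phi> :: "'k::comm_ring_1 \<Rightarrow> 'k"
  assumes "\<And>x y. \<phi> (x + y) = \<phi> x + \<phi> y" "\<phi> 0 = 0" "\<And>x y. \<phi> (x * y) = \<phi> x * \<phi> y"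
    and h: "\<And>x y. h (x + y) = h1 x + h2 (y::'a::comm_monoid_add)"
  shows "push_map h \<phi> (c * d) = push_map h1 \<phi> c * (push_map h2 \<phi> d :: 'b::comm_monoid_add \<Rightarrow>\<^sub>0 'k)"
proof -
  let ?c = "\<Sum>\<mu>\<in>mkeys c. msingle \<mu> (lk c \<mu>)"
  let ?d = "\<Sum>\<mu>\<in>mkeys d. msingle \<mu> (lk d \<mu>)"
  have "push_map h \<phi> (c * d) = push_map h \<phi> (?c * ?d)" using poly_mapping_expand[of c] poly_mapping_expand[of d] by simp
  also have "\<dots> = (\<Sum>\<mu>\<in>mkeys c. \<Sum>\<nu>\<in>mkeys d.
      msingle (h1 \<mu> + h2 \<nu>) (\<phi> (lk c \<mu>) * \<phi> (lk d \<nu>)))"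
    by (simp add: sum_product mult_single push_map_sum assms push_map_single)
  also have "\<dots> = push_map h1 \<phi> c * push_map h2 \<phi> d"
    by (simp add: push_map_def sum_product mult_single)
  finally show ?thesis .
qed

lemma push_map_push_map:
  assumes "\<And>x y. \<phi> (x + y) = \<phi> x + \<phi> y" "\<phi> 0 = 0" "\<phi>' 0 = 0"
  shows "push_map h \<phi> (push_map h' \<phi>' c) = push_map (h \<circ> h') (\<phi> \<circ> \<phi>') c"
  unfolding push_map_def[of h'] push_map_def[of "h \<circ> h'"]
  by (simp add: push_map_sum assms push_map_single)

lemma push_map_id: "push_map (\<lambda>x. x) (\<lambda>x. x) c = c"
  unfolding push_map_def by (rule poly_mapping_expand[symmetric])

lemma lookup_push_map:
  assumes "inj h" "\<phi> 0 = 0"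
  shows "lk (push_map h \<phi> c) (h \<mu>) = \<phi> (lk c \<mu>)"
proof -
  have "lk (push_map h \<phi> c) (h \<mu>) = (\<Sum>\<nu>\<in>mkeys c. if \<mu> = \<nu> then \<phi> (lk c \<nu>) else 0)"
    unfolding push_map_def lookup_sum using inj_eq[OF assms(1)]
    by (intro sum.cong) (auto simp: lookup_single when_def)
  also have "\<dots> = \<phi> (lk c \<mu>)" by (simp add: assms in_keys_iff)
  finally show ?thesis .
qed

lemma lookup_single0_mult: "lk (msingle 0 k * C) \<gamma> = k * lk C \<gamma>"
  for C :: "wt \<Rightarrow>\<^sub>0 'k::comm_ring_1"
proof -
  have "msingle 0 k * (\<Sum>\<mu>\<in>mkeys C. msingle \<mu> (lk C \<mu>))
      = push_map (\<lambda>x. x) (\<lambda>x. k * x) C"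
    by (simp add: push_map_def sum_distrib_left mult_single)
  then have "msingle 0 k * C = push_map (\<lambda>x. x) (\<lambda>x. k * x) C"
    using poly_mapping_expand[of C] by simp
  then show ?thesis using lookup_push_map[of "\<lambda>x. x" "\<lambda>x. k * x" C \<gamma>] by simp
qed

lemma actCP_push_map: "actCP f = push_map f (\<lambda>x. x)"
  by (rule ext) (simp add: actCP_def push_map_def)

text \<open>Injectivity of f keeps denominators nonzero and additivity makes \<open>actCP f\<close>
  multiplicative, so the value is independent of the fraction and the choice in \<open>actK\<close>
  is forced.\<close>

lemma actK_Fract:
  assumes f: "\<And>x y. f (x + y) = f x + f y" "inj f" and b: "b \<noteq> 0"
  shows "actK f (Fract a b) = Fract (actCP f a) (actCP f b)" "actCP f b \<noteq> 0"
proof -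
  have m: "actCP f (c * d) = actCP f c * actCP f d" for c d
    unfolding actCP_push_map by (rule push_map_mult) (simp_all add: f)
  have nz: "actCP f c \<noteq> 0" if "c \<noteq> 0" for c
  proof
    assume "actCP f c = 0"
    then have "lk c \<mu> = 0" for \<mu> using lookup_push_map[OF f(2), of "\<lambda>x. x" c \<mu>] by (simp add: actCP_push_map)
    then show False using that by (simp add: poly_mapping_eqI)
  qed
  then show "actCP f b \<noteq> 0" using b .
  have *: "Fract (actCP f a) (actCP f b) = Fract (actCP f a') (actCP f b')" if "b' \<noteq> 0" "Fract a b = Fract a' b'" for a' b'
    using that b nz m by (metis eq_fract(1))
  have "\<exists>y. \<forall>a' b'. b' \<noteq> 0 \<longrightarrow> Fract a b = Fract a' b' \<longrightarrow> y = Fract (actCP f a') (actCP f b')"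
    using * by blast
  from someI_ex[OF this, folded actK_def] show "actK f (Fract a b) = Fract (actCP f a) (actCP f b)"
    using b by blast
qed

lemma actK_field_hom:
  assumes f: "\<And>x y. f (x + y) = f x + f y" "inj f"
  shows "field_hom (actK f)"
proof
  note F = actK_Fract[OF f]
  have m: "actCP f (c * d) = actCP f c * actCP f d" and a: "actCP f (c + d) = actCP f c + actCP f d" for c d
    unfolding actCP_push_map by (rule push_map_mult push_map_add; simp add: f)+
  have 0: "f 0 = 0" using f(1)[of 0 0] by (metis add.right_neutral add_cancel_left_left)
  show "actK f (x + y) = actK f x + actK f y" for x y
    by (cases x; cases y) (simp add: F m a)
  show "actK f (x * y) = actK f x * actK f y" for x y
    by (cases x; cases y) (simp add: F m)
  have "actCP f 1 = 1" unfolding actCP_push_map single_one[symmetric] by (simp add: push_map_single 0 del: single_one)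
  then show "actK f 1 = 1" by (simp add: One_fract_def F)
qed

lemma actK_comp:
  assumes f: "\<And>x y. f (x + y) = f x + f y" "inj f" and g: "\<And>x y. g (x + y) = g x + g y" "inj g"
  shows "actK (f \<circ> g) x = actK f (actK g x)"
proof -
  have c: "actCP (f \<circ> g) c = actCP f (actCP g c)" for c
    unfolding actCP_push_map by (subst push_map_push_map) (simp_all add: comp_def)
  have "inj (f \<circ> g)" using f g by (simp add: inj_compose)
  then show ?thesis by (cases x) (simp add: actK_Fract f g c)
qed

lemma actK_id: "actK id x = x"
proof -
  have "actCP id c = c" for c unfolding actCP_push_map id_def by (rule push_map_id)
  then show ?thesis by (cases x) (simp add: actK_Fract)
qed

lemma eK_add: "eK (\<mu> + \<nu>) = eK \<mu> * eK \<nu>" by (simp add: eK_def mult_single)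
lemma eK_0: "eK 0 = 1" by (simp add: eK_def One_fract_def)
lemma single_nz: "msingle \<mu> (1::complex) \<noteq> 0" by (metis lookup_single_eq lookup_zero zero_neq_one)
lemma eK_nz: "eK \<mu> \<noteq> 0" by (simp add: eK_def Zero_fract_def eq_fract single_nz)
lemma eK_uminus: "eK (- \<mu>) = 1 / eK \<mu>"
  using eK_add[of "- \<mu>" \<mu>] eK_nz[of \<mu>] by (simp add: eK_0 field_simps)
lemma eK_power: "eK (fc (int k) \<mu>) = eK \<mu> ^ k"
  by (induction k) (simp_all add: eK_0 frag_cmul_distrib eK_add)
lemma eK_eq_1: "eK \<mu> = 1 \<longleftrightarrow> \<mu> = 0"
proof -
  have "eK \<mu> = 1 \<longleftrightarrow> msingle \<mu> (1::complex) = msingle 0 1"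
    by (simp add: eK_def One_fract_def eq_fract)
  also have "\<dots> \<longleftrightarrow> \<mu> = 0" by (metis lookup_single_eq lookup_single_not_eq zero_neq_one)
  finally show ?thesis .
qed

lemma actK_eK:
  assumes "\<And>x y. f (x + y) = f x + f y" "inj f"
  shows "actK f (eK \<mu>) = eK (f \<mu>)"
proof -
  have "actCP f 1 = 1" "actCP f (msingle \<mu> 1) = msingle (f \<mu>) 1"
    using assms(1)[of 0 0] unfolding actCP_push_map single_one[symmetric]
    by (simp_all add: push_map_single del: single_one)
  then show ?thesis by (simp add: eK_def actK_Fract assms)
qed

section \<open>Demazure operators on functions on the coroot lattice\<close>

context cartan
begin

abbreviation actW :: "waf \<Rightarrow> K \<Rightarrow> K" where "actW x \<equiv> actK (fst (snd x))"

text \<open>The affine action on Q^vee, that is, the left action of W_af on the cosets W_af / W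
  labelled by their translation parts.\<close>

definition cact :: "waf \<Rightarrow> wt \<Rightarrow> wt" where "cact x \<gamma> = fst x + snd (snd x) \<gamma>"

lemma cact_mul: "good x \<Longrightarrow> cact (x \<cdot> y) \<gamma> = cact x (cact y \<gamma>)"
  by (auto simp: cact_def good_def wmul_def add.assoc split: prod.splits)

lemma cact_one [simp]: "cact wone \<gamma> = \<gamma>" by (simp add: cact_def wone_def)

lemma fst_mul: "fst (x \<cdot> y) = cact x (fst y)"
  by (simp add: cact_def wmul_def split: prod.splits)

lemma Waf_linear_inj: assumes "x \<in> W" shows "fst (snd x) (\<mu> + \<nu>) = fst (snd x) \<mu> + fst (snd x) \<nu>" "inj (fst (snd x))" "inj (cact x)"
proof -
  show "fst (snd x) (\<mu> + \<nu>) = fst (snd x) \<mu> + fst (snd x) \<nu>"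
    using W_good[OF assms] by (auto simp: good_def split: prod.splits)
  have "fst (snd (winv x \<cdot> x)) = fst (snd (winv x)) \<circ> fst (snd x)" by (simp add: wmul_def split: prod.splits)
  then have "fst (snd (winv x)) (fst (snd x) \<mu>) = \<mu>" for \<mu>
    using winv(3)[OF assms] by (simp add: wone_def fun_eq_iff)
  then show "inj (fst (snd x))" by (rule inj_on_inverseI)
  have "cact (winv x) (cact x \<gamma>) = \<gamma>" for \<gamma>
    using cact_mul[OF W_good[OF winv(1)[OF assms]], of x \<gamma>] winv(3)[OF assms] by simp
  then show "inj (cact x)" by (rule inj_on_inverseI)
qed

lemma field_hom_W: "x \<in> W \<Longrightarrow> field_hom (actW x)" using Waf_linear_inj by (intro actK_field_hom)

lemma actW_mul: "x \<in> W \<Longrightarrow> y \<in> W \<Longrightarrow> actW (x \<cdot> y) k = actW x (actW y k)"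
proof -
  assume xy: "x \<in> W" "y \<in> W"
  have "fst (snd (x \<cdot> y)) = fst (snd x) \<circ> fst (snd y)" by (simp add: wmul_def split: prod.splits)
  then show ?thesis using Waf_linear_inj[OF xy(1)] Waf_linear_inj[OF xy(2)] by (simp add: actK_comp)
qed

lemma actW_one [simp]: "actW wone k = k" by (simp add: wone_def actK_id)

lemma actW_invol: "i \<in> J \<Longrightarrow> actW (s i) (actW (s i) k) = k"
  using actW_mul[OF gen_W gen_W, of i i k] by simp

lemma cact_invol: "i \<in> J \<Longrightarrow> cact (s i) (cact (s i) \<gamma>) = \<gamma>"
  using cact_mul[OF good_gen, of i "s i" \<gamma>] by simp

lemma actW_eK: "i \<in> J \<Longrightarrow> actW (s i) (eK \<mu>) = eK (\<mu> - fc \<langle>rc i,\<mu>\<rangle> (rw i))"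
  using Waf_linear_inj[OF gen_W, of i] by (simp add: actK_eK) (simp add: gen_eq reflP_def)

text \<open>Defined on all functions so that the abstract braid relations apply directly;
  \<open>DCc\<close> is its restriction to finite support.\<close>

definition DC :: "nat \<Rightarrow> (wt \<Rightarrow> K) \<Rightarrow> wt \<Rightarrow> K" where
  "DC i = demazure (eK (rw i)) (actW (s i)) (cact (s i))"

lemma rw_nz: "i \<in> J \<Longrightarrow> rw i \<noteq> 0" using rc_rw[of i] by auto

lemma eK_rw: "i \<in> J \<Longrightarrow> 1 - eK (rw i) \<noteq> 0"
  using rw_nz eK_eq_1[of "rw i"] by (metis eq_iff_diff_eq_0)

text \<open>The level is lost in e^alpha, so the finite parts themselves must be independent.
  Pairing with both coroots gives a 2 by 2 system whose determinant is 4 minus the product of the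
  two Cartan integers.\<close>

lemma comb_nz:
  assumes ij: "i \<in> J" "j \<in> J" and ab: "cm i j * cm j i \<noteq> 4" and xy: "x \<noteq> 0 \<or> y \<noteq> 0"
  shows "fc x (rw i) + fc y (rw j) \<noteq> 0"
proof
  assume 0: "fc x (rw i) + fc y (rw j) = 0"
  have "\<langle>rc i, fc x (rw i) + fc y (rw j)\<rangle> = 0" "\<langle>rc j, fc x (rw i) + fc y (rw j)\<rangle> = 0" unfolding 0 by simp_all
  then have e: "2 * x + cm i j * y = 0" "cm j i * x + 2 * y = 0"
    using rc_rw[OF ij(1)] rc_rw[OF ij(2)] by (simp_all add: cm_def algebra_simps)
  have "(4 - cm i j * cm j i) * y = 2 * (cm j i * x + 2 * y) - cm j i * (2 * x + cm i j * y)" by (simp add: algebra_simps)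
  then have "y = 0" using e ab by simp
  then show False using e xy by simp
qed

lemma comb_eK:
  assumes ij: "i \<in> J" "j \<in> J" and ab: "cm i j * cm j i \<noteq> 4" and xy: "x \<noteq> 0 \<or> y \<noteq> 0"
  shows "1 - eK (rw i) ^ x * eK (rw j) ^ y \<noteq> 0"
  using comb_nz[OF ij ab, of "int x" "int y"] xy
  by (simp add: eK_power[symmetric] eK_add[symmetric] eK_eq_1 del: eK_power)

lemma word_act:
  assumes "set w \<subseteq> J"
  shows "actW (E w) k = foldr (\<lambda>i. actW (s i)) w k" "cact (E w) \<gamma> = foldr (\<lambda>i. cact (s i)) w \<gamma>"
  using assms by (induction w) (simp_all add: actW_mul gen_W word_Waf cact_mul good_gen)

text \<open>The rank 2 locales fix the direction of a multiple bond: the exponent of a in s b is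
  minus \<open>cm i j\<close>, that of b in t a is minus \<open>cm j i\<close>. The opposite
  direction follows by exchanging i and j.\<close>

lemma DC_braid_oriented:
  assumes ij: "i \<in> J" "j \<in> J"
    and t: "(cm i j, cm j i) \<in> {(0, 0), (-1, -1), (-2, -1), (-3, -1)}"
  shows "foldr DC (rev (alt i j (cox i j))) = foldr DC (rev (alt j i (cox i j)))"
proof -
  let ?s = "actW (s i)" and ?t = "actW (s j)" and ?p = "cact (s i)" and ?q = "cact (s j)"
    and ?a = "eK (rw i)" and ?b = "eK (rw j)" and ?m = "cox i j"
  interpret S: field_hom ?s by (rule field_hom_W[OF gen_W[OF ij(1)]])
  interpret T: field_hom ?t by (rule field_hom_W[OF gen_W[OF ij(2)]])
  have self: "?s ?a = 1 / ?a" "?t ?b = 1 / ?b"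
    unfolding actW_eK[OF ij(1)] actW_eK[OF ij(2)] rc_rw[OF ij(1)] rc_rw[OF ij(2)] eK_uminus[symmetric]
    by (intro arg_cong[where f = eK] poly_mapping_eqI; simp add: lookup_minus)+
  interpret P: reflection_pair ?s ?t ?p ?q ?a ?b "1 - ?a" "1 - ?b"
    by unfold_locales (simp_all only: actW_invol[OF ij(1)] actW_invol[OF ij(2)] cact_invol[OF ij(1)]
        cact_invol[OF ij(2)] eK_nz eK_rw[OF ij(1)] eK_rw[OF ij(2)] self not_False_eq_True)
  have ab: "cm i j * cm j i \<noteq> 4" and t': "(cm i j, cm j i) \<in> rank2_types" using t by (auto simp: rank2_types_def)
  have J: "set (alt i j ?m) \<subseteq> J" "set (alt j i ?m) \<subseteq> J" using alt_J ij by blast+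
  have rel: "foldr (\<lambda>i. actW (s i)) (alt i j ?m) k = foldr (\<lambda>i. actW (s i)) (alt j i ?m) k"
    "foldr (\<lambda>i. cact (s i)) (alt i j ?m) \<gamma> = foldr (\<lambda>i. cact (s i)) (alt j i ?m) \<gamma>" for k \<gamma>
    using coxeter_relation[OF ij t'] word_act[OF J(1)] word_act[OF J(2)] by metis+
  have cross: "?s ?b = eK (rw j - fc (cm i j) (rw i))" "?t ?a = eK (rw i - fc (cm j i) (rw j))"
    by (simp_all add: actW_eK[OF ij(1)] actW_eK[OF ij(2)] cm_def)
  have pw: "eK (rw j - fc (- int k) (rw i)) = ?a ^ k * ?b" "eK (rw i - fc (- int k) (rw j)) = ?a * ?b ^ k" for k
    by (simp_all add: eK_add eK_power mult.commute diff_conv_add_uminus)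
  note nz = comb_eK[OF ij ab]
  from t consider (1) "cm i j = 0" "cm j i = 0" | (2) "cm i j = -1" "cm j i = -1"
    | (3) "cm i j = -2" "cm j i = -1" | (4) "cm i j = -3" "cm j i = -1" by auto
  then show ?thesis
  proof cases
    case 1
    then interpret Q: braid_A1 ?s ?t ?p ?q ?a ?b "1 - ?a" "1 - ?b"
      by unfold_locales (simp_all add: cross)
    show ?thesis using 1 rel by (simp add: cox_def alt_simps fun_eq_iff DC_def Q.braid)
  next
    case 2
    then interpret Q: braid_A2 ?s ?t ?p ?q ?a ?b "1 - ?a" "1 - ?b" "1 - ?a * ?b"
      using pw[of 1] nz[of 1 1] by unfold_locales (simp_all add: cross)
    show ?thesis using 2 rel by (simp add: cox_def alt_simps fun_eq_iff DC_def Q.braid)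
  next
    case 3
    then interpret Q: braid_B2 ?s ?t ?p ?q ?a ?b "1 - ?a" "1 - ?b" "1 - ?a * ?b" "1 - ?a^2 * ?b"
      using pw(1)[of 2] pw(2)[of 1] nz[of 1 1] nz[of 2 1] by unfold_locales (simp_all add: cross)
    show ?thesis using 3 rel by (simp add: cox_def alt_simps fun_eq_iff DC_def Q.braid)
  next
    case 4
    then interpret Q: braid_G2 ?s ?t ?p ?q ?a ?b "1 - ?a" "1 - ?b" "1 - ?a * ?b" "1 - ?a^2 * ?b" "1 - ?a^3 * ?b" "1 - ?a^3 * ?b^2"
      using pw(1)[of 3] pw(2)[of 1] nz[of 1 1] nz[of 2 1] nz[of 3 1] nz[of 3 2] by unfold_locales (simp_all add: cross)
    show ?thesis using 4 rel by (simp add: cox_def alt_simps fun_eq_iff DC_def Q.braid)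
  qed
qed

lemma DC_braid:
  assumes ij: "i \<in> J" "j \<in> J" and t: "(cm i j, cm j i) \<in> rank2_types"
  shows "foldr DC (rev (alt i j (cox i j))) = foldr DC (rev (alt j i (cox i j)))"
proof (cases "(cm i j, cm j i) \<in> {(0, 0), (-1, -1), (-2, -1), (-3, -1)}")
  case True then show ?thesis using DC_braid_oriented ij by blast
next
  case False
  then have "(cm j i, cm i j) \<in> {(0, 0), (-1, -1), (-2, -1), (-3, -1)}" using t by (auto simp: rank2_types_def)
  from DC_braid_oriented[OF ij(2,1) this] show ?thesis by (simp add: cox_sym[of j i])
qed

text \<open>The operator that left multiplication by x induces on C(P) tensor CQ^vee through
  \<open>pr\<close>: affine on exponents, semilinear on coefficients.\<close>

definition tau :: "waf \<Rightarrow> Calg \<Rightarrow> Calg" where "tau x = push_map (cact x) (actW x)"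

lemma actW_hom: assumes "x \<in> W" shows "actW x (a + b) = actW x a + actW x b" "actW x (a * b) = actW x a * actW x b"
    "actW x 0 = 0" "actW x 1 = 1"
proof -
  interpret field_hom "actW x" using assms by (rule field_hom_W)
  show "actW x (a + b) = actW x a + actW x b" "actW x (a * b) = actW x a * actW x b" "actW x 0 = 0" "actW x 1 = 1"
    by (simp_all add: hom)
qed

lemma lookup_tau: "x \<in> W \<Longrightarrow> lk (tau x C) (cact x \<gamma>) = actW x (lk C \<gamma>)"
  unfolding tau_def by (intro lookup_push_map Waf_linear_inj actW_hom)

lemma cact_fin: "x \<in> W \<Longrightarrow> cact x (\<gamma> + \<delta>) = cact x \<gamma> + cact (fin x) \<delta>"
  using W_good[of x] by (auto simp: cact_def fin_def good_def algebra_simps split: prod.splits)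

text \<open>The translation part of x may enter only one factor, so the other is moved by the linear
  part \<open>fin x\<close>, an element of \<open>WI\<close>. This is why even D_0 commutes with
  multiplication by W-invariants.\<close>

lemma tau_mult: "x \<in> W \<Longrightarrow> tau x (C * D) = tau x C * tau (fin x) D"
proof -
  assume x: "x \<in> W"
  have "push_map (cact x) (actW x) (C * D) = push_map (cact x) (actW x) C * push_map (cact (fin x)) (actW x) D"
    by (rule push_map_mult) (simp_all add: actW_hom[OF x] cact_fin[OF x])
  then show ?thesis by (simp add: tau_def fin_def)
qed

lemma tau_mul: "x \<in> W \<Longrightarrow> y \<in> W \<Longrightarrow> tau (x \<cdot> y) C = tau x (tau y C)"
proof -
  assume x: "x \<in> W" and y: "y \<in> W"
  have "cact (x \<cdot> y) = cact x \<circ> cact y" "actW (x \<cdot> y) = actW x \<circ> actW y"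
    by (simp_all add: fun_eq_iff cact_mul[OF W_good[OF x]] actW_mul[OF x y])
  then show ?thesis unfolding tau_def by (simp add: push_map_push_map actW_hom[OF x] actW_hom[OF y])
qed

lemma tau_one: "tau wone C = C"
proof -
  have "cact wone = (\<lambda>x. x)" "actW wone = (\<lambda>x. x)" by (simp_all add: fun_eq_iff)
  then show ?thesis by (simp add: tau_def push_map_id)
qed

abbreviation cst :: "K \<Rightarrow> Calg" where "cst k \<equiv> msingle 0 k"

definition DCc :: "nat \<Rightarrow> Calg \<Rightarrow> Calg" where
  "DCc i C = cst (1 / (1 - eK (rw i))) * C + cst (- (eK (rw i) / (1 - eK (rw i)))) * tau (s i) C"

lemma lookup_DCc:
  assumes "i \<in> J" shows "lk (DCc i C) = DC i (lk C)"
proof (rule ext)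
  fix \<gamma>
  have "lk (tau (s i) C) \<gamma> = actW (s i) (lk C (cact (s i) \<gamma>))"
    using lookup_tau[OF gen_W[OF assms], of C "cact (s i) \<gamma>"] cact_invol[OF assms] by simp
  then show "lk (DCc i C) \<gamma> = DC i (lk C) \<gamma>"
    by (simp add: DCc_def DC_def demazure_def lookup_add lookup_single0_mult diff_divide_distrib)
qed

lemma DCc_word: "set w \<subseteq> J \<Longrightarrow> lk (foldr DCc w C) = foldr DC w (lk C)"
  by (induction w) (simp_all add: lookup_DCc)

lemma DCc_braid:
  assumes ij: "i \<in> J" "j \<in> J" and t: "(cm i j, cm j i) \<in> rank2_types"
  shows "foldr DCc (rev (alt i j (cox i j))) = foldr DCc (rev (alt j i (cox i j)))"
proof (rule ext)
  fix C
  have J: "set (rev (alt i j (cox i j))) \<subseteq> J" "set (rev (alt j i (cox i j))) \<subseteq> J"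
    using alt_J[OF ij] alt_J[OF ij(2,1)] by simp_all
  have "lk (foldr DCc (rev (alt i j (cox i j))) C) = lk (foldr DCc (rev (alt j i (cox i j))) C)"
    unfolding DCc_word[OF J(1)] DCc_word[OF J(2)] DC_braid[OF assms] ..
  then show "foldr DCc (rev (alt i j (cox i j))) C = foldr DCc (rev (alt j i (cox i j))) C"
    by (intro poly_mapping_eqI) (erule fun_cong)
qed

lemmas DCc_red = matsumoto[of DCc, OF DCc_braid]

lemma cst_sum: "cst (a + b) = cst a + cst b" by (rule single_add)

text \<open>With q = e^alpha / (1 - e^alpha) one has D_i = 1 + q (1 - s_i), and q is
  nonzero.\<close>

lemma DCc_fixed_iff:
  assumes "i \<in> J" shows "DCc i C = C \<longleftrightarrow> tau (s i) C = C"
proof -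
  let ?e = "eK (rw i)" and ?q = "eK (rw i) / (1 - eK (rw i))"
  have e: "1 - ?e \<noteq> 0" "?q \<noteq> 0" using eK_rw[OF assms] eK_nz[of "rw i"] by auto
  have p: "1 / (1 - ?e) = 1 + ?q" using e by (simp add: field_simps)
  have D: "DCc i C = C + cst ?q * (C - tau (s i) C)"
    unfolding DCc_def p cst_sum single_uminus by (simp add: algebra_simps)
  show ?thesis
  proof
    assume "DCc i C = C"
    then have "cst ?q * (C - tau (s i) C) = 0" unfolding D by simp
    then have "?q * lk (C - tau (s i) C) \<gamma> = 0" for \<gamma> by (metis lookup_single0_mult lookup_zero)
    then have "C - tau (s i) C = 0" using e by (intro poly_mapping_eqI) simp
    then show "tau (s i) C = C" by simp
  qed (simp add: D)
qed

lemma tau_unit: "x \<in> W \<Longrightarrow> tau x 1 = msingle (fst x) 1"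
proof -
  assume x: "x \<in> W"
  have "cact x 0 = fst x" using W_good[OF x] good_diff(1)[of "snd (snd x)"]
    by (cases x) (simp add: cact_def good_def)
  then show ?thesis unfolding tau_def single_one[symmetric] using x by (simp add: push_map_single actW_hom del: single_one)
qed

lemma DCc_unit: "set v \<subseteq> I \<Longrightarrow> foldr DCc v 1 = 1"
proof (induction v)
  case (Cons i v)
  then have i: "i \<in> I" by simp
  have "tau (s i) 1 = 1" using tau_unit[OF gen_W[OF I_J[OF i]]] WI_fst[OF gen_WI[OF i]] by simp
  then show ?case using Cons DCc_fixed_iff[OF I_J[OF i]] by simp
qed simp

lemma lookup_DCc_at:
  assumes "i \<in> J"
  shows "lk (DCc i C) \<gamma> = (lk C \<gamma> - eK (rw i) * actW (s i) (lk C (cact (s i) \<gamma>))) / (1 - eK (rw i))"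
  by (simp add: lookup_DCc[OF assms] DC_def demazure_def)

text \<open>Every value of D_i is invariant under s_i, which multiplies its numerator and
  denominator by the same factor -e^{-alpha}; invariants are fixed.\<close>

lemma DCc_idem: assumes i: "i \<in> J" shows "DCc i (DCc i C) = DCc i C"
proof -
  interpret S: field_hom "actW (s i)" by (rule field_hom_W[OF gen_W[OF i]])
  have self: "actW (s i) (eK (rw i)) = 1 / eK (rw i)"
    unfolding actW_eK[OF i] rc_rw[OF i] eK_uminus[symmetric]
    by (intro arg_cong[where f = eK] poly_mapping_eqI) (simp add: lookup_minus)
  have "lk (tau (s i) (DCc i C)) \<gamma> = lk (DCc i C) \<gamma>" for \<gamma>
  proof -
    let ?e = "eK (rw i)"
    have e: "?e \<noteq> 0" "1 - ?e \<noteq> 0" "?e - 1 \<noteq> 0" using eK_nz[of "rw i"] eK_rw[OF i] by auto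
    have "lk (tau (s i) (DCc i C)) \<gamma> = actW (s i) (lk (DCc i C) (cact (s i) \<gamma>))"
      using lookup_tau[OF gen_W[OF i], of "DCc i C" "cact (s i) \<gamma>"] cact_invol[OF i] by simp
    also have "\<dots> = (actW (s i) (lk C (cact (s i) \<gamma>)) - 1 / ?e * lk C \<gamma>) / (1 - 1 / ?e)"
      by (simp add: lookup_DCc_at[OF i] S.hom self actW_invol[OF i] cact_invol[OF i])
    also have "\<dots> = lk (DCc i C) \<gamma>" using e by (simp add: lookup_DCc_at[OF i] field_simps)
    finally show ?thesis .
  qed
  then have "tau (s i) (DCc i C) = DCc i C" by (rule poly_mapping_eqI)
  then show ?thesis using DCc_fixed_iff[OF i] by blast
qed

text \<open>The image of the class of Gr_gamma in C(P) tensor CQ^vee, as \<open>pr_class\<close>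
  shows; the word is the one chosen inside \<open>Dimg\<close>, and \<open>Xi_eq\<close> frees the
  value from that choice.\<close>

definition Xi :: "wt \<Rightarrow> Calg" where "Xi \<gamma> = foldr DCc (SOME ws. red (transl \<gamma>) ws) 1"

lemma Xi_eq: "ascI x \<Longrightarrow> red x u \<Longrightarrow> Xi (fst x) = foldr DCc u 1"
proof -
  assume a: "ascI x" and u: "red x u"
  obtain u' v where uv: "red x u'" "set v \<subseteq> I" "red (transl (fst x)) (u' @ v)" using ascI_transl[OF a] by blast
  have "red (transl (fst x)) (SOME ws. red (transl (fst x)) ws)" using uv(3) by (rule someI)
  then have "Xi (fst x) = foldr DCc (u' @ v) 1" unfolding Xi_def using DCc_red[OF _ _ _ _ uv(3)] by metis
  also have "\<dots> = foldr DCc u' 1" using DCc_unit[OF uv(2)] by simp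
  also have "\<dots> = foldr DCc u 1" using DCc_red[OF _ _ _ uv(1) u] by metis
  finally show ?thesis .
qed

lemma Xi_invariant:
  assumes "antidominant \<beta>" "v \<in> WI"
  shows "tau v (Xi \<beta>) = Xi \<beta>"
proof -
  have one: "ascI wone" using wone_W apos_al I_J by (auto simp: ascI_def)
  have t: "ascI (transl \<beta>)" using len_antidominant(2)[OF one assms(1)] by simp
  have "fst (transl \<beta>) = \<beta>" by (simp add: transl_def)
  then have Xi: "red (transl \<beta>) u \<Longrightarrow> Xi \<beta> = foldr DCc u 1" for u using Xi_eq[OF t] by simp
  have gen: "tau (s i) (Xi \<beta>) = Xi \<beta>" if i: "i \<in> I" for i
  proof -
    obtain u where u: "red (transl \<beta>) (i # u)" using red_left[OF assms(1) i] by blast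
    have "DCc i (Xi \<beta>) = Xi \<beta>" unfolding Xi[OF u] by (simp add: DCc_idem[OF I_J[OF i]])
    then show ?thesis using DCc_fixed_iff[OF I_J[OF i]] by simp
  qed
  obtain w where w: "set w \<subseteq> I" "v = E w" using assms(2) by (auto simp: Wfin_word)
  have "set w \<subseteq> I \<Longrightarrow> tau (E w) (Xi \<beta>) = Xi \<beta>"
  proof (induction w)
    case Nil then show ?case by (simp add: tau_one)
  next
    case (Cons i w)
    then have i: "i \<in> I" and "set w \<subseteq> J" using I_J by auto
    then show ?case using Cons by (simp add: tau_mul[OF gen_W[OF I_J[OF i]] word_Waf] gen)
  qed
  then show ?thesis using w by simp
qed

lemma DCc_mult_invariant:
  assumes "i \<in> J" "\<And>v. v \<in> WI \<Longrightarrow> tau v D = D"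
  shows "DCc i (C * D) = DCc i C * D"
  using tau_mult[OF gen_W[OF assms(1)], of C D] assms(2)[OF Waf_fin(1)[OF gen_W[OF assms(1)]]]
  by (simp add: DCc_def algebra_simps)

lemma DCc_word_mult_invariant:
  assumes "set w \<subseteq> J" "\<And>v. v \<in> WI \<Longrightarrow> tau v D = D"
  shows "foldr DCc w (C * D) = foldr DCc w C * D"
  using assms(1) by (induction w) (simp_all add: DCc_mult_invariant assms(2))

lemma Xi_product:
  assumes "ascI w" "antidominant \<beta>"
  shows "Xi (fst w) * Xi \<beta> = Xi (fst (w \<cdot> transl \<beta>))"
proof -
  have one: "ascI wone" using wone_W apos_al I_J by (auto simp: ascI_def)
  have t: "ascI (transl \<beta>)" using len_antidominant(2)[OF one assms(2)] by simp
  obtain u v where u: "red w u" and v: "red (transl \<beta>) v"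
    using reduced_exists assms(1) t unfolding ascI_def by blast
  have "Xi (fst w) * Xi \<beta> = foldr DCc u 1 * Xi \<beta>" using Xi_eq[OF assms(1) u] by simp
  also have "\<dots> = foldr DCc u (Xi \<beta>)"
    using DCc_word_mult_invariant[OF redD(1)[OF u] Xi_invariant[OF assms(2)], of 1] by simp
  also have "\<dots> = foldr DCc (u @ v) 1" using Xi_eq[OF t v] by (simp add: transl_def)
  also have "\<dots> = Xi (fst (w \<cdot> transl \<beta>))"
    using Xi_eq[OF len_antidominant(2)[OF assms] red_append[OF u v len_antidominant(1)[OF assms]]] by simp
  finally show ?thesis .
qed

section \<open>Triangularity and independence of the classes\<close>

definition min_len :: "wt \<Rightarrow> nat" where "min_len \<gamma> = (LEAST k. \<exists>z\<in>W. fst z = \<gamma> \<and> \<l> z = k)"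

lemma min_len_le: "z \<in> W \<Longrightarrow> min_len (fst z) \<le> \<l> z"
  unfolding min_len_def by (rule Least_le) blast

lemma min_len_attained: "z \<in> W \<Longrightarrow> \<exists>y\<in>W. fst y = fst z \<and> \<l> y = min_len (fst z)"
proof -
  assume "z \<in> W"
  then have "\<exists>k. \<exists>y\<in>W. fst y = fst z \<and> \<l> y = k" by blast
  from LeastI_ex[OF this] show ?thesis unfolding min_len_def .
qed

lemma min_len_word: "set vs \<subseteq> J \<Longrightarrow> min_len (fst (E vs)) \<le> length vs"
  using min_len_le[OF word_Waf] len_le order_trans by blast

text \<open>The product of operators expands over subwords of \<open>ws\<close>. The full word is a
  separate alternative because, when \<open>ws\<close> is minimal, only it can reach the leading
  index.\<close>

lemma DCc_support:
  "set ws \<subseteq> J \<Longrightarrow> lk (foldr DCc ws 1) \<gamma> \<noteq> 0 \<Longrightarrow>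
    \<exists>vs. set vs \<subseteq> J \<and> fst (E vs) = \<gamma> \<and> (length vs < length ws \<or> vs = ws)"
proof (induction ws arbitrary: \<gamma>)
  case Nil
  then have "\<gamma> = 0" by (simp add: lookup_one when_def split: if_splits)
  then show ?case by (intro exI[of _ "[]"]) (simp add: wone_def)
next
  case (Cons i ws)
  then have i: "i \<in> J" and ws: "set ws \<subseteq> J" by auto
  let ?c = "foldr DCc ws 1"
  have "lk ?c \<gamma> \<noteq> 0 \<or> lk ?c (cact (s i) \<gamma>) \<noteq> 0"
    using Cons.prems(2) actW_hom(3)[OF gen_W[OF i]] by (auto simp: lookup_DCc_at[OF i])
  then show ?case
  proof
    assume "lk ?c \<gamma> \<noteq> 0"
    from Cons.IH[OF ws this] obtain vs where "set vs \<subseteq> J" "fst (E vs) = \<gamma>" "length vs < length ws \<or> vs = ws" by blast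
    then show ?thesis by (intro exI[of _ vs]) auto
  next
    assume "lk ?c (cact (s i) \<gamma>) \<noteq> 0"
    from Cons.IH[OF ws this] obtain vs where vs: "set vs \<subseteq> J" "fst (E vs) = cact (s i) \<gamma>" "length vs < length ws \<or> vs = ws" by blast
    then have "fst (E (i # vs)) = \<gamma>" by (simp add: fst_mul cact_invol[OF i])
    then show ?thesis using vs i by (intro exI[of _ "i # vs"]) auto
  qed
qed

text \<open>At the leading index only the s_i part of the outermost operator contributes: the other
  part would represent the same coset by a word shorter than the minimum.\<close>

lemma DCc_leading:
  "set ws \<subseteq> J \<Longrightarrow> min_len (fst (E ws)) = length ws \<Longrightarrow> lk (foldr DCc ws 1) (fst (E ws)) \<noteq> 0"
proof (induction ws)
  case Nil then show ?case by (simp add: wone_def)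
next
  case (Cons i ws)
  then have i: "i \<in> J" and ws: "set ws \<subseteq> J" by auto
  let ?\<gamma> = "fst (E (i # ws))" and ?\<delta> = "fst (E ws)" and ?c = "foldr DCc ws 1"
  have g: "?\<gamma> = cact (s i) ?\<delta>" by (simp add: fst_mul)
  \<comment> \<open>A tail of a minimal word is minimal, since prepending s_i lengthens a
    representative by at most one.\<close>
  have "min_len ?\<delta> = length ws"
  proof (rule antisym[OF min_len_word[OF ws]], rule ccontr)
    assume lt: "\<not> length ws \<le> min_len ?\<delta>"
    obtain z where z: "z \<in> W" "fst z = ?\<delta>" "\<l> z = min_len ?\<delta>" using min_len_attained[OF word_Waf[OF ws]] by blast
    have "min_len (fst (s i \<cdot> z)) \<le> \<l> (s i \<cdot> z)" using min_len_le W_mul gen_W i z by blast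
    also have "\<dots> \<le> Suc (\<l> z)" using len_mul_le[OF gen_W[OF i] z(1)] len_gen_le[OF i] by simp
    finally show False using lt z Cons.prems(2) g by (simp add: fst_mul)
  qed
  then have nz: "lk ?c ?\<delta> \<noteq> 0" using Cons.IH ws by blast
  have "lk ?c ?\<gamma> = 0"
  proof (rule ccontr)
    assume "lk ?c ?\<gamma> \<noteq> 0"
    then obtain vs where "set vs \<subseteq> J" "fst (E vs) = ?\<gamma>" "length vs \<le> length ws" using DCc_support[OF ws] by fastforce
    then show False using min_len_word[of vs] Cons.prems(2) by simp
  qed
  moreover have "actW (s i) (lk ?c ?\<delta>) \<noteq> 0" using nz actW_invol[OF i] actW_hom(3)[OF gen_W[OF i]] by metis
  ultimately show ?case using eK_nz[of "rw i"] eK_rw[OF i] cact_invol[OF i] g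
    by (simp add: lookup_DCc_at[OF i])
qed

lemma Xi_triangular:
  assumes "L \<delta>" shows "lk (Xi \<delta>) \<delta> \<noteq> 0" "\<gamma> \<noteq> \<delta> \<Longrightarrow> lk (Xi \<delta>) \<gamma> \<noteq> 0 \<Longrightarrow> min_len \<gamma> < min_len \<delta>"
proof -
  have "fst (transl \<delta>) = \<delta>" by (simp add: transl_def)
  then obtain y where y: "ascI y" "fst y = \<delta>" "\<And>z. z \<in> W \<Longrightarrow> fst z = \<delta> \<Longrightarrow> \<l> y \<le> \<l> z"
    using ascI_exists[OF transl_W[OF assms]] by metis
  have yW: "y \<in> W" using y by (simp add: ascI_def)
  obtain u where u: "red y u" using reduced_exists yW by blast
  note r = redD[OF u]
  have "min_len \<delta> = \<l> y" using min_len_le[OF yW] min_len_attained[OF yW] y by (metis antisym)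
  then have m: "min_len (fst (E u)) = length u" "fst (E u) = \<delta>" using r y by simp_all
  have Xi: "Xi \<delta> = foldr DCc u 1" using Xi_eq[OF y(1) u] y by simp
  show "lk (Xi \<delta>) \<delta> \<noteq> 0" using DCc_leading[OF r(1) m(1)] m Xi by simp
  assume "\<gamma> \<noteq> \<delta>" "lk (Xi \<delta>) \<gamma> \<noteq> 0"
  then obtain vs where "set vs \<subseteq> J" "fst (E vs) = \<gamma>" "length vs < length u"
    using DCc_support[OF r(1)] Xi m by metis
  then show "min_len \<gamma> < min_len \<delta>" using min_len_word[of vs] m by simp
qed

text \<open>Among the indices with nonzero coefficient take delta with \<open>min_len\<close>
  maximal and read the coefficient at delta: by triangularity the other classes vanish
  there.\<close>

lemma Xi_independent:
  assumes "finite S" "\<And>\<gamma>. \<gamma> \<in> S \<Longrightarrow> L \<gamma>" "(\<Sum>\<gamma>\<in>S. cst (z \<gamma>) * Xi \<gamma>) = 0" "\<gamma> \<in> S"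
  shows "z \<gamma> = 0"
proof (rule ccontr)
  assume "z \<gamma> \<noteq> 0"
  then have ne: "{\<gamma> \<in> S. z \<gamma> \<noteq> 0} \<noteq> {}" and fin: "finite {\<gamma> \<in> S. z \<gamma> \<noteq> 0}" using assms(1,4) by auto
  obtain \<delta> where "\<delta> \<in> {\<gamma> \<in> S. z \<gamma> \<noteq> 0}" and max: "\<And>\<gamma>. \<gamma> \<in> {\<gamma> \<in> S. z \<gamma> \<noteq> 0} \<Longrightarrow> min_len \<gamma> \<le> min_len \<delta>"
    using obtain_max[OF fin ne, of min_len] by blast
  then have d: "\<delta> \<in> S" "z \<delta> \<noteq> 0" "\<And>\<gamma>. \<gamma> \<in> S \<Longrightarrow> z \<gamma> \<noteq> 0 \<Longrightarrow> min_len \<gamma> \<le> min_len \<delta>" by auto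
  have "0 = (\<Sum>\<gamma>\<in>S. z \<gamma> * lk (Xi \<gamma>) \<delta>)"
    using arg_cong[OF assms(3), of "\<lambda>C. lk C \<delta>"] by (simp add: lookup_sum lookup_single0_mult)
  also have "\<dots> = z \<delta> * lk (Xi \<delta>) \<delta> + (\<Sum>\<gamma>\<in>S-{\<delta>}. z \<gamma> * lk (Xi \<gamma>) \<delta>)"
    using assms(1) d(1) by (rule sum.remove)
  also have "(\<Sum>\<gamma>\<in>S-{\<delta>}. z \<gamma> * lk (Xi \<gamma>) \<delta>) = 0"
  proof (rule sum.neutral, rule ballI, rule ccontr)
    fix \<gamma> assume g: "\<gamma> \<in> S - {\<delta>}" "z \<gamma> * lk (Xi \<gamma>) \<delta> \<noteq> 0"
    then have "min_len \<delta> < min_len \<gamma>" using Xi_triangular(2)[of \<gamma> \<delta>] assms(2) by auto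
    then show False using d(3)[of \<gamma>] g by auto
  qed
  finally show False using d(2) Xi_triangular(1)[OF assms(2)[OF d(1)]] by simp
qed

section \<open>The projection of the twisted group algebra and the map Phi\<close>

lemma pr_sum: "pr (X + Y) = pr X + pr Y"
  unfolding pr_def by (rule setsum_keys_plus_distrib) (simp_all add: single_add)

lemma pr_single: "pr (msingle w a) = msingle (fst w) a"
  by (simp add: pr_def)

lemma pr_finite_sum: "pr (sum f S) = (\<Sum>i\<in>S. pr (f i))"
  by (induction S rule: infinite_finite_induct) (simp_all add: pr_sum, simp_all add: pr_def)

text \<open>A triple in \<open>waf\<close> outside the group need not act by a field homomorphism,
  so products are controlled on elements supported in the group.\<close>

definition Wsupp :: "Aalg \<Rightarrow> bool" where "Wsupp X \<longleftrightarrow> mkeys X \<subseteq> W"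

lemma pr_amul:
  assumes "Wsupp X"
  shows "pr (amul X Y) = (\<Sum>w\<in>mkeys X. cst (lk X w) * tau w (pr Y))"
  unfolding amul_def pr_finite_sum
proof (rule sum.cong[OF HOL.refl])
  fix w assume "w \<in> mkeys X"
  then have w: "w \<in> W" using assms by (auto simp: Wsupp_def)
  have "tau w (pr Y) = (\<Sum>v\<in>mkeys Y. msingle (cact w (fst v)) (actW w (lk Y v)))"
    unfolding tau_def pr_def by (simp add: push_map_sum push_map_single actW_hom[OF w])
  then show "(\<Sum>v\<in>mkeys Y. pr (msingle (w \<cdot> v) (lk X w * actW w (lk Y v))))
      = cst (lk X w) * tau w (pr Y)"
    by (simp add: pr_single fst_mul sum_distrib_left mult_single)
qed

lemma amul_supp: assumes "Wsupp X" "Wsupp Y" shows "Wsupp (amul X Y)"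
proof -
  have "lk (amul X Y) z = 0" if z: "z \<notin> W" for z
    unfolding amul_def lookup_sum
  proof (intro sum.neutral ballI)
    fix w v assume "w \<in> mkeys X" "v \<in> mkeys Y"
    then have "w \<in> W" "v \<in> W" using assms by (auto simp: Wsupp_def)
    then have "w \<cdot> v \<in> W" by (rule W_mul)
    then have "w \<cdot> v \<noteq> z" using z by blast
    then show "lk (msingle (w \<cdot> v) (lk X w * actW w (lk Y v))) z = 0" by (rule lookup_single_not_eq)
  qed
  then show ?thesis unfolding Wsupp_def by (metis in_keys_iff subsetI)
qed

lemma iD_eq: "i \<in> J \<Longrightarrow> iD n A i = msingle wone (1 / (1 - eK (rw i)))
    + msingle (s i) (- (eK (rw i) / (1 - eK (rw i))))"
  by (simp add: iD_def rw_def single_uminus Let_def)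

lemma iD_supp: "i \<in> J \<Longrightarrow> Wsupp (iD n A i)"
  unfolding Wsupp_def iD_eq using gen_W[of i] wone_W keys_add
  by (intro order_trans[OF keys_add]) auto

lemma pr_iD: assumes "i \<in> J" shows "pr (amul (iD n A i) Y) = DCc i (pr Y)"
proof -
  let ?R = "\<lambda>X. \<Sum>w\<in>mkeys X. cst (lk X w) * tau w (pr Y)"
  have add: "?R (X + X') = ?R X + ?R X'" for X X'
    by (rule setsum_keys_plus_distrib) (simp_all add: single_add algebra_simps)
  have sing: "?R (msingle w a) = cst a * tau w (pr Y)" for w a by simp
  show ?thesis unfolding pr_amul[OF iD_supp[OF assms]] unfolding iD_eq[OF assms] add sing
    by (simp add: tau_one DCc_def)
qed

lemma aone_supp: "Wsupp aone" using wone_W by (simp add: Wsupp_def aone_def)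

lemma pr_aone: "pr aone = 1" by (simp add: aone_def pr_single wone_def)

lemma word_supp: "set ws \<subseteq> J \<Longrightarrow> Wsupp (foldr amul (map (iD n A) ws) aone)"
  by (induction ws) (simp_all add: aone_supp amul_supp iD_supp)

lemma pr_word: "set ws \<subseteq> J \<Longrightarrow> pr (foldr amul (map (iD n A) ws) aone) = foldr DCc ws 1"
  by (induction ws) (simp_all add: pr_aone pr_iD)

lemma Dimg_word: assumes "x \<in> W" obtains ws where "red x ws" "Dimg n A x = foldr amul (map (iD n A) ws) aone"
    "ws = (SOME ws. red x ws)"
  using someI_ex[OF reduced_exists[OF assms]] by (simp add: Dimg_def)

text \<open>The word chosen in \<open>Dimg\<close> ranges a priori over all affine letters;
  independence of the word replaces it by one in I, whose operators fix 1.\<close>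

lemma pr_w0: "pr (Dimg n A (w0 n A)) = 1"
proof -
  obtain ws where ws: "red (w0 n A) ws" "Dimg n A (w0 n A) = foldr amul (map (iD n A) ws) aone"
    by (rule Dimg_word[OF Wfin_Waf[OF w0_WI]])
  obtain v where v: "red (w0 n A) v" "set v \<subseteq> I" using WI_red[OF w0_WI] by blast
  have "foldr DCc ws 1 = foldr DCc v 1" using DCc_red[OF _ _ _ ws(1) v(1)] by metis
  then show ?thesis using pr_word[OF redD(1)[OF ws(1)]] ws(2) DCc_unit[OF v(2)] by simp
qed

lemma amul_aone: assumes "Wsupp X" shows "amul X aone = X"
proof -
  have "amul X aone = (\<Sum>w\<in>mkeys X. msingle (w \<cdot> wone) (lk X w * actW w 1))"
    by (simp add: amul_def aone_def)
  also have "\<dots> = (\<Sum>w\<in>mkeys X. msingle w (lk X w))"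
  proof (rule sum.cong[OF HOL.refl])
    fix w assume "w \<in> mkeys X"
    then have "w \<in> W" using assms by (auto simp: Wsupp_def)
    then show "msingle (w \<cdot> wone) (lk X w * actW w 1) = msingle w (lk X w)"
      by (simp add: actW_hom W_good)
  qed
  also have "\<dots> = X" by (rule poly_mapping_expand[symmetric])
  finally show ?thesis .
qed

lemma pr_class: assumes "L \<beta>" shows "pr (amul (Dimg n A (transl \<beta>)) (Dimg n A (w0 n A))) = Xi \<beta>"
proof -
  obtain ws where ws: "red (transl \<beta>) ws" "Dimg n A (transl \<beta>) = foldr amul (map (iD n A) ws) aone"
      "ws = (SOME ws. red (transl \<beta>) ws)"
    by (rule Dimg_word[OF transl_W[OF assms]])
  note J = redD(1)[OF ws(1)]
  let ?X = "foldr amul (map (iD n A) ws) aone"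
  \<comment> \<open>D of the longest element and the unit have the same projection 1, so one may
    replace the other as right factor under \<open>pr\<close>.\<close>
  have "pr (amul ?X (Dimg n A (w0 n A))) = pr (amul ?X aone)"
    unfolding pr_amul[OF word_supp[OF J]] pr_w0 pr_aone ..
  also have "\<dots> = foldr DCc ws 1" unfolding amul_aone[OF word_supp[OF J]] by (rule pr_word[OF J])
  also have "\<dots> = Xi \<beta>" unfolding Xi_def ws(3)[symmetric] ..
  finally show ?thesis using ws(2) by simp
qed

lemma pr_scalar: "pr (amul (msingle wone k) Y) = cst k * pr Y"
proof -
  have "Wsupp (msingle wone k)" using wone_W by (simp add: Wsupp_def)
  from pr_amul[OF this, of Y] show ?thesis by (cases "k = 0") (simp_all add: tau_one)
qed

lemma Phi_eq:
  assumes "x \<in> KHset n" "finite S" "mkeys x \<subseteq> S"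
  shows "Phi n A x = (\<Sum>\<beta>\<in>S. cst (Fract (lk x \<beta>) 1) * Xi \<beta>)"
proof -
  have "Phi n A x = (\<Sum>\<beta>\<in>mkeys x. cst (Fract (lk x \<beta>) 1) * Xi \<beta>)"
    unfolding Phi_def pr_scalar
    by (intro sum.cong arg_cong2[where f = "(*)"] HOL.refl pr_class) (use assms(1) in \<open>auto simp: KHset_def\<close>)
  also have "\<dots> = (\<Sum>\<beta>\<in>S. cst (Fract (lk x \<beta>) 1) * Xi \<beta>)"
    by (rule sum.mono_neutral_left) (use assms in \<open>auto simp: in_keys_iff fract_collapse\<close>)
  finally show ?thesis .
qed

text \<open>\<open>pontryagin\<close> is built with \<open>inv_into\<close>, which returns a given
  preimage in \<open>KHset\<close> once \<open>Phi\<close> is injective there.\<close>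

lemma Phi_inj: "inj_on (Phi n A) (KHset n)"
proof (rule inj_onI)
  fix x y assume xy: "x \<in> KHset n" "y \<in> KHset n" and eq: "Phi n A x = Phi n A y"
  let ?S = "mkeys x \<union> mkeys y" and ?z = "\<lambda>\<beta>. Fract (lk x \<beta>) 1 - Fract (lk y \<beta>) (1::CP)"
  have "(\<Sum>\<beta>\<in>?S. cst (?z \<beta>) * Xi \<beta>) = Phi n A x - Phi n A y"
    using Phi_eq[OF xy(1), of ?S] Phi_eq[OF xy(2), of ?S]
    by (simp add: single_diff left_diff_distrib sum_subtractf del: diff_fract)
  then have 0: "(\<Sum>\<beta>\<in>?S. cst (?z \<beta>) * Xi \<beta>) = 0" by (simp only: eq diff_self)
  have L: "L \<beta>" if "\<beta> \<in> ?S" for \<beta> using that xy by (auto simp: KHset_def)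
  show "x = y"
  proof (rule poly_mapping_eqI)
    fix \<beta>
    show "lk x \<beta> = lk y \<beta>"
    proof (cases "\<beta> \<in> ?S")
      case True
      have "?z \<beta> = 0" by (rule Xi_independent[OF _ L 0 True]) simp
      then have "Fract (lk x \<beta>) 1 = Fract (lk y \<beta>) 1" by (simp only: right_minus_eq)
      then show ?thesis by (simp add: eq_fract)
    next
      case False then show ?thesis by (simp add: in_keys_iff)
    qed
  qed
qed

lemma OGr_KHset: "L \<beta> \<Longrightarrow> OGr \<beta> \<in> KHset n"
  by (auto simp: KHset_def OGr_def lookup_single when_def split: if_splits)

lemma Phi_OGr: assumes "L \<beta>" shows "Phi n A (OGr \<beta>) = Xi \<beta>"
  using Phi_eq[OF OGr_KHset[OF assms], of "{\<beta>}"] by (simp add: OGr_def fract_collapse)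

lemma pontryagin_OGr:
  assumes "w \<in> Waf_minus n A" "antidominant \<beta>"
  shows "pontryagin n A (OGr (fst w)) (OGr \<beta>) = OGr (fst (w \<cdot> transl \<beta>))"
proof -
  have a: "ascI w" using assms(1) by (rule Waf_minus_ascI)
  have L: "L (fst w)" "L \<beta>" "L (fst (w \<cdot> transl \<beta>))"
    using a assms(2) len_antidominant(2)[OF a assms(2)] Waf_fin(2) by (auto simp: ascI_def antidominant_def)
  have "Phi n A (OGr (fst w)) * Phi n A (OGr \<beta>) = Phi n A (OGr (fst (w \<cdot> transl \<beta>)))"
    using Xi_product[OF a assms(2)] L by (simp add: Phi_OGr)
  then show ?thesis unfolding pontryagin_def using inv_into_f_f[OF Phi_inj OGr_KHset[OF L(3)]] by simp
qed

end

theorem theorem1p8: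
  fixes n :: nat and A :: "nat \<Rightarrow> nat \<Rightarrow> int" and w :: waf and \<beta> :: wt
  assumes "simple_cartan n A"
    and "w \<in> Waf_minus n A"
    and "in_lattice n \<beta>"
    and "\<forall>i\<in>Iset n. pairing n \<beta> (alphaW n A i) < 0"
  shows "pontryagin n A (OGr (fst w)) (OGr \<beta>) = OGr (fst (wmul w (transl \<beta>)))"
proof -
  obtain d :: "nat \<Rightarrow> real" where d: "\<forall>i\<in>Iset n. d i > 0"
    "\<forall>i\<in>Iset n. \<forall>j\<in>Iset n. d i * of_int (A i j) = d j * of_int (A j i)"
    "\<forall>x::nat \<Rightarrow> real. (\<exists>i\<in>Iset n. x i \<noteq> 0) \<longrightarrow>
        0 < (\<Sum>i\<in>Iset n. \<Sum>j\<in>Iset n. x i * d i * of_int (A i j) * x j)"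
    using assms(1) unfolding simple_cartan_def finite_type_def by blast
  interpret cartan n A d
    using assms(1) d unfolding simple_cartan_def gen_cartan_def by unfold_locales blast+
  show ?thesis using assms by (intro pontryagin_OGr) (auto simp: antidominant_def)
qed

end
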